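(* Let $T>0$, let $\{\mathcal{N}^n\}_{n\ge 0}$ be an expanding network in $\mathbf{R}^d$ (with intrinsic distances $\delta_n$ on $\mathcal{N}^n$), and let $\mathcal{N}\subset\mathbf{R}^d$ carry the intrinsic distance $\tilde d$. Assume: (1) $\mathcal{N}$ is compact and $d_H(\mathcal{N}^n,\mathcal{N})\to 0$ as $n\to\infty$, where $d_H$ is the Hausdorff distance on $\mathbf{R}^d$. (2) For all sequences $a_n,b_n\in\mathcal{N}^n$ converging to $a,b\in\mathcal{N}$ respectively with respect to $\tilde d$, one has $\delta_n(a_n,b_n)\to\tilde d(a,b)$ as $n\to\infty$. (3) For all sequences $a_n,b_n\in\mathcal{N}$, if $\lim_{n\to\infty}d_E(a_n,b_n)=0$ then $\lim_{n\to\infty}\tilde d(a_n,b_n)=0$, where $d_E$ is the Euclidean distance. (4) There is a constant $C>0$ such that $\tilde d(a,b)\le C$ for all $a,b\in\mathcal{N}$. Let $V\in C(\mathcal{N})$, $H(x,p)=\frac12|p|^2+V(x)$ for $(x,p)\in\mathcal{N}\times[0,\infty)$, and let $g:\mathcal{N}\to\mathbf{R}$ be Lipschitz continuous. Put $H_n=H|_{\mathcal{N}^n\times[0,\infty)}$ and $g_n=g|_{\mathcal{N}^n}$. For each $n\ge 0$ let $u_n$ be the unique viscosity solution on $(\mathcal{N}^n,\delta_n)$ of $$\partial_t u+H_n(x,|\nabla u|)=0\ \text{ in }(0,T)\times\mathcal{N}^n,\qquad u(0,x)=g_n(x)\ \text{ for }x\in\mathcal{N}^n.$$ Then there exists a viscosity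 solution $u:[0,T)\times\mathcal{N}\to\mathbf{R}$ on $(\mathcal{N},\tilde d)$ of $$\partial_t u+H(x,|\nabla u|)=0\ \text{ in }(0,T)\times\mathcal{N},\qquad u(0,x)=g(x)\ \text{ for }x\in\mathcal{N},$$ such that for every $m\ge 0$ the sequence $u_n$ ($n\ge m$) converges to $u$ uniformly on $[0,T)\times\mathcal{N}^m$.
   Context: **Networks.** Let $V=\{v_i\mid i\in I\}$ be a finite set of distinct points of $\mathbf{R}^d$ and $\{\pi_j\mid j\in J\}$ a finite set of (non-self-intersecting) line segments $\pi_j:[0,1]\to\mathbf{R}^d$. Put $e_j=\pi_j((0,1))$, $\bar e_j=\pi_j([0,1])$, $E=\{e_j\mid j\in J\}$. Assume: (i) $\pi_j(0),\pi_j(1)\in V$ for all $j$; (ii) $\#(\bar e_j\cap V)=2$ for all $j$; (iii) for $j\ne k$, $\bar e_j\cap\bar e_k\subset V$ and $\#(\bar e_j\cap\bar e_k)\le 1$; (iv) any two $v,w\in V$ are connected by a path of edges. Then $(V,E)$ is a graph and $\bigcup_{j\in J}\bar e_j$ is the corresponding network. **Expanding networks.** A sequence of networks $\{\mathcal{N}^n\}_{n\ge0}$ corresponding to graphs $(V^n,E^n)$ in $\mathbf{R}^d$ is an expanding network if (a) $\mathcal{N}^n\subset\mathcal{N}^{n+1}$ and $V^n\subset V^{n+1}$ for all $n\ge 0$; (b) for each $v\in\bigcup_n V^n$ there exist $m\ge0$ and $r>0$ such that $v\in V^m$ and $B_r(v)\cap\mathcal{N}^l=B_r(v)\cap\mathcal{N}^m$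 for all $l\ge m$, where $B_r(v)$ is the open Euclidean ball. **Distances.** $\delta_n(x,y)=\inf_\gamma L(\gamma)$ over rectifiable curves $\gamma$ in $\mathcal{N}^n$ connecting $x,y\in\mathcal{N}^n$, and $\tilde d(x,y)=\inf_\gamma L(\gamma)$ over rectifiable curves in $\mathcal{N}$ connecting $x,y\in\mathcal{N}$, where $L$ is Euclidean length. Lipschitz continuity of $g$ is with respect to $\tilde d$; continuity of $V$ on $\mathcal N$ is for the Euclidean topology. **Slopes.** For a function $f$ on a metric space $(\Omega,d)$, with $[s]_+=\max\{0,s\}$ and $[s]_-=\max\{0,-s\}$, $$|\nabla f(x)|=\limsup_{y\to x}\frac{|f(y)-f(x)|}{d(y,x)},\qquad |\nabla^{\pm} f(x)|=\limsup_{y\to x}\frac{[f(y)-f(x)]_\pm}{d(y,x)}.$$ **Test functions.** $\underline{\mathbf{C}}$ is the set of functions $\phi(t,x)=\phi_1(x)+\phi_2(t)$ on $(0,T)\times\Omega$ with $\phi_1:\Omega\to\mathbf{R}$ locally Lipschitz, $|\nabla\phi_1|=|\nabla^-\phi_1|$ on $\Omega$, $|\nabla^-\phi_1|$ continuous on $\Omega$, and $\phi_2\in C^1(0,T)$. $\overline{\mathbf{C}}=\{\phi: -\phi\in\underline{\mathbf{C}}\}$. **Viscosity solutions.** Let $(\Omega,d)$ be a complete geodesic space and consider $\partial_tu+H(x,|\nabla u|)=0$ in $(0,T)\times\Omega$, $u(0,\cdot)=g$. A locally bounded upper semicontinuous $u:[0,T)\times\Omega\to\mathbf{R}$ is a subsolution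 if $u(0,x)\le g(x)$ on $\Omega$ and, whenever $\phi=\phi_1+\phi_2\in\underline{\mathbf{C}}$ and $u-\phi$ has a local maximum at $(t,x)\in(0,T)\times\Omega$, $\phi_2'(t)+H(x,|\nabla\phi_1(x)|)\le0$. A locally bounded lower semicontinuous $u$ is a supersolution if $u(0,x)\ge g(x)$ on $\Omega$ and, whenever $\phi\in\overline{\mathbf{C}}$ and $u-\phi$ has a local minimum at $(t,x)\in(0,T)\times\Omega$, $\phi_2'(t)+H(x,|\nabla\phi_1(x)|)\ge0$. A viscosity solution is a locally bounded continuous function on $[0,T)\times\Omega$ that is both a subsolution and a supersolution. On $\mathcal{N}^n$ these notions are used with $d=\delta_n$, on $\mathcal{N}$ with $d=\tilde d$. *)

theory Defs
  imports "HOL-Analysis.Analysis"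
begin

section \<open>Networks\<close>

text \<open>The indexed family of segments is represented by the set \<open>P\<close> of its members. Nothing is lost:
  two distinct indices cannot carry the same segment, as the closed segments of distinct indices
  share at most one point. The requirement \<open>P \<noteq> {}\<close> makes the network a nonempty set.\<close>

definition network :: "(real \<Rightarrow> 'a::euclidean_space) set \<Rightarrow> 'a set" where
  "network P = (\<Union>p\<in>P. path_image p)"

definition joined :: "(real \<Rightarrow> 'a::euclidean_space) set \<Rightarrow> ('a \<times> 'a) set" where
  "joined P = {(v, w). \<exists>p\<in>P. {p 0, p 1} = {v, w}}"

definition network_graph :: "'a::euclidean_space set \<Rightarrow> (real \<Rightarrow> 'a) set \<Rightarrow> bool" where
  "network_graph V P \<longleftrightarrow>
     finite V \<and> finite P \<and> P \<noteq> {} \<and>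
     (\<forall>p\<in>P. \<exists>a b. a \<noteq> b \<and> p = linepath a b) \<and>
     (\<forall>p\<in>P. p 0 \<in> V \<and> p 1 \<in> V) \<and>
     (\<forall>p\<in>P. card (path_image p \<inter> V) = 2) \<and>
     (\<forall>p\<in>P. \<forall>q\<in>P. p \<noteq> q \<longrightarrow>
        path_image p \<inter> path_image q \<subseteq> V \<and>
        finite (path_image p \<inter> path_image q) \<and> card (path_image p \<inter> path_image q) \<le> 1) \<and>
     (\<forall>v\<in>V. \<forall>w\<in>V. (v, w) \<in> (joined P)\<^sup>*)"

definition expanding_network ::
    "(nat \<Rightarrow> 'a::euclidean_space set) \<Rightarrow> (nat \<Rightarrow> (real \<Rightarrow> 'a) set) \<Rightarrow> bool" where
  "expanding_network V P \<longleftrightarrow>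
     (\<forall>n. network_graph (V n) (P n)) \<and>
     (\<forall>n. network (P n) \<subseteq> network (P (Suc n)) \<and> V n \<subseteq> V (Suc n)) \<and>
     (\<forall>v\<in>(\<Union>n. V n). \<exists>m r. r > 0 \<and> v \<in> V m \<and>
        (\<forall>l\<ge>m. ball v r \<inter> network (P l) = ball v r \<inter> network (P m)))"


section \<open>Intrinsic and Hausdorff distances\<close>

definition curve_length :: "(real \<Rightarrow> 'a::metric_space) \<Rightarrow> ennreal" where
  "curve_length \<gamma> =
     (SUP (k, t) \<in> {(k :: nat, t :: nat \<Rightarrow> real). mono t \<and> range t \<subseteq> {0..1}}.
        ennreal (\<Sum>i<k. dist (\<gamma> (t i)) (\<gamma> (t (Suc i)))))"

definition rectifiable_curves :: "'a::metric_space set \<Rightarrow> 'a \<Rightarrow> 'a \<Rightarrow> (real \<Rightarrow> 'a) set" where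
  "rectifiable_curves S x y =
     {\<gamma>. path \<gamma> \<and> path_image \<gamma> \<subseteq> S \<and> pathstart \<gamma> = x \<and> pathfinish \<gamma> = y \<and> curve_length \<gamma> < \<infinity>}"

text \<open>Extended-valued, so that the distance of points not joined by a rectifiable curve is infinite.
  The real-valued version is the metric used once finiteness is known.\<close>

definition intrinsic_edist :: "'a::metric_space set \<Rightarrow> 'a \<Rightarrow> 'a \<Rightarrow> ennreal" where
  "intrinsic_edist S x y = (INF \<gamma>\<in>rectifiable_curves S x y. curve_length \<gamma>)"

definition intrinsic_dist :: "'a::metric_space set \<Rightarrow> 'a \<Rightarrow> 'a \<Rightarrow> real" where
  "intrinsic_dist S x y = enn2real (intrinsic_edist S x y)"

text \<open>The distance between an empty and a nonempty set is infinite.\<close>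

definition hausdorff_edist :: "'a::metric_space set \<Rightarrow> 'a set \<Rightarrow> ennreal" where
  "hausdorff_edist A B =
     (INF \<epsilon>\<in>{\<epsilon>::real. \<epsilon> > 0 \<and> (\<forall>a\<in>A. \<exists>b\<in>B. dist a b \<le> \<epsilon>) \<and> (\<forall>b\<in>B. \<exists>a\<in>A. dist a b \<le> \<epsilon>)}.
        ennreal \<epsilon>)"


section \<open>Slopes and test functions on a metric space \<open>(\<Omega>, d)\<close>\<close>

text \<open>The values lie in \<open>[0, \<infinity>]\<close>; hence the upper limit is \<open>0\<close> at an isolated point.\<close>

definition slope :: "'a set \<Rightarrow> ('a \<Rightarrow> 'a \<Rightarrow> real) \<Rightarrow> ('a \<Rightarrow> real) \<Rightarrow> 'a \<Rightarrow> ennreal" where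
  "slope \<Omega> d f x =
     Limsup (atin (Metric_space.mtopology \<Omega> d) x) (\<lambda>y. ennreal (\<bar>f y - f x\<bar> / d y x))"

definition subslope :: "'a set \<Rightarrow> ('a \<Rightarrow> 'a \<Rightarrow> real) \<Rightarrow> ('a \<Rightarrow> real) \<Rightarrow> 'a \<Rightarrow> ennreal" where
  "subslope \<Omega> d f x =
     Limsup (atin (Metric_space.mtopology \<Omega> d) x) (\<lambda>y. ennreal (max 0 (- (f y - f x)) / d y x))"

definition lipschitz_wrt :: "('a \<Rightarrow> 'a \<Rightarrow> real) \<Rightarrow> 'a set \<Rightarrow> ('a \<Rightarrow> real) \<Rightarrow> bool" where
  "lipschitz_wrt d S f \<longleftrightarrow> (\<exists>L. \<forall>x\<in>S. \<forall>y\<in>S. \<bar>f x - f y\<bar> \<le> L * d x y)"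

definition locally_lipschitz_wrt :: "('a \<Rightarrow> 'a \<Rightarrow> real) \<Rightarrow> 'a set \<Rightarrow> ('a \<Rightarrow> real) \<Rightarrow> bool" where
  "locally_lipschitz_wrt d \<Omega> f \<longleftrightarrow>
     (\<forall>x\<in>\<Omega>. \<exists>r>0. lipschitz_wrt d (Metric_space.mball \<Omega> d x r) f)"

text \<open>\<open>lower_test T \<Omega> d \<phi>\<^sub>1 \<phi>\<^sub>2\<close> says that \<open>(t, x) \<mapsto> \<phi>\<^sub>1 x + \<phi>\<^sub>2 t\<close> belongs to the class of test
  functions for subsolutions. The decomposition is unique up to an additive constant, on which
  neither this condition nor the slope of \<open>\<phi>\<^sub>1\<close> and the derivative of \<open>\<phi>\<^sub>2\<close> depend.\<close>

definition lower_test ::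
    "real \<Rightarrow> 'a set \<Rightarrow> ('a \<Rightarrow> 'a \<Rightarrow> real) \<Rightarrow> ('a \<Rightarrow> real) \<Rightarrow> (real \<Rightarrow> real) \<Rightarrow> bool" where
  "lower_test T \<Omega> d \<phi>\<^sub>1 \<phi>\<^sub>2 \<longleftrightarrow>
     locally_lipschitz_wrt d \<Omega> \<phi>\<^sub>1 \<and>
     (\<forall>x\<in>\<Omega>. slope \<Omega> d \<phi>\<^sub>1 x = subslope \<Omega> d \<phi>\<^sub>1 x) \<and>
     continuous_map (Metric_space.mtopology \<Omega> d) euclidean (subslope \<Omega> d \<phi>\<^sub>1) \<and>
     \<phi>\<^sub>2 C1_differentiable_on {0<..<T}"

definition upper_test ::
    "real \<Rightarrow> 'a set \<Rightarrow> ('a \<Rightarrow> 'a \<Rightarrow> real) \<Rightarrow> ('a \<Rightarrow> real) \<Rightarrow> (real \<Rightarrow> real) \<Rightarrow> bool" where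
  "upper_test T \<Omega> d \<phi>\<^sub>1 \<phi>\<^sub>2 \<longleftrightarrow> lower_test T \<Omega> d (\<lambda>x. - \<phi>\<^sub>1 x) (\<lambda>t. - \<phi>\<^sub>2 t)"


section \<open>Viscosity solutions\<close>

definition locally_bounded_map :: "'b topology \<Rightarrow> ('b \<Rightarrow> real) \<Rightarrow> bool" where
  "locally_bounded_map X f \<longleftrightarrow>
     (\<forall>p\<in>topspace X. \<exists>U B. openin X U \<and> p \<in> U \<and> (\<forall>q\<in>U. \<bar>f q\<bar> \<le> B))"

definition usc_map :: "'b topology \<Rightarrow> ('b \<Rightarrow> real) \<Rightarrow> bool" where
  "usc_map X f \<longleftrightarrow> (\<forall>a. openin X {p \<in> topspace X. f p < a})"

definition lsc_map :: "'b topology \<Rightarrow> ('b \<Rightarrow> real) \<Rightarrow> bool" where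
  "lsc_map X f \<longleftrightarrow> (\<forall>a. openin X {p \<in> topspace X. f p > a})"

definition local_max_at :: "'b topology \<Rightarrow> ('b \<Rightarrow> real) \<Rightarrow> 'b \<Rightarrow> bool" where
  "local_max_at X f p \<longleftrightarrow> (\<exists>U. openin X U \<and> p \<in> U \<and> (\<forall>q\<in>U. f q \<le> f p))"

definition local_min_at :: "'b topology \<Rightarrow> ('b \<Rightarrow> real) \<Rightarrow> 'b \<Rightarrow> bool" where
  "local_min_at X f p \<longleftrightarrow> (\<exists>U. openin X U \<and> p \<in> U \<and> (\<forall>q\<in>U. f p \<le> f q))"

definition spacetime :: "real set \<Rightarrow> 'a set \<Rightarrow> ('a \<Rightarrow> 'a \<Rightarrow> real) \<Rightarrow> (real \<times> 'a) topology" where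
  "spacetime I \<Omega> d = prod_topology (top_of_set I) (Metric_space.mtopology \<Omega> d)"

text \<open>The problem \<open>\<partial>\<^sub>t u + H(x, |\<nabla>u|) = 0\<close> in \<open>(0, T) \<times> \<Omega>\<close>, \<open>u(0, \<cdot>) = g\<close>. Test functions are locally
  Lipschitz, so their slopes are finite and \<^const>\<open>enn2real\<close> only changes the type.\<close>

definition viscosity_subsolution ::
    "real \<Rightarrow> 'a set \<Rightarrow> ('a \<Rightarrow> 'a \<Rightarrow> real) \<Rightarrow> ('a \<Rightarrow> real \<Rightarrow> real) \<Rightarrow> ('a \<Rightarrow> real) \<Rightarrow>
     (real \<times> 'a \<Rightarrow> real) \<Rightarrow> bool" where
  "viscosity_subsolution T \<Omega> d H g u \<longleftrightarrow>
     locally_bounded_map (spacetime {0..<T} \<Omega> d) u \<and>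
     usc_map (spacetime {0..<T} \<Omega> d) u \<and>
     (\<forall>x\<in>\<Omega>. u (0, x) \<le> g x) \<and>
     (\<forall>\<phi>\<^sub>1 \<phi>\<^sub>2. \<forall>t\<in>{0<..<T}. \<forall>x\<in>\<Omega>.
        lower_test T \<Omega> d \<phi>\<^sub>1 \<phi>\<^sub>2 \<and>
        local_max_at (spacetime {0<..<T} \<Omega> d) (\<lambda>(s, y). u (s, y) - (\<phi>\<^sub>1 y + \<phi>\<^sub>2 s)) (t, x) \<longrightarrow>
        deriv \<phi>\<^sub>2 t + H x (enn2real (slope \<Omega> d \<phi>\<^sub>1 x)) \<le> 0)"

definition viscosity_supersolution ::
    "real \<Rightarrow> 'a set \<Rightarrow> ('a \<Rightarrow> 'a \<Rightarrow> real) \<Rightarrow> ('a \<Rightarrow> real \<Rightarrow> real) \<Rightarrow> ('a \<Rightarrow> real) \<Rightarrow>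
     (real \<times> 'a \<Rightarrow> real) \<Rightarrow> bool" where
  "viscosity_supersolution T \<Omega> d H g u \<longleftrightarrow>
     locally_bounded_map (spacetime {0..<T} \<Omega> d) u \<and>
     lsc_map (spacetime {0..<T} \<Omega> d) u \<and>
     (\<forall>x\<in>\<Omega>. u (0, x) \<ge> g x) \<and>
     (\<forall>\<phi>\<^sub>1 \<phi>\<^sub>2. \<forall>t\<in>{0<..<T}. \<forall>x\<in>\<Omega>.
        upper_test T \<Omega> d \<phi>\<^sub>1 \<phi>\<^sub>2 \<and>
        local_min_at (spacetime {0<..<T} \<Omega> d) (\<lambda>(s, y). u (s, y) - (\<phi>\<^sub>1 y + \<phi>\<^sub>2 s)) (t, x) \<longrightarrow>
        deriv \<phi>\<^sub>2 t + H x (enn2real (slope \<Omega> d \<phi>\<^sub>1 x)) \<ge> 0)"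

definition viscosity_solution ::
    "real \<Rightarrow> 'a set \<Rightarrow> ('a \<Rightarrow> 'a \<Rightarrow> real) \<Rightarrow> ('a \<Rightarrow> real \<Rightarrow> real) \<Rightarrow> ('a \<Rightarrow> real) \<Rightarrow>
     (real \<times> 'a \<Rightarrow> real) \<Rightarrow> bool" where
  "viscosity_solution T \<Omega> d H g u \<longleftrightarrow>
     locally_bounded_map (spacetime {0..<T} \<Omega> d) u \<and>
     continuous_map (spacetime {0..<T} \<Omega> d) euclideanreal u \<and>
     viscosity_subsolution T \<Omega> d H g u \<and>
     viscosity_supersolution T \<Omega> d H g u"

end

theory Submission
  imports Defs
begin

text \<open>
  The proof is the method of half-relaxed limits: the upper and the lower relaxed limit of the
  solutions \<open>u n\<close> are a sub- and a supersolution on the limit space, and a comparison principle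
  forces them to agree. Two points need care: the spaces and their metrics vary with \<open>n\<close>, and the
  test functions are those for which slope and subslope agree and are continuous.

  The networks and the limit space are compact geodesic spaces whose intrinsic metric induces the
  Euclidean topology (\<open>compact_geodesic_space_network\<close>,
  \<open>compact_geodesic_space_intrinsic\<close>). On such a space the squared distance to a point is a test
  function with explicit slope (\<open>slope_square_dist\<close>), and the information on \<open>u n\<close> that enters the
  proof is the inequality for these test functions (\<open>quadratic_subsolution\<close>). A supersolution
  \<open>u\<close> for \<open>H\<close> is treated as the subsolution \<open>- u\<close> for \<open>- H\<close>.

  Doubling of variables with these test functions proves the comparison principle
  (\<open>comparison\<close>). Since \<open>g\<close> is Lipschitz, the functions \<open>g \<plusminus> C t\<close> are barriers, and comparison with them
  and with translates in time shows that \<open>u n\<close> is within \<open>C t\<close> of \<open>g\<close> and \<open>C\<close>-Lipschitz in time, with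
  \<open>C\<close> independent of \<open>n\<close> (\<open>solution_bounds\<close>).

  The hypothesis that the distances converge along sequences becomes uniform convergence by
  compactness (\<open>intrinsic_dist_uniform_convergence\<close>). This is what stability rests on
  (\<open>test_subsolution_relaxed_limit\<close>). A test function \<open>\<phi>\<close> on the limit space need not be one on the \<open>n\<close>-th
  network, so the variables are separated: one maximizes
  \<open>u n (t, x) - \<phi> (t, y) - (dn n x y)\<^sup>2 / (2 * \<epsilon>)\<close> over \<open>t\<close>, \<open>x\<close>, \<open>y\<close>, so that the equation for \<open>u n\<close> is tested
  by a squared distance and holds with the slope \<open>dn n x y / \<epsilon>\<close>. As \<open>n\<close> tends to infinity, \<open>y\<close> becomes
  a minimum point of \<open>\<phi> + (d x y)\<^sup>2 / (2 * \<epsilon>)\<close> on the whole limit space. Minimality bounds the subslope of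
  \<open>\<phi>\<close> by \<open>d x y / \<epsilon>\<close> from above and, moving along a geodesic towards \<open>x\<close>, the slope by the same
  number from below. Both slopes of a test function agree, so the slope tested is that of \<open>\<phi>\<close>, and
  its continuity allows \<open>\<epsilon>\<close> to tend to \<open>0\<close>.

  Once the relaxed limits agree, convergence is uniform on compact subsets of \<open>{0..<T} \<times> N\<close>, and the
  uniform Lipschitz bound in time extends it up to the time \<open>T\<close> (\<open>viscosity_solutions_converge\<close>).
\<close>


section \<open>Length of curves\<close>

lemma polygon_le_curve_length:
  assumes "mono t" "range t \<subseteq> {0..1}"
  shows "ennreal (\<Sum>i<k. dist (\<gamma> (t i)) (\<gamma> (t (Suc i)))) \<le> curve_length \<gamma>"
  unfolding curve_length_def
  by (rule SUP_upper2[of "(k, t)"]) (use assms in auto)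

lemma curve_length_least:
  assumes "\<And>k t. mono t \<Longrightarrow> range t \<subseteq> {0..1} \<Longrightarrow>
      ennreal (\<Sum>i<k. dist (\<gamma> (t i)) (\<gamma> (t (Suc i)))) \<le> B"
  shows "curve_length \<gamma> \<le> B"
  unfolding curve_length_def by (rule SUP_least) (use assms in auto)

lemma dist_le_curve_length: "ennreal (dist (pathstart \<gamma>) (pathfinish \<gamma>)) \<le> curve_length \<gamma>"
proof -
  define t :: "nat \<Rightarrow> real" where "t i = (if i = 0 then 0 else 1)" for i
  have "mono t" "range t \<subseteq> {0..1}" by (auto simp: mono_def t_def)
  from polygon_le_curve_length[OF this, of \<gamma> 1] show ?thesis
    by (simp add: t_def pathstart_def pathfinish_def)
qed

lemma curve_length_reversepath_le: "curve_length (reversepath \<gamma>) \<le> curve_length \<gamma>"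
proof (rule curve_length_least)
  fix k and t :: "nat \<Rightarrow> real" assume t: "mono t" "range t \<subseteq> {0..1}"
  define r where "r i = 1 - t (k - i)" for i
  have "mono r" using t(1) by (auto simp: mono_def r_def)
  moreover have "range r \<subseteq> {0..1}" using t(2) by (auto simp: r_def image_subset_iff)
  ultimately have *: "ennreal (\<Sum>i<k. dist (\<gamma> (r i)) (\<gamma> (r (Suc i)))) \<le> curve_length \<gamma>"
    by (rule polygon_le_curve_length)
  have "(\<Sum>i<k. dist (\<gamma> (r i)) (\<gamma> (r (Suc i)))) =
      (\<Sum>i<k. dist (\<gamma> (r (k - Suc i))) (\<gamma> (r (Suc (k - Suc i)))))"
    by (rule sum.nat_diff_reindex[symmetric])
  also have "\<dots> = (\<Sum>i<k. dist (reversepath \<gamma> (t i)) (reversepath \<gamma> (t (Suc i))))"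
    by (rule sum.cong) (auto simp: r_def reversepath_def dist_commute Suc_diff_Suc)
  finally show "ennreal (\<Sum>i<k. dist (reversepath \<gamma> (t i)) (reversepath \<gamma> (t (Suc i)))) \<le> curve_length \<gamma>"
    using * by simp
qed

lemma curve_length_reversepath [simp]: "curve_length (reversepath \<gamma>) = curve_length \<gamma>"
  using curve_length_reversepath_le[of \<gamma>] curve_length_reversepath_le[of "reversepath \<gamma>"]
  by simp

text \<open>A partition of the joined curve is sent to a partition of each piece by clamping its points to
  the corresponding half of the parameter interval. Only the step across the junction is then
  split in two, and the triangle inequality covers it.\<close>

lemma curve_length_joinpaths_le:
  assumes j: "pathfinish \<gamma> = pathstart \<rho>"
  shows "curve_length (\<gamma> +++ \<rho>) \<le> curve_length \<gamma> + curve_length \<rho>"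
proof (rule curve_length_least)
  fix k and t :: "nat \<Rightarrow> real" assume t: "mono t" "range t \<subseteq> {0..1}"
  define a where "a i = min (2 * t i) 1" for i
  define b where "b i = max (2 * t i - 1) 0" for i
  have ab: "mono a" "range a \<subseteq> {0..1}" "mono b" "range b \<subseteq> {0..1}"
    using t by (auto simp: mono_def a_def b_def image_subset_iff min_def max_def)
       (smt (verit))+
  have "dist ((\<gamma> +++ \<rho>) (t i)) ((\<gamma> +++ \<rho>) (t (Suc i))) \<le>
      dist (\<gamma> (a i)) (\<gamma> (a (Suc i))) + dist (\<rho> (b i)) (\<rho> (b (Suc i)))" for i
  proof -
    have m: "t i \<le> t (Suc i)" using t(1) by (simp add: mono_def)
    have j': "\<gamma> 1 = \<rho> 0" using j by (simp add: pathstart_def pathfinish_def)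
    consider "t (Suc i) \<le> 1/2" | "t i > 1/2" | "t i \<le> 1/2" "t (Suc i) > 1/2" by linarith
    then show ?thesis
    proof cases
      case 3
      then show ?thesis
        using dist_triangle[of "\<gamma> (2 * t i)" "\<rho> (2 * t (Suc i) - 1)" "\<gamma> 1"] j'
        by (auto simp: joinpaths_def a_def b_def min_def max_def)
    qed (use m in \<open>auto simp: joinpaths_def a_def b_def min_def max_def\<close>)
  qed
  then have "(\<Sum>i<k. dist ((\<gamma> +++ \<rho>) (t i)) ((\<gamma> +++ \<rho>) (t (Suc i)))) \<le>
      (\<Sum>i<k. dist (\<gamma> (a i)) (\<gamma> (a (Suc i)))) + (\<Sum>i<k. dist (\<rho> (b i)) (\<rho> (b (Suc i))))"
    by (simp flip: sum.distrib add: sum_mono)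
  then have "ennreal (\<Sum>i<k. dist ((\<gamma> +++ \<rho>) (t i)) ((\<gamma> +++ \<rho>) (t (Suc i)))) \<le>
      ennreal (\<Sum>i<k. dist (\<gamma> (a i)) (\<gamma> (a (Suc i)))) + ennreal (\<Sum>i<k. dist (\<rho> (b i)) (\<rho> (b (Suc i))))"
    by (simp add: sum_nonneg flip: ennreal_plus)
  also have "\<dots> \<le> curve_length \<gamma> + curve_length \<rho>"
    by (intro add_mono polygon_le_curve_length ab)
  finally show "ennreal (\<Sum>i<k. dist ((\<gamma> +++ \<rho>) (t i)) ((\<gamma> +++ \<rho>) (t (Suc i)))) \<le>
    curve_length \<gamma> + curve_length \<rho>" .
qed

text \<open>Partitions of the two pieces, put one after the other, form a partition of the whole curve.\<close>

lemma curve_length_split: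
  assumes s: "s \<in> {0..1}"
  shows "curve_length (subpath 0 s \<gamma>) + curve_length (subpath s 1 \<gamma>) \<le> curve_length \<gamma>"
proof -
  define P where "P = {(k :: nat, t :: nat \<Rightarrow> real). mono t \<and> range t \<subseteq> {0..1}}"
  define F where "F \<gamma> = (\<lambda>(k::nat, t::nat \<Rightarrow> real). \<Sum>i<k. dist (\<gamma> (t i)) (\<gamma> (t (Suc i)) :: 'a))"
    for \<gamma> :: "real \<Rightarrow> 'a"
  have cl: "curve_length \<gamma> = (SUP x\<in>P. ennreal (F \<gamma> x))" for \<gamma> :: "real \<Rightarrow> 'a"
    unfolding curve_length_def P_def F_def by (simp add: case_prod_unfold)
  have ne: "P \<noteq> {}" by (auto simp: P_def mono_def intro!: exI[of _ "\<lambda>_. 0"])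
  have sum_split: "(\<Sum>i<m + n. f i) = (\<Sum>i<m. f i) + (\<Sum>i<n. f (m + i))"
    for f :: "nat \<Rightarrow> real" and m n
    by (induction n) (auto simp: add.assoc)
  have "ennreal (F (subpath 0 s \<gamma>) p) + ennreal (F (subpath s 1 \<gamma>) q) \<le> curve_length \<gamma>"
    if "p \<in> P" "q \<in> P" for p q
  proof -
    obtain k t l r where pq: "p = (k, t)" "q = (l, r)" by (cases p, cases q)
    with that have t: "mono t" "range t \<subseteq> {0..1}" "mono r" "range r \<subseteq> {0..1}"
      by (auto simp: P_def)
    then have t01: "0 \<le> t i" "t i \<le> 1" "0 \<le> r i" "r i \<le> 1" for i
      by (auto simp: image_subset_iff)
      \<comment> \<open>The index \<open>k\<close> still belongs to the first piece, so the second partition starts at \<open>Suc k\<close>;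
        the step between them, over the junction, has length at least zero.\<close>
    define c where "c i = (if i \<le> k then s * t i else s + (1 - s) * r (i - Suc k))" for i
    have split01: "s * t i \<le> s" "0 \<le> s * t i" "0 \<le> (1 - s) * r j" "(1 - s) * r j \<le> 1 - s" for i j
      using t01 s by (auto intro: mult_left_le)
    have "mono c"
    proof (rule monoI)
      fix i j :: nat assume "i \<le> j"
      then consider "j \<le> k" | "i > k" | "i \<le> k" "j > k" by linarith
      then show "c i \<le> c j"
      proof cases
        case 1
        then show ?thesis using \<open>i \<le> j\<close> t(1) s by (auto simp: c_def mono_def intro: mult_left_mono)
      next
        case 2
        then have "r (i - Suc k) \<le> r (j - Suc k)" using \<open>i \<le> j\<close> t(3) by (auto simp: mono_def)
        then show ?thesis using 2 \<open>i \<le> j\<close> s by (auto simp: c_def intro: mult_left_mono)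
      next
        case 3
        then show ?thesis using split01(1)[of i] split01(3)[of "j - Suc k"] by (auto simp: c_def)
      qed
    qed
    moreover have "range c \<subseteq> {0..1}"
    proof -
      have "0 \<le> c i \<and> c i \<le> 1" for i
        using split01(1,2)[of i] split01(3,4)[of "i - Suc k"] s by (auto simp: c_def)
      then show ?thesis by auto
    qed
    ultimately have le: "ennreal (\<Sum>i<Suc k + l. dist (\<gamma> (c i)) (\<gamma> (c (Suc i)))) \<le> curve_length \<gamma>"
      by (rule polygon_le_curve_length)
    have 1: "(\<Sum>i<k. dist (\<gamma> (c i)) (\<gamma> (c (Suc i)))) = F (subpath 0 s \<gamma>) p"
      unfolding F_def pq by (auto simp: c_def subpath_def intro!: sum.cong)
    have 2: "(\<Sum>i<l. dist (\<gamma> (c (Suc k + i))) (\<gamma> (c (Suc (Suc k + i))))) = F (subpath s 1 \<gamma>) q"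
      unfolding F_def pq by (auto simp: c_def subpath_def add.commute intro!: sum.cong)
    have "F (subpath 0 s \<gamma>) p + F (subpath s 1 \<gamma>) q \<le> (\<Sum>i<Suc k + l. dist (\<gamma> (c i)) (\<gamma> (c (Suc i))))"
      unfolding sum_split 1[symmetric] 2[symmetric] by (simp add: add.commute)
    moreover have "F \<rho> x \<ge> 0" for \<rho> x unfolding F_def by (auto simp: case_prod_unfold sum_nonneg)
    ultimately show ?thesis
      using order_trans[OF ennreal_leI le] by (simp flip: ennreal_plus)
  qed
  then have "(SUP p\<in>P. ennreal (F (subpath 0 s \<gamma>) p) + ennreal (F (subpath s 1 \<gamma>) q)) \<le> curve_length \<gamma>"
    if "q \<in> P" for q using that by (blast intro: SUP_least)
  then have "curve_length (subpath 0 s \<gamma>) + ennreal (F (subpath s 1 \<gamma>) q) \<le> curve_length \<gamma>"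
    if "q \<in> P" for q using that ne by (simp add: cl ennreal_SUP_add_left)
  then have "(SUP q\<in>P. curve_length (subpath 0 s \<gamma>) + ennreal (F (subpath s 1 \<gamma>) q)) \<le> curve_length \<gamma>"
    by (auto intro!: SUP_least)
  then show ?thesis using ne by (simp add: cl[of "subpath s 1 \<gamma>"] ennreal_SUP_add_right)
qed

lemma curve_length_linepath_le:
  fixes a b :: "'a::real_normed_vector"
  shows "curve_length (linepath a b) \<le> ennreal (dist a b)"
proof (rule curve_length_least)
  fix k and t :: "nat \<Rightarrow> real" assume t: "mono t" "range t \<subseteq> {0..1}"
  have d: "dist (linepath a b (t i)) (linepath a b (t (Suc i))) = (t (Suc i) - t i) * dist a b" for i
  proof -
    have "linepath a b (t i) - linepath a b (t (Suc i)) = (t (Suc i) - t i) *\<^sub>R (a - b)"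
      by (simp add: linepath_def algebra_simps)
    then show ?thesis using t(1) by (simp add: dist_norm mono_def)
  qed
  have "(\<Sum>i<k. dist (linepath a b (t i)) (linepath a b (t (Suc i)))) = (t k - t 0) * dist a b"
    by (simp add: d sum_lessThan_telescope flip: sum_distrib_right)
  also have "\<dots> \<le> 1 * dist a b"
  proof (rule mult_right_mono)
    have "t k \<in> {0..1}" "t 0 \<in> {0..1}" using t(2) by blast+
    then show "t k - t 0 \<le> 1" by auto
  qed simp
  finally show "ennreal (\<Sum>i<k. dist (linepath a b (t i)) (linepath a b (t (Suc i)))) \<le> ennreal (dist a b)"
    by (simp add: ennreal_leI)
qed


section \<open>Intrinsic distances\<close>

lemma intrinsic_edist_le:
  assumes "path \<gamma>" "path_image \<gamma> \<subseteq> S" "pathstart \<gamma> = x" "pathfinish \<gamma> = y"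
  shows "intrinsic_edist S x y \<le> curve_length \<gamma>"
proof (cases "curve_length \<gamma> < \<infinity>")
  case True
  then show ?thesis unfolding intrinsic_edist_def
    by (intro INF_lower) (use assms in \<open>auto simp: rectifiable_curves_def\<close>)
next
  case False
  then show ?thesis by (simp add: less_top[symmetric])
qed

lemma intrinsic_edist_lessD:
  assumes "intrinsic_edist S x y < B"
  obtains \<gamma> where "path \<gamma>" "path_image \<gamma> \<subseteq> S" "pathstart \<gamma> = x" "pathfinish \<gamma> = y"
    "curve_length \<gamma> < B"
  using assms unfolding intrinsic_edist_def INF_less_iff by (auto simp: rectifiable_curves_def)

lemma dist_le_intrinsic_edist: "ennreal (dist x y) \<le> intrinsic_edist S x y"
  unfolding intrinsic_edist_def
  by (rule INF_greatest) (auto simp: rectifiable_curves_def intro: order_trans[OF _ dist_le_curve_length])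

lemma intrinsic_edist_mono: "S \<subseteq> S' \<Longrightarrow> intrinsic_edist S' x y \<le> intrinsic_edist S x y"
  unfolding intrinsic_edist_def
  by (rule INF_superset_mono) (auto simp: rectifiable_curves_def)

lemma intrinsic_edist_commute: "intrinsic_edist S x y = intrinsic_edist S y x"
proof -
  have "intrinsic_edist S x y \<le> intrinsic_edist S y x" for x y
    unfolding intrinsic_edist_def[of S y x]
    by (rule INF_greatest) (auto simp: rectifiable_curves_def
        intro!: order_trans[OF intrinsic_edist_le[where \<gamma>="reversepath _"]])
  then show ?thesis by (simp add: antisym)
qed

lemma intrinsic_edist_triangle:
  "intrinsic_edist S x z \<le> intrinsic_edist S x y + intrinsic_edist S y z"
proof (cases "intrinsic_edist S x y < \<infinity> \<and> intrinsic_edist S y z < \<infinity>")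
  case True
  show ?thesis
  proof (rule ennreal_le_epsilon)
    fix e :: real assume "0 < e"
    then have e: "0 < ennreal (e/2)" by simp
    obtain \<gamma> where g: "path \<gamma>" "path_image \<gamma> \<subseteq> S" "pathstart \<gamma> = x" "pathfinish \<gamma> = y"
      "curve_length \<gamma> < intrinsic_edist S x y + ennreal (e/2)"
      using intrinsic_edist_lessD[of S x y "intrinsic_edist S x y + ennreal (e/2)"] True e
      by (auto simp: less_top)
    obtain \<rho> where r: "path \<rho>" "path_image \<rho> \<subseteq> S" "pathstart \<rho> = y" "pathfinish \<rho> = z"
      "curve_length \<rho> < intrinsic_edist S y z + ennreal (e/2)"
      using intrinsic_edist_lessD[of S y z "intrinsic_edist S y z + ennreal (e/2)"] True e
      by (auto simp: less_top)
    have "intrinsic_edist S x z \<le> curve_length (\<gamma> +++ \<rho>)"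
      using g r by (intro intrinsic_edist_le) (auto simp: path_image_join)
    also have "\<dots> \<le> curve_length \<gamma> + curve_length \<rho>"
      using g r by (intro curve_length_joinpaths_le) auto
    also have "\<dots> \<le> (intrinsic_edist S x y + ennreal (e/2)) + (intrinsic_edist S y z + ennreal (e/2))"
      using g r by (intro add_mono) auto
    also have "\<dots> = (intrinsic_edist S x y + intrinsic_edist S y z) + (ennreal (e/2) + ennreal (e/2))"
      by (simp add: ac_simps)
    also have "ennreal (e/2) + ennreal (e/2) = ennreal e"
      using \<open>0 < e\<close> by (simp flip: ennreal_plus)
    finally show "intrinsic_edist S x z \<le> intrinsic_edist S x y + intrinsic_edist S y z + ennreal e" .
  qed
qed (force simp: less_top[symmetric])

lemma intrinsic_edist_segment:
  fixes x y :: "'a::real_normed_vector"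
  assumes "closed_segment x y \<subseteq> S"
  shows "intrinsic_edist S x y \<le> ennreal (dist x y)"
  using order_trans[OF intrinsic_edist_le[of "linepath x y" S x y] curve_length_linepath_le] assms by simp

lemma intrinsic_edist_eq:
  "intrinsic_edist S x y < \<infinity> \<Longrightarrow> intrinsic_edist S x y = ennreal (intrinsic_dist S x y)"
  by (simp add: intrinsic_dist_def)

lemma dist_le_intrinsic_dist:
  assumes "intrinsic_edist S x y < \<infinity>"
  shows "dist x y \<le> intrinsic_dist S x y"
proof -
  have "ennreal (dist x y) \<le> ennreal (intrinsic_dist S x y)"
    using dist_le_intrinsic_edist[of x y S] by (simp flip: intrinsic_edist_eq[OF assms])
  then show ?thesis by (simp add: intrinsic_dist_def)
qed

lemma Metric_space_intrinsic_dist: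
  assumes fin: "\<And>x y. x \<in> S \<Longrightarrow> y \<in> S \<Longrightarrow> intrinsic_edist S x y < \<infinity>"
  shows "Metric_space S (intrinsic_dist S)"
proof
  show "0 \<le> intrinsic_dist S x y" for x y by (simp add: intrinsic_dist_def)
  show "intrinsic_dist S x y = intrinsic_dist S y x" for x y
    by (simp add: intrinsic_dist_def intrinsic_edist_commute)
  show "(intrinsic_dist S x y = 0) = (x = y)" if "x \<in> S" "y \<in> S" for x y
  proof
    assume "intrinsic_dist S x y = 0"
    then show "x = y" using dist_le_intrinsic_dist[OF fin[OF that]] by simp
  next
    have "curve_length (\<lambda>_. x) \<le> 0" by (rule curve_length_least) simp
    then have "intrinsic_edist S x x \<le> 0"
      using intrinsic_edist_le[of "\<lambda>_. x" S x x] that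
      by (auto simp: path_def path_image_def pathstart_def pathfinish_def image_subset_iff)
    then show "x = y \<Longrightarrow> intrinsic_dist S x y = 0" by (simp add: intrinsic_dist_def)
  qed
  show "intrinsic_dist S x z \<le> intrinsic_dist S x y + intrinsic_dist S y z"
    if "x \<in> S" "y \<in> S" "z \<in> S" for x y z
  proof -
    have f: "intrinsic_edist S x y < top" "intrinsic_edist S y z < top"
      using fin that by auto
    have "enn2real (intrinsic_edist S x z) \<le> enn2real (intrinsic_edist S x y + intrinsic_edist S y z)"
      by (rule enn2real_mono[OF intrinsic_edist_triangle]) (use f in auto)
    then show ?thesis unfolding intrinsic_dist_def enn2real_plus[OF f] .
  qed
qed

text \<open>Domination puts balls of \<open>d\<close> inside ambient balls of the same radius; continuity puts small
  ambient balls inside balls of \<open>d\<close>.\<close>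

lemma mtopology_eq_top_of_set:
  fixes S :: "'a::metric_space set"
  assumes M: "Metric_space S d"
    and ge: "\<And>x y. x \<in> S \<Longrightarrow> y \<in> S \<Longrightarrow> dist x y \<le> d x y"
    and cont: "\<And>x e. x \<in> S \<Longrightarrow> e > 0 \<Longrightarrow> \<exists>r>0. \<forall>y\<in>S. dist x y < r \<longrightarrow> d x y < e"
  shows "Metric_space.mtopology S d = top_of_set S"
proof (rule topology_eq[THEN iffD2], intro allI)
  interpret Metric_space S d by fact
  fix U
  show "openin mtopology U = openin (top_of_set S) U"
  proof
    assume "openin mtopology U"
    then have U: "U \<subseteq> S" "\<And>x. x \<in> U \<Longrightarrow> \<exists>r>0. mball x r \<subseteq> U"
      by (auto simp: openin_mtopology)
    have "\<exists>e>0. \<forall>x'\<in>S. dist x' x < e \<longrightarrow> x' \<in> U" if x: "x \<in> U" for x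
    proof -
      obtain r where r: "r > 0" "mball x r \<subseteq> U" using U x by blast
      have xS: "x \<in> S" using U(1) x by blast
      obtain e where e: "e > 0" "\<And>y. y \<in> S \<Longrightarrow> dist x y < e \<Longrightarrow> d x y < r"
        using cont[OF xS r(1)] by blast
      have "x' \<in> U" if "x' \<in> S" "dist x' x < e" for x'
        using r(2) e(2)[of x'] that xS by (auto simp: dist_commute)
      then show ?thesis using e(1) by blast
    qed
    then show "openin (top_of_set S) U"
      using U(1) by (simp add: openin_euclidean_subtopology_iff)
  next
    assume "openin (top_of_set S) U"
    then have U: "U \<subseteq> S" "\<And>x. x \<in> U \<Longrightarrow> \<exists>e>0. \<forall>x'\<in>S. dist x' x < e \<longrightarrow> x' \<in> U"
      by (auto simp: openin_euclidean_subtopology_iff)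
    have "\<exists>r>0. mball x r \<subseteq> U" if x: "x \<in> U" for x
    proof -
      obtain e where e: "e > 0" "\<forall>x'\<in>S. dist x' x < e \<longrightarrow> x' \<in> U" using U(2)[OF x] by blast
      have "mball x e \<subseteq> U"
      proof
        fix y assume "y \<in> mball x e"
        then have y: "x \<in> S" "y \<in> S" "d x y < e" by auto
        with ge[of x y] have "dist y x < e" by (simp add: dist_commute)
        with e y show "y \<in> U" by blast
      qed
      then show ?thesis using e by blast
    qed
    then show "openin mtopology U"
      using U(1) by (simp add: openin_mtopology)
  qed
qed


section \<open>Compact geodesic spaces\<close>

text \<open>The metric \<open>d\<close> lives on a subset of a metric space whose topology it induces; hence
  continuity and compactness are those of the ambient space. The last axiom provides
  the points of a minimal geodesic.\<close>

locale compact_geodesic_space = Metric_space X d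
  for X :: "'a::metric_space set" and d +
  assumes compact_space: "compact X"
    and mtopology_eq: "mtopology = top_of_set X"
    and between: "\<And>x y h. x \<in> X \<Longrightarrow> y \<in> X \<Longrightarrow> 0 \<le> h \<Longrightarrow> h \<le> d x y \<Longrightarrow>
        \<exists>z\<in>X. d x z = h \<and> d z y = d x y - h"
begin

lemma tendsto_mdist:
  assumes "(f \<longlongrightarrow> a) F" "(g \<longlongrightarrow> b) F" "eventually (\<lambda>k. f k \<in> X) F" "eventually (\<lambda>k. g k \<in> X) F"
    "a \<in> X" "b \<in> X"
  shows "((\<lambda>k. d (f k) (g k)) \<longlongrightarrow> d a b) F"
proof -
  have *: "((\<lambda>k. d (f k) a) \<longlongrightarrow> 0) F"
    if "(f \<longlongrightarrow> a) F" "eventually (\<lambda>k. f k \<in> X) F" "a \<in> X" for f a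
  proof -
    have "limitin mtopology f a F"
      using that by (auto simp: mtopology_eq limitin_subtopology)
    then show ?thesis using limitin_metric_dist_null by blast
  qed
  have "((\<lambda>k. d (f k) a + d (g k) b) \<longlongrightarrow> 0 + 0) F"
    by (intro tendsto_add * assms)
  moreover have "eventually (\<lambda>k. norm (d (f k) (g k) - d a b) \<le> d (f k) a + d (g k) b) F"
    using assms(3,4)
  proof eventually_elim
    case (elim k)
    have "d (f k) (g k) \<le> d (f k) a + (d a b + d b (g k))" "d a b \<le> d a (f k) + (d (f k) (g k) + d (g k) b)"
      using elim assms(5,6) by (meson add_left_mono order_trans triangle)+
    then show ?case by (simp add: commute[of b] commute[of a "f k"])
  qed
  ultimately have "((\<lambda>k. d (f k) (g k) - d a b) \<longlongrightarrow> 0) F"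
    by (rule_tac Lim_null_comparison[where g="\<lambda>k. d (f k) a + d (g k) b"]) auto
  then show ?thesis by (simp add: LIM_zero_iff)
qed

lemma continuous_on_mdist:
  assumes "continuous_on S f" "continuous_on S g" "f ` S \<subseteq> X" "g ` S \<subseteq> X"
  shows "continuous_on S (\<lambda>x. d (f x) (g x))"
  unfolding continuous_on_def
  by (intro ballI tendsto_mdist)
    (use assms in \<open>auto simp: continuous_on_def eventually_at_topological intro!: exI[of _ UNIV]\<close>)

lemma mdist_small:
  assumes "x \<in> X" "e > 0"
  shows "\<exists>r>0. \<forall>y\<in>X. dist y x < r \<longrightarrow> d y x < e"
proof -
  have "continuous_on X (\<lambda>y. d y x)" by (intro continuous_on_mdist) (use assms in auto)
  then show ?thesis using assms
    by (force simp: continuous_on_iff dist_real_def)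
qed

end

text \<open>On a compact set the intermediate points on almost minimal curves accumulate at points of a
  geodesic. The intermediate value theorem applies to the distance along a curve because curves
  are continuous for the ambient topology and the intrinsic distance induces that topology.\<close>

lemma compact_geodesic_space_intrinsic:
  fixes S :: "'a::real_normed_vector set"
  assumes comp: "compact S"
    and fin: "\<And>x y. x \<in> S \<Longrightarrow> y \<in> S \<Longrightarrow> intrinsic_edist S x y < \<infinity>"
    and cont: "\<And>x e. x \<in> S \<Longrightarrow> e > 0 \<Longrightarrow> \<exists>r>0. \<forall>y\<in>S. dist x y < r \<longrightarrow> intrinsic_dist S x y < e"
  shows "compact_geodesic_space S (intrinsic_dist S)"
proof -
  define d where "d = intrinsic_dist S"
  interpret Metric_space S d unfolding d_def by (rule Metric_space_intrinsic_dist[OF fin])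
  have ed: "intrinsic_edist S x y = ennreal (d x y)" if "x \<in> S" "y \<in> S" for x y
    unfolding d_def by (rule intrinsic_edist_eq) (use fin that in blast)
  have top: "mtopology = top_of_set S"
    unfolding d_def using Metric_space_axioms
    by (intro mtopology_eq_top_of_set cont) (auto simp: d_def intro!: dist_le_intrinsic_dist fin)
  have tend: "(\<lambda>k. d (f k) y) \<longlonglongrightarrow> d a y"
    if f: "f \<longlonglongrightarrow> a" "\<And>k. f k \<in> S" "a \<in> S" "y \<in> S" for f :: "nat \<Rightarrow> 'a" and a y
  proof -
    have "limitin mtopology f a sequentially"
      using f by (auto simp: top limitin_subtopology)
    then have l: "(\<lambda>k. d (f k) a) \<longlonglongrightarrow> 0" using limitin_metric_dist_null by blast
    have "norm (d (f k) y - d a y) \<le> d (f k) a" for k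
      using triangle[of "f k" a y] triangle[of a "f k" y] commute[of a "f k"] f by auto
    then have "(\<lambda>k. d (f k) y - d a y) \<longlonglongrightarrow> 0" using l by (rule_tac Lim_null_comparison) auto
    then show ?thesis by (simp add: LIM_zero_iff)
  qed
  have approx: "\<exists>z\<in>S. d x z = h \<and> d z y \<le> d x y - h + e"
    if xy: "x \<in> S" "y \<in> S" "0 \<le> h" "h \<le> d x y" "e > 0" for x y h e
  proof -
    have "intrinsic_edist S x y < ennreal (d x y + e)"
      using xy ed by (simp add: ennreal_lessI)
    from intrinsic_edist_lessD[OF this] obtain \<gamma> where
      g: "path \<gamma>" "path_image \<gamma> \<subseteq> S" "pathstart \<gamma> = x" "pathfinish \<gamma> = y"
         "curve_length \<gamma> < ennreal (d x y + e)" by blast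
    have gS: "\<gamma> s \<in> S" if "s \<in> {0..1}" for s using g(2) that by (auto simp: path_image_def)
    have "continuous_on {0..1} (\<lambda>s. d (\<gamma> s) x)"
      unfolding continuous_on_sequentially comp_def
    proof safe
      fix p :: "nat \<Rightarrow> real" and a assume p: "a \<in> {0..1}" "\<forall>n. p n \<in> {0..1}" "p \<longlonglongrightarrow> a"
      have "(\<lambda>k. \<gamma> (p k)) \<longlonglongrightarrow> \<gamma> a"
        using g(1) p unfolding path_def continuous_on_sequentially comp_def by blast
      then show "(\<lambda>n. d (\<gamma> (p n)) x) \<longlonglongrightarrow> d (\<gamma> a) x" by (rule tend) (use p gS xy in auto)
    qed
    then have "\<exists>s\<ge>0. s \<le> 1 \<and> d (\<gamma> s) x = h"
      by (intro IVT') (use g xy commute in \<open>auto simp: pathstart_def pathfinish_def\<close>)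
    then obtain s where s: "s \<in> {0..1}" "d x (\<gamma> s) = h" by (auto simp: commute)
    have "ennreal (d x (\<gamma> s)) + ennreal (d (\<gamma> s) y) \<le> curve_length (subpath 0 s \<gamma>) + curve_length (subpath s 1 \<gamma>)"
      unfolding ed[symmetric, OF xy(1) gS[OF s(1)]] ed[symmetric, OF gS[OF s(1)] xy(2)]
      using g s path_subpath[of \<gamma> 0 s] path_subpath[of \<gamma> s 1] path_image_subpath_subset[of 0 s \<gamma>] path_image_subpath_subset[of s 1 \<gamma>]
      by (intro add_mono intrinsic_edist_le) (auto simp: pathstart_def pathfinish_def subpath_def)
    also have "\<dots> \<le> curve_length \<gamma>" by (rule curve_length_split) fact
    also have "\<dots> \<le> ennreal (d x y + e)" using g by simp
    finally have "d x (\<gamma> s) + d (\<gamma> s) y \<le> d x y + e"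
      using xy(5) by (simp flip: ennreal_plus)
    then show ?thesis using s gS by (intro bexI[of _ "\<gamma> s"]) auto
  qed
  have "\<exists>z\<in>S. d x z = h \<and> d z y = d x y - h"
    if xy: "x \<in> S" "y \<in> S" "0 \<le> h" "h \<le> d x y" for x y h
  proof -
    have "\<forall>k. \<exists>z. z \<in> S \<and> d x z = h \<and> d z y \<le> d x y - h + inverse (real (Suc k))"
      using approx[OF xy] by (simp add: Bex_def)
    then obtain f where f: "\<And>k. f k \<in> S" "\<And>k. d x (f k) = h"
        "\<And>k. d (f k) y \<le> d x y - h + inverse (real (Suc k))" by metis
    obtain z r where z: "z \<in> S" "strict_mono r" "(f \<circ> r) \<longlonglongrightarrow> z"
      using comp f(1) unfolding compact_def by metis
    have "(\<lambda>k. d ((f \<circ> r) k) x) \<longlonglongrightarrow> d z x" by (rule tend) (use z f xy in \<open>auto simp: comp_def\<close>)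
    then have zx: "d x z = h" using f(2) by (simp add: commute LIMSEQ_const_iff)
    have "(\<lambda>k. d ((f \<circ> r) k) y) \<longlonglongrightarrow> d z y" by (rule tend) (use z f xy in \<open>auto simp: comp_def\<close>)
    moreover have "(\<lambda>k. d x y - h + inverse (real (Suc (r k)))) \<longlonglongrightarrow> d x y - h + 0"
      using LIMSEQ_subseq_LIMSEQ[OF LIMSEQ_inverse_real_of_nat z(2)]
      by (intro tendsto_intros) (simp add: comp_def)
    ultimately have "d z y \<le> d x y - h + 0"
      by (rule LIMSEQ_le) (use f(3) in auto)
    then show ?thesis using triangle[OF xy(1) z(1) xy(2)] zx z(1) by auto
  qed
  then show ?thesis
    unfolding d_def[symmetric] by unfold_locales (use comp top in auto)
qed


section \<open>Slopes\<close>

context compact_geodesic_space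
begin

lemma spacetime_eq: "spacetime I X d = top_of_set (I \<times> X)"
  unfolding spacetime_def mtopology_eq by (simp add: prod_topology_subtopology_eu)

text \<open>Both slopes are upper limits of difference quotients. The next two lemmas bound such a limit by
  the first-order coefficient of an estimate with quadratic remainder; every slope below is
  computed in this way.\<close>

lemma Limsup_quotient_le:
  assumes x: "x \<in> X" and r: "r > 0" and c: "c \<ge> 0" "k \<ge> 0"
    and le: "\<And>z. z \<in> X \<Longrightarrow> d z x < r \<Longrightarrow> f z \<le> d z x * (c + k * d z x)"
  shows "Limsup (atin mtopology x) (\<lambda>z. ennreal (f z / d z x)) \<le> ennreal c"
proof (rule ennreal_le_epsilon)
  fix e :: real assume "0 < e"
  define \<delta> where "\<delta> = min r (e / (k + 1))"
  have "\<delta> > 0" using r c \<open>0 < e\<close> by (simp add: \<delta>_def)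
  have "ennreal (f z / d z x) \<le> ennreal c + ennreal e"
    if z: "z \<in> X" "0 < d z x" "d z x < \<delta>" for z
  proof -
    have "k * d z x \<le> (k + 1) * (e / (k + 1))"
      using z c by (intro mult_mono) (auto simp: \<delta>_def)
    then have "c + k * d z x \<le> c + e" using c by simp
    then have "d z x * (c + k * d z x) \<le> d z x * (c + e)" by (rule mult_left_mono) simp
    moreover have "f z \<le> d z x * (c + k * d z x)" using z by (intro le) (auto simp: \<delta>_def)
    ultimately have "f z \<le> d z x * (c + e)" by linarith
    then have "f z / d z x \<le> c + e" using z by (simp add: field_simps)
    then show ?thesis using c \<open>0 < e\<close> by (simp flip: ennreal_plus add: ennreal_leI)
  qed
  then show "Limsup (atin mtopology x) (\<lambda>z. ennreal (f z / d z x)) \<le> ennreal c + ennreal e"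
    by (intro Limsup_bounded) (use \<open>\<delta> > 0\<close> in \<open>auto simp: eventually_atin_metric\<close>)
qed

lemma Limsup_quotient_ge:
  assumes x: "x \<in> X" and r: "r > 0" and k: "k \<ge> 0"
    and ge: "\<And>h. 0 < h \<Longrightarrow> h < r \<Longrightarrow> \<exists>z\<in>X. d z x = h \<and> h * (c - k * h) \<le> f z"
  shows "ennreal c \<le> Limsup (atin mtopology x) (\<lambda>z. ennreal (f z / d z x))"
proof (rule Limsup_greatest)
  fix P assume "eventually P (atin mtopology x)"
  then obtain \<delta> where \<delta>: "\<delta> > 0" "\<And>z. z \<in> X \<Longrightarrow> 0 < d z x \<Longrightarrow> d z x < \<delta> \<Longrightarrow> P z"
    using x by (auto simp: eventually_atin_metric)
  show "ennreal c \<le> (SUP z\<in>Collect P. ennreal (f z / d z x))"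
  proof (rule ennreal_le_epsilon)
    fix e :: real assume "0 < e"
    define h where "h = min (min r \<delta>) (e / (k + 1)) / 2"
    have "h > 0" using r \<delta> k \<open>0 < e\<close> by (simp add: h_def)
    moreover have h': "h < r" "h < \<delta>" using \<open>h > 0\<close> by (auto simp: h_def)
    ultimately obtain z where z: "z \<in> X" "d z x = h" "h * (c - k * h) \<le> f z" using ge[of h] by blast
    have "h \<le> e / (k + 1)" using \<open>0 < h\<close> unfolding h_def by linarith
    then have "k * h \<le> (k + 1) * (e / (k + 1))"
      using \<open>0 < h\<close> k by (intro mult_mono) auto
    then have "k * h \<le> e" using k by simp
    have "c - k * h \<le> f z / d z x" using z \<open>0 < h\<close> by (simp add: field_simps)
    then have "c \<le> max 0 (f z / d z x) + e" using \<open>k * h \<le> e\<close> by linarith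
    then have "ennreal c \<le> ennreal (max 0 (f z / d z x)) + ennreal e"
      using \<open>0 < e\<close> by (simp flip: ennreal_plus add: ennreal_leI)
    also have "\<dots> \<le> (SUP z\<in>Collect P. ennreal (f z / d z x)) + ennreal e"
    proof (rule add_right_mono, rule SUP_upper2)
      show "z \<in> Collect P" using \<delta>(2)[of z] z \<open>0 < h\<close> h' by simp
      show "ennreal (max 0 (f z / d z x)) \<le> ennreal (f z / d z x)"
        by (auto simp: max_def ennreal_neg)
    qed
    finally show "ennreal c \<le> (SUP z\<in>Collect P. ennreal (f z / d z x)) + ennreal e" .
  qed
qed

lemma slope_le:
  assumes "x \<in> X" "r > 0" "c \<ge> 0" "k \<ge> 0"
    and "\<And>z. z \<in> X \<Longrightarrow> d z x < r \<Longrightarrow> \<bar>f z - f x\<bar> \<le> d z x * (c + k * d z x)"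
  shows "slope X d f x \<le> ennreal c"
  unfolding slope_def by (rule Limsup_quotient_le[OF assms])

lemma subslope_le:
  assumes "x \<in> X" "r > 0" "c \<ge> 0" "k \<ge> 0"
    and "\<And>z. z \<in> X \<Longrightarrow> d z x < r \<Longrightarrow> f x - f z \<le> d z x * (c + k * d z x)"
  shows "subslope X d f x \<le> ennreal c"
  unfolding subslope_def
proof (rule Limsup_quotient_le[OF assms(1-4)])
  fix z assume "z \<in> X" "d z x < r"
  moreover have "0 \<le> d z x * (c + k * d z x)" using assms(3,4) by simp
  ultimately show "max 0 (- (f z - f x)) \<le> d z x * (c + k * d z x)" using assms(5)[of z] by simp
qed

lemma slope_ge:
  assumes "x \<in> X" "r > 0" "k \<ge> 0"
    and "\<And>h. 0 < h \<Longrightarrow> h < r \<Longrightarrow> \<exists>z\<in>X. d z x = h \<and> h * (c - k * h) \<le> f z - f x"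
  shows "ennreal c \<le> slope X d f x"
  unfolding slope_def
proof (rule Limsup_quotient_ge[OF assms(1-3)])
  fix h assume "0 < h" "h < r"
  from assms(4)[OF this] show "\<exists>z\<in>X. d z x = h \<and> h * (c - k * h) \<le> \<bar>f z - f x\<bar>"
    by (elim bexE conjE) (rule bexI, rule conjI, assumption, linarith)
qed

lemma subslope_ge:
  assumes "x \<in> X" "r > 0" "k \<ge> 0"
    and "\<And>h. 0 < h \<Longrightarrow> h < r \<Longrightarrow> \<exists>z\<in>X. d z x = h \<and> h * (c - k * h) \<le> f x - f z"
  shows "ennreal c \<le> subslope X d f x"
  unfolding subslope_def
proof (rule Limsup_quotient_ge[OF assms(1-3)])
  fix h assume "0 < h" "h < r"
  from assms(4)[OF this] show "\<exists>z\<in>X. d z x = h \<and> h * (c - k * h) \<le> max 0 (- (f z - f x))"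
    by (elim bexE conjE) (rule bexI, rule conjI, assumption, linarith)
qed

lemma subslope_le_slope: "subslope X d f x \<le> slope X d f x"
  unfolding subslope_def slope_def
  by (intro Limsup_mono always_eventually allI ennreal_leI divide_right_mono) auto

lemma square_dist_diff_le:
  assumes "x \<in> X" "y \<in> X" "z \<in> X"
  shows "(d z y)\<^sup>2 - (d x y)\<^sup>2 \<le> d z x * (2 * d x y + d z x)"
proof -
  have "d z y \<le> d z x + d x y" using triangle assms by blast
  then have "(d z y)\<^sup>2 \<le> (d z x + d x y)\<^sup>2" by (intro power_mono) auto
  then show ?thesis by (simp add: power2_eq_square algebra_simps)
qed

lemma abs_square_dist_diff_le:
  assumes "x \<in> X" "y \<in> X" "z \<in> X"
  shows "\<bar>(d z y)\<^sup>2 - (d x y)\<^sup>2\<bar> \<le> d z x * (2 * d x y + d z x)"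
proof -
  have "d x y \<le> d z x + d z y" using triangle[of x z y] assms commute by simp
  then have "d x y - d z x \<le> d z y" by simp
  have "(d x y)\<^sup>2 - (d z y)\<^sup>2 \<le> d z x * (2 * d x y + d z x)"
  proof (cases "d z x \<le> d x y")
    case True
    then have "(d x y - d z x)\<^sup>2 \<le> (d z y)\<^sup>2" using \<open>d x y - d z x \<le> d z y\<close> by (intro power_mono) auto
    moreover have "(d x y - d z x)\<^sup>2 = (d x y)\<^sup>2 - 2 * d x y * d z x + (d z x)\<^sup>2"
      "d z x * (2 * d x y + d z x) = 2 * d x y * d z x + (d z x)\<^sup>2"
      by (simp_all add: power2_eq_square algebra_simps)
    moreover have "0 \<le> (d z x)\<^sup>2" by simp
    ultimately show ?thesis by linarith
  next
    case False
    then have "d x y * d x y \<le> d z x * (2 * d x y + d z x)"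
      by (intro mult_mono) auto
    then show ?thesis by (simp add: power2_eq_square) (smt (verit) zero_le_square)
  qed
  then show ?thesis using square_dist_diff_le[OF assms] by simp
qed

text \<open>Moving from \<open>x\<close> towards \<open>y\<close> along a geodesic decreases the squared distance at the
  maximal rate; this is where geodesics enter.\<close>

lemma slope_square_dist:
  assumes "x \<in> X" "y \<in> X" "\<epsilon> > 0"
  shows "slope X d (\<lambda>z. (d z y)\<^sup>2 / (2 * \<epsilon>)) x = ennreal (d x y / \<epsilon>)"
    and "subslope X d (\<lambda>z. (d z y)\<^sup>2 / (2 * \<epsilon>)) x = ennreal (d x y / \<epsilon>)"
proof -
  let ?f = "\<lambda>z. (d z y)\<^sup>2 / (2 * \<epsilon>)"
  have le: "slope X d ?f x \<le> ennreal (d x y / \<epsilon>)"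
  proof (rule slope_le[where r=1 and k="1/(2*\<epsilon>)"])
    fix z assume "z \<in> X" "d z x < 1"
    have "\<bar>?f z - ?f x\<bar> = \<bar>(d z y)\<^sup>2 - (d x y)\<^sup>2\<bar> / (2 * \<epsilon>)"
      using assms(3) by (simp add: abs_divide flip: diff_divide_distrib)
    also have "\<dots> \<le> (d z x * (2 * d x y + d z x)) / (2 * \<epsilon>)"
      using assms \<open>z \<in> X\<close> by (intro divide_right_mono abs_square_dist_diff_le) auto
    finally show "\<bar>?f z - ?f x\<bar> \<le> d z x * (d x y / \<epsilon> + 1/(2*\<epsilon>) * d z x)"
      using assms(3) by (simp add: field_simps)
  qed (use assms in auto)
  have ge: "ennreal (d x y / \<epsilon>) \<le> subslope X d ?f x"
  proof (cases "x = y")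
    case False
    then have pos: "0 < d x y" using assms by simp
    show ?thesis
    proof (rule subslope_ge[where r="d x y" and k="1/(2*\<epsilon>)"])
      fix h assume h: "0 < h" "h < d x y"
      then obtain z where z: "z \<in> X" "d x z = h" "d z y = d x y - h"
        using between[of x y h] assms by auto
      have "?f x - ?f z = h * (d x y / \<epsilon> - 1 / (2 * \<epsilon>) * h)"
        using assms(3) unfolding z(3) by (simp add: power2_eq_square field_simps)
      then show "\<exists>z\<in>X. d z x = h \<and> h * (d x y / \<epsilon> - 1 / (2 * \<epsilon>) * h) \<le> ?f x - ?f z"
        using z(1,2) commute[of x z] by (intro bexI[of _ z]) auto
    qed (use assms pos in auto)
  qed (use assms in simp)
  from le ge subslope_le_slope[of ?f x]
  show "slope X d ?f x = ennreal (d x y / \<epsilon>)" "subslope X d ?f x = ennreal (d x y / \<epsilon>)"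
    by (auto intro: antisym order_trans)
qed

text \<open>Squared distances are therefore test functions, and the slope of each is explicit. They are the
  only test functions that the comparison argument uses.\<close>

lemma lower_test_square_dist:
  assumes y: "y \<in> X" and \<epsilon>: "\<epsilon> > 0" and \<theta>: "\<theta> C1_differentiable_on {0<..<T}"
  shows "lower_test T X d (\<lambda>z. (d z y)\<^sup>2 / (2 * \<epsilon>)) \<theta>"
  unfolding lower_test_def
proof (intro conjI ballI \<theta>)
  let ?f = "\<lambda>z. (d z y)\<^sup>2 / (2 * \<epsilon>)"
  show "slope X d ?f x = subslope X d ?f x" if "x \<in> X" for x
    using slope_square_dist[OF that y \<epsilon>] by simp
  have "continuous_on X (subslope X d ?f) \<longleftrightarrow> continuous_on X (\<lambda>x. ennreal (d x y / \<epsilon>))"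
    by (intro continuous_on_cong refl slope_square_dist y \<epsilon>)
  moreover have "continuous_on X (\<lambda>x. ennreal (d x y / \<epsilon>))"
    by (intro continuous_on_ennreal continuous_intros continuous_on_mdist) (use y \<epsilon> in auto)
  ultimately show "continuous_map mtopology euclidean (subslope X d ?f)"
    by (simp add: mtopology_eq)
  show "locally_lipschitz_wrt d X ?f"
    unfolding locally_lipschitz_wrt_def lipschitz_wrt_def
  proof (intro ballI exI conjI)
    fix x a b assume x: "x \<in> X" and ab: "a \<in> mball x 1" "b \<in> mball x 1"
    then have X: "a \<in> X" "b \<in> X" and l: "d x a < 1" "d x b < 1" by auto
    have ay: "d a y \<le> 1 + d x y" using triangle[of a x y] commute[of a x] X x y l by simp
    have by': "d b y \<le> 1 + d x y" using triangle[of b x y] commute[of b x] X x y l by simp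
    have ab': "d a b \<le> 2" using triangle[of a x b] commute[of a x] X x l by simp
    have "\<bar>?f a - ?f b\<bar> = \<bar>(d a y)\<^sup>2 - (d b y)\<^sup>2\<bar> / (2 * \<epsilon>)"
      using \<epsilon> by (simp add: abs_divide flip: diff_divide_distrib)
    also have "\<dots> \<le> (d a b * (2 * d b y + d a b)) / (2 * \<epsilon>)"
      using X y \<epsilon> by (intro divide_right_mono abs_square_dist_diff_le) auto
    also have "\<dots> \<le> (d a b * (2 * (1 + d x y) + 2)) / (2 * \<epsilon>)"
      using ab' by' \<epsilon> by (intro divide_right_mono mult_left_mono) auto
    also have "\<dots> = ((2 + d x y) / \<epsilon>) * d a b" using \<epsilon> by (simp add: field_simps)
    finally show "\<bar>?f a - ?f b\<bar> \<le> ((2 + d x y) / \<epsilon>) * d a b" .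
  qed simp
qed

lemma slope_finite:
  assumes "locally_lipschitz_wrt d X f" "x \<in> X"
  shows "slope X d f x < \<infinity>"
proof -
  obtain r L where r: "r > 0" and L: "\<forall>a\<in>mball x r. \<forall>b\<in>mball x r. \<bar>f a - f b\<bar> \<le> L * d a b"
    using assms unfolding locally_lipschitz_wrt_def lipschitz_wrt_def by blast
  have "slope X d f x \<le> ennreal (max 0 L)"
  proof (rule slope_le[OF \<open>x \<in> X\<close> r, where k=0])
    fix z assume z: "z \<in> X" "d z x < r"
    then have "z \<in> mball x r" "x \<in> mball x r" using assms(2) r by (auto simp: commute)
    with L have "\<bar>f z - f x\<bar> \<le> L * d z x" by blast
    also have "\<dots> \<le> max 0 L * d z x" by (intro mult_right_mono) auto
    finally show "\<bar>f z - f x\<bar> \<le> d z x * (max 0 L + 0 * d z x)" by (simp add: mult.commute)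
  qed auto
  then show ?thesis by (simp add: le_less_trans)
qed

lemma locally_lipschitz_continuous:
  assumes "locally_lipschitz_wrt d X f"
  shows "continuous_on X f"
  unfolding continuous_on_iff
proof (intro ballI allI impI)
  fix x and e :: real assume x: "x \<in> X" "0 < e"
  obtain r L where r: "r > 0" and L: "\<forall>a\<in>mball x r. \<forall>b\<in>mball x r. \<bar>f a - f b\<bar> \<le> L * d a b"
    using assms x unfolding locally_lipschitz_wrt_def lipschitz_wrt_def by blast
  obtain \<delta> where \<delta>: "\<delta> > 0" "\<And>y. y \<in> X \<Longrightarrow> dist y x < \<delta> \<Longrightarrow> d y x < min r (e / (\<bar>L\<bar> + 1))"
    using mdist_small[of x "min r (e / (\<bar>L\<bar> + 1))"] x r by auto
  have "dist (f y) (f x) < e" if y: "y \<in> X" "dist y x < \<delta>" for y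
  proof -
    have l: "d y x < r" "d y x < e / (\<bar>L\<bar> + 1)" using \<delta>(2)[OF y] by auto
    then have "y \<in> mball x r" "x \<in> mball x r" using x y r by (auto simp: commute)
    with L have "\<bar>f y - f x\<bar> \<le> L * d y x" by blast
    also have "\<dots> \<le> (\<bar>L\<bar> + 1) * d y x" by (intro mult_right_mono) auto
    also have "\<dots> < (\<bar>L\<bar> + 1) * (e / (\<bar>L\<bar> + 1))" using l(2) by (intro mult_strict_left_mono) auto
    also have "\<dots> = e" by simp
    finally show ?thesis by (simp add: dist_real_def)
  qed
  then show "\<exists>\<delta>>0. \<forall>y\<in>X. dist y x < \<delta> \<longrightarrow> dist (f y) (f x) < e" using \<delta>(1) by blast
qed

end

section \<open>One-sided formulations\<close>

text \<open>The condition on test functions in the definition of a subsolution, for a Hamiltonian \<open>G\<close>. A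
  supersolution \<open>u\<close> for \<open>H\<close> is a subsolution \<open>- u\<close> for \<open>- H\<close> in this sense, so that each
  argument below need be made only once.\<close>

definition test_subsolution ::
    "real \<Rightarrow> 'a set \<Rightarrow> ('a \<Rightarrow> 'a \<Rightarrow> real) \<Rightarrow> ('a \<Rightarrow> real \<Rightarrow> real) \<Rightarrow> (real \<times> 'a \<Rightarrow> real) \<Rightarrow> bool" where
  "test_subsolution T X d G v \<longleftrightarrow>
     (\<forall>\<phi>\<^sub>1 \<phi>\<^sub>2. \<forall>t\<in>{0<..<T}. \<forall>x\<in>X.
        lower_test T X d \<phi>\<^sub>1 \<phi>\<^sub>2 \<and>
        local_max_at (spacetime {0<..<T} X d) (\<lambda>(s, y). v (s, y) - (\<phi>\<^sub>1 y + \<phi>\<^sub>2 s)) (t, x) \<longrightarrow>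
        deriv \<phi>\<^sub>2 t + G x (enn2real (slope X d \<phi>\<^sub>1 x)) \<le> 0)"

text \<open>The same condition for squared distances only, whose slope is written out, and for maxima that
  are local in time but global in space. It survives when the space varies, because no test
  function on a limit space has to be transferred: only distances occur.\<close>

definition quadratic_subsolution ::
    "real \<Rightarrow> 'a set \<Rightarrow> ('a \<Rightarrow> 'a \<Rightarrow> real) \<Rightarrow> ('a \<Rightarrow> real \<Rightarrow> real) \<Rightarrow> (real \<times> 'a \<Rightarrow> real) \<Rightarrow> bool" where
  "quadratic_subsolution T X d G v \<longleftrightarrow>
     (\<forall>x\<in>X. \<forall>y\<in>X. \<forall>t\<in>{0<..<T}. \<forall>\<epsilon>>0. \<forall>r>0. \<forall>\<theta> \<theta>'.
        (\<forall>s\<in>{0<..<T}. (\<theta> has_real_derivative \<theta>' s) (at s)) \<and> continuous_on {0<..<T} \<theta>' \<and>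
        (\<forall>s\<in>{0<..<T}. \<forall>z\<in>X. \<bar>s - t\<bar> < r \<longrightarrow>
           v (s, z) - \<theta> s - (d z y)\<^sup>2 / (2 * \<epsilon>) \<le> v (t, x) - \<theta> t - (d x y)\<^sup>2 / (2 * \<epsilon>)) \<longrightarrow>
        \<theta>' t + G x (d x y / \<epsilon>) \<le> 0)"

lemma viscosity_subsolution_iff:
  "viscosity_subsolution T X d H g u \<longleftrightarrow>
     locally_bounded_map (spacetime {0..<T} X d) u \<and> usc_map (spacetime {0..<T} X d) u \<and>
     (\<forall>x\<in>X. u (0, x) \<le> g x) \<and> test_subsolution T X d H u"
  unfolding viscosity_subsolution_def test_subsolution_def ..

lemma slope_uminus: "slope X d (\<lambda>x. - f x) x = slope X d f x"
proof -
  have "\<bar>- f y - - f x\<bar> = \<bar>f y - f x\<bar>" for y by linarith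
  then show ?thesis by (simp add: slope_def)
qed

lemma deriv_uminus_C1:
  fixes \<phi> :: "real \<Rightarrow> real"
  assumes "\<phi> C1_differentiable_on S" "t \<in> S"
  shows "deriv (\<lambda>s. - \<phi> s) t = - deriv \<phi> t"
proof -
  have "\<phi> field_differentiable at t"
    using assms by (auto simp: C1_differentiable_on_def has_real_derivative_iff_has_vector_derivative
        field_differentiable_def)
  then show ?thesis by (simp add: DERIV_deriv_iff_field_differentiable DERIV_imp_deriv DERIV_minus)
qed

lemma test_subsolution_uminus_iff:
  "test_subsolution T X d (\<lambda>x p. - H x p) (\<lambda>p. - u p) \<longleftrightarrow>
     (\<forall>\<phi>\<^sub>1 \<phi>\<^sub>2. \<forall>t\<in>{0<..<T}. \<forall>x\<in>X.
        upper_test T X d \<phi>\<^sub>1 \<phi>\<^sub>2 \<and>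
        local_min_at (spacetime {0<..<T} X d) (\<lambda>(s, y). u (s, y) - (\<phi>\<^sub>1 y + \<phi>\<^sub>2 s)) (t, x) \<longrightarrow>
        deriv \<phi>\<^sub>2 t + H x (enn2real (slope X d \<phi>\<^sub>1 x)) \<ge> 0)" (is "?L \<longleftrightarrow> ?R")
proof -
  have mm: "local_max_at Y (\<lambda>(s, y). - u (s, y) - (- \<phi>\<^sub>1 y + - \<phi>\<^sub>2 s)) p \<longleftrightarrow>
      local_min_at Y (\<lambda>(s, y). u (s, y) - (\<phi>\<^sub>1 y + \<phi>\<^sub>2 s)) p" for Y p \<phi>\<^sub>1 \<phi>\<^sub>2
    unfolding local_max_at_def local_min_at_def
    by (intro ex_cong1 conj_cong refl ball_cong) (auto split: prod.splits)
  have eq: "(- D + - Hx \<le> 0) = (0 \<le> D + Hx)" for D Hx :: real by linarith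
  show ?thesis
  proof
    assume L: ?L
    show ?R
    proof (intro allI ballI impI)
      fix \<phi>\<^sub>1 \<phi>\<^sub>2 t x
      assume *: "t \<in> {0<..<T}" "x \<in> X" "upper_test T X d \<phi>\<^sub>1 \<phi>\<^sub>2 \<and>
        local_min_at (spacetime {0<..<T} X d) (\<lambda>(s, y). u (s, y) - (\<phi>\<^sub>1 y + \<phi>\<^sub>2 s)) (t, x)"
      then have low: "lower_test T X d (\<lambda>x. - \<phi>\<^sub>1 x) (\<lambda>t. - \<phi>\<^sub>2 t)" by (simp add: upper_test_def)
      then have "(\<lambda>t. - \<phi>\<^sub>2 t) C1_differentiable_on {0<..<T}" by (simp add: lower_test_def)
      from deriv_uminus_C1[OF this *(1)] have dv: "deriv (\<lambda>t. - \<phi>\<^sub>2 t) t = - deriv \<phi>\<^sub>2 t" by simp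
      have "deriv (\<lambda>t. - \<phi>\<^sub>2 t) t + - H x (enn2real (slope X d (\<lambda>x. - \<phi>\<^sub>1 x) x)) \<le> 0"
        using L * low mm unfolding test_subsolution_def by blast
      then show "deriv \<phi>\<^sub>2 t + H x (enn2real (slope X d \<phi>\<^sub>1 x)) \<ge> 0"
        unfolding dv slope_uminus eq .
    qed
  next
    assume R: ?R
    show ?L unfolding test_subsolution_def
    proof (intro allI ballI impI)
      fix \<phi>\<^sub>1 \<phi>\<^sub>2 t x
      assume *: "t \<in> {0<..<T}" "x \<in> X" "lower_test T X d \<phi>\<^sub>1 \<phi>\<^sub>2 \<and>
        local_max_at (spacetime {0<..<T} X d) (\<lambda>(s, y). - u (s, y) - (\<phi>\<^sub>1 y + \<phi>\<^sub>2 s)) (t, x)"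
      then have up: "upper_test T X d (\<lambda>x. - \<phi>\<^sub>1 x) (\<lambda>t. - \<phi>\<^sub>2 t)" by (simp add: upper_test_def)
      have "\<phi>\<^sub>2 C1_differentiable_on {0<..<T}" using * by (simp add: lower_test_def)
      from deriv_uminus_C1[OF this *(1)] have dv: "deriv (\<lambda>t. - \<phi>\<^sub>2 t) t = - deriv \<phi>\<^sub>2 t" .
      have "local_min_at (spacetime {0<..<T} X d) (\<lambda>(s, y). u (s, y) - (- \<phi>\<^sub>1 y + - \<phi>\<^sub>2 s)) (t, x)"
        using *(3) mm[of _ "\<lambda>x. - \<phi>\<^sub>1 x" "\<lambda>t. - \<phi>\<^sub>2 t"] by simp
      then have "0 \<le> deriv (\<lambda>t. - \<phi>\<^sub>2 t) t + H x (enn2real (slope X d (\<lambda>x. - \<phi>\<^sub>1 x) x))"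
        using R *(1,2) up by blast
      then show "deriv \<phi>\<^sub>2 t + - H x (enn2real (slope X d \<phi>\<^sub>1 x)) \<le> 0"
        unfolding dv slope_uminus by linarith
    qed
  qed
qed

lemma viscosity_supersolution_iff:
  "viscosity_supersolution T X d H g u \<longleftrightarrow>
     locally_bounded_map (spacetime {0..<T} X d) u \<and> lsc_map (spacetime {0..<T} X d) u \<and>
     (\<forall>x\<in>X. u (0, x) \<ge> g x) \<and> test_subsolution T X d (\<lambda>x p. - H x p) (\<lambda>p. - u p)"
  unfolding viscosity_supersolution_def test_subsolution_uminus_iff ..

lemma (in compact_geodesic_space) quadratic_subsolution_if_test_subsolution:
  assumes "test_subsolution T X d G v"
  shows "quadratic_subsolution T X d G v"
  unfolding quadratic_subsolution_def
proof (intro ballI allI impI, elim conjE)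
  fix x y t \<epsilon> r and \<theta> \<theta>' :: "real \<Rightarrow> real"
  assume x: "x \<in> X" and y: "y \<in> X" and t: "t \<in> {0<..<T}" and pos: "0 < \<epsilon>" "0 < r"
    and \<theta>: "\<forall>s\<in>{0<..<T}. (\<theta> has_real_derivative \<theta>' s) (at s)" "continuous_on {0<..<T} \<theta>'"
    and max: "\<forall>s\<in>{0<..<T}. \<forall>z\<in>X. \<bar>s - t\<bar> < r \<longrightarrow>
           v (s, z) - \<theta> s - (d z y)\<^sup>2 / (2 * \<epsilon>) \<le> v (t, x) - \<theta> t - (d x y)\<^sup>2 / (2 * \<epsilon>)"
  let ?f = "\<lambda>z. (d z y)\<^sup>2 / (2 * \<epsilon>)"
  have "\<theta> C1_differentiable_on {0<..<T}"
    unfolding C1_differentiable_on_def has_real_derivative_iff_has_vector_derivative[symmetric]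
    using \<theta> by blast
  then have low: "lower_test T X d ?f \<theta>" by (rule lower_test_square_dist[OF y pos(1)])
  let ?U = "({0<..<T} \<inter> ball t r) \<times> X"
  have U: "openin (top_of_set ({0<..<T} \<times> X)) ?U"
    by (intro openin_Times) (auto simp: openin_open_Int)
  have mem: "(t, x) \<in> ?U" using t x pos by simp
  have le: "\<forall>q\<in>?U. (\<lambda>(s, y). v (s, y) - (?f y + \<theta> s)) q \<le> (\<lambda>(s, y). v (s, y) - (?f y + \<theta> s)) (t, x)"
  proof
    fix q assume "q \<in> ?U"
    then obtain s z where q: "q = (s, z)" "s \<in> {0<..<T}" "z \<in> X" "\<bar>s - t\<bar> < r"
      by (auto simp: dist_real_def)
    from max[rule_format, OF q(2-4)]
    show "(\<lambda>(s, y). v (s, y) - (?f y + \<theta> s)) q \<le> (\<lambda>(s, y). v (s, y) - (?f y + \<theta> s)) (t, x)"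
      by (simp add: q(1))
  qed
  have "local_max_at (spacetime {0<..<T} X d) (\<lambda>(s, y). v (s, y) - (?f y + \<theta> s)) (t, x)"
    unfolding local_max_at_def spacetime_eq by (rule exI[of _ ?U]) (intro conjI U mem le)
  then have "deriv \<theta> t + G x (enn2real (slope X d ?f x)) \<le> 0"
    using assms[unfolded test_subsolution_def, rule_format, OF t x] low by simp
  moreover have "deriv \<theta> t = \<theta>' t" using \<theta>(1) t by (blast intro: DERIV_imp_deriv)
  moreover have "enn2real (slope X d ?f x) = d x y / \<epsilon>"
    using slope_square_dist(1)[OF x y pos(1)] pos by simp
  ultimately show "\<theta>' t + G x (d x y / \<epsilon>) \<le> 0" by simp
qed


section \<open>Upper semicontinuous functions\<close>

text \<open>Relaxed limits are at first only semicontinuous; this is the form of upper semicontinuity that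
  the comparison argument uses.\<close>

definition usc_on :: "'a::metric_space set \<Rightarrow> ('a \<Rightarrow> real) \<Rightarrow> bool" where
  "usc_on S f \<longleftrightarrow> (\<forall>p\<in>S. \<forall>e>0. \<exists>r>0. \<forall>q\<in>S. dist q p < r \<longrightarrow> f q < f p + e)"

lemma usc_onD:
  assumes "usc_on S f" "p \<in> S" "e > 0"
  obtains r where "r > 0" "\<And>q. q \<in> S \<Longrightarrow> dist q p < r \<Longrightarrow> f q < f p + e"
  using assms unfolding usc_on_def by blast

lemma continuous_on_imp_usc_on: "continuous_on S f \<Longrightarrow> usc_on S f"
  unfolding usc_on_def
proof (intro ballI allI impI)
  fix p and e :: real assume "continuous_on S f" "p \<in> S" "e > 0"
  then obtain r where "r > 0" "\<forall>q\<in>S. dist q p < r \<longrightarrow> dist (f q) (f p) < e"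
    unfolding continuous_on_iff by blast
  then show "\<exists>r>0. \<forall>q\<in>S. dist q p < r \<longrightarrow> f q < f p + e"
    by (intro exI[of _ r]) (force simp: dist_real_def)
qed

lemma usc_on_add:
  assumes "usc_on S f" "usc_on S g"
  shows "usc_on S (\<lambda>x. f x + g x)"
  unfolding usc_on_def
proof (intro ballI allI impI)
  fix p and e :: real assume p: "p \<in> S" "e > 0"
  then have e2: "e / 2 > 0" by simp
  obtain r where r: "r > 0" "\<And>q. q \<in> S \<Longrightarrow> dist q p < r \<Longrightarrow> f q < f p + e / 2"
    using usc_onD[OF assms(1) p(1) e2] by blast
  obtain r' where r': "r' > 0" "\<And>q. q \<in> S \<Longrightarrow> dist q p < r' \<Longrightarrow> g q < g p + e / 2"
    using usc_onD[OF assms(2) p(1) e2] by blast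
  have "f q + g q < f p + g p + e" if "q \<in> S" "dist q p < min r r'" for q
    using r(2)[of q] r'(2)[of q] that by force
  then show "\<exists>r>0. \<forall>q\<in>S. dist q p < r \<longrightarrow> f q + g q < f p + g p + e"
    using r(1) r'(1) by (intro exI[of _ "min r r'"]) auto
qed

lemma usc_on_compose:
  assumes "usc_on S' f" "continuous_on S g" "g ` S \<subseteq> S'"
  shows "usc_on S (\<lambda>x. f (g x))"
  unfolding usc_on_def
proof (intro ballI allI impI)
  fix p and e :: real assume p: "p \<in> S" "e > 0"
  have gp: "g p \<in> S'" using assms(3) p by blast
  obtain r where r: "r > 0" "\<And>q. q \<in> S' \<Longrightarrow> dist q (g p) < r \<Longrightarrow> f q < f (g p) + e"
    using usc_onD[OF assms(1) gp p(2)] by blast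
  obtain r' where "r' > 0" "\<forall>q\<in>S. dist q p < r' \<longrightarrow> dist (g q) (g p) < r"
    using assms(2) p(1) r(1) unfolding continuous_on_iff by blast
  then show "\<exists>r>0. \<forall>q\<in>S. dist q p < r \<longrightarrow> f (g q) < f (g p) + e"
    using r(2) assms(3) by (intro exI[of _ r']) blast
qed

lemma usc_on_attains_max:
  assumes "compact K" "K \<noteq> {}" "usc_on K f"
  obtains p where "p \<in> K" "\<And>q. q \<in> K \<Longrightarrow> f q \<le> f p"
proof -
  have "\<exists>p\<in>K. \<forall>q\<in>K. f q \<le> f p"
  proof (rule ccontr)
    assume "\<not> ?thesis"
    then obtain c where c: "\<And>p. p \<in> K \<Longrightarrow> c p \<in> K \<and> f p < f (c p)"
      by (meson not_le)
    have "\<exists>r>0. \<forall>q\<in>K. dist q p < r \<longrightarrow> f q < f (c p)" if "p \<in> K" for p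
    proof -
      have "f (c p) - f p > 0" using c[OF that] by simp
      from usc_onD[OF assms(3) that this] show ?thesis by (metis add.commute diff_add_cancel)
    qed
    then obtain r where r: "\<And>p. p \<in> K \<Longrightarrow> r p > 0"
      "\<And>p q. p \<in> K \<Longrightarrow> q \<in> K \<Longrightarrow> dist q p < r p \<Longrightarrow> f q < f (c p)" by metis
    have cov: "K \<subseteq> (\<Union>p\<in>K. ball p (r p))" using r(1) by force
    obtain C where C: "C \<subseteq> K" "finite C" "K \<subseteq> (\<Union>p\<in>C. ball p (r p))"
      using compactE_image[OF assms(1) _ cov] by (metis open_ball)
    have "C \<noteq> {}" using C(3) assms(2) by auto
    define m where "m = Max ((\<lambda>p. f (c p)) ` C)"
    have "m \<in> (\<lambda>p. f (c p)) ` C"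
      unfolding m_def using C \<open>C \<noteq> {}\<close> by (intro Max_in) auto
    then obtain p where p: "p \<in> C" "m = f (c p)" by blast
    have cpK: "c p \<in> K" using c[of p] p C by blast
    then obtain p' where p': "p' \<in> C" "dist (c p) p' < r p'"
      using C(3) by (auto simp: dist_commute)
    have "f (c p) < f (c p')" using r(2)[of p' "c p"] p' cpK C(1) by blast
    moreover have "f (c p') \<le> m" unfolding m_def using C(2) p'(1) by (intro Max_ge) auto
    ultimately show False using p by simp
  qed
  then show thesis using that by blast
qed

lemma usc_on_LIMSEQ_le:
  assumes "usc_on S f" "\<And>k. x k \<in> S" "x \<longlonglongrightarrow> p" "p \<in> S" "\<And>k. c \<le> f (x k)"
  shows "c \<le> f p"
proof (rule field_le_epsilon)
  fix e :: real assume "e > 0"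
  obtain r where r: "r > 0" "\<And>q. q \<in> S \<Longrightarrow> dist q p < r \<Longrightarrow> f q < f p + e"
    using usc_onD[OF assms(1,4) \<open>e > 0\<close>] by blast
  obtain k where "dist (x k) p < r"
    using tendstoD[OF assms(3) r(1)] by (meson eventually_sequentially order_refl)
  then show "c \<le> f p + e" using r(2)[OF assms(2)] assms(5)[of k] by (meson less_imp_le order_trans)
qed


section \<open>Comparison\<close>

lemma tendsto_0_if_square_le:
  fixes f \<epsilon> :: "nat \<Rightarrow> real"
  assumes "\<epsilon> \<longlonglongrightarrow> 0" "\<And>j. (f j)\<^sup>2 \<le> c * \<epsilon> j"
  shows "f \<longlonglongrightarrow> 0"
proof -
  have lim: "(\<lambda>j. c * \<epsilon> j) \<longlonglongrightarrow> 0" using tendsto_mult_left[OF assms(1), of c] by simp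
  have "(\<lambda>j. (f j)\<^sup>2) \<longlonglongrightarrow> 0"
    by (rule tendsto_sandwich[OF _ _ tendsto_const lim]) (use assms(2) in auto)
  then have "(\<lambda>j. sqrt ((f j)\<^sup>2)) \<longlonglongrightarrow> sqrt 0" by (rule tendsto_real_sqrt)
  then show ?thesis by (simp add: tendsto_rabs_zero_iff)
qed

context compact_geodesic_space
begin

text \<open>Doubling of variables. Let \<open>(t, x)\<close> and \<open>(s, y)\<close> maximize
  \<open>U (a + t, x) + W (b + s, y)\<close> minus \<open>(d x y)\<^sup>2 / (2 * \<epsilon>) + (t - s)\<^sup>2 / (2 * \<epsilon>)\<close> and a penalty in \<open>t\<close>. Both
  inequalities are tested with the slope \<open>d x y / \<epsilon>\<close>, so the kinetic terms cancel in their sum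
  and \<open>V x - V y\<close>, which tends to \<open>0\<close> with \<open>\<epsilon>\<close>, has to dominate the positive slope of the penalty.
  The two offsets \<open>a\<close> and \<open>b\<close> allow a solution to be compared with its own translate in time,
  without extending test functions beyond \<open>{0<..<T}\<close>.\<close>

lemma comparison:
  assumes U: "usc_on ({0..<T} \<times> X) U" and W: "usc_on ({0..<T} \<times> X) W"
    and QU: "quadratic_subsolution T X d (\<lambda>x p. h p + V x) U"
    and QW: "quadratic_subsolution T X d (\<lambda>x p. - (h p + V x)) W"
    and V: "continuous_on X V"
    and ab: "0 \<le> a" "0 \<le> b"
    and init: "\<And>x. x \<in> X \<Longrightarrow> U (a, x) + W (b, x) \<le> M"
    and t1: "0 \<le> t1" "a + t1 < T" "b + t1 < T" and x1: "x1 \<in> X"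
  shows "U (a + t1, x1) + W (b + t1, x1) \<le> M"
proof (rule ccontr)
  assume neg: "\<not> ?thesis"
  define \<mu> where "\<mu> = (U (a + t1, x1) + W (b + t1, x1) - M) / 3"
  have \<mu>: "\<mu> > 0" "U (a + t1, x1) + W (b + t1, x1) = M + 3 * \<mu>" using neg by (auto simp: \<mu>_def field_simps)
  define \<tau> where "\<tau> = (t1 + (T - max a b)) / 2"
  have \<tau>: "t1 < \<tau>" "a + \<tau> < T" "b + \<tau> < T"
  proof -
    have "t1 < T - max a b" using t1 by (simp add: max_def)
    then have "t1 < \<tau>" "\<tau> < T - max a b" by (auto simp: \<tau>_def)
    then show "t1 < \<tau>" "a + \<tau> < T" "b + \<tau> < T" by (auto simp: max_def split: if_splits)
  qed
  define I where "I = {0..\<tau>}"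
  define K where "K = (I \<times> X) \<times> (I \<times> X)"
  have K: "compact K" unfolding K_def I_def by (intro compact_Times compact_Icc compact_space)
  have diag: "((t1, x1), (t1, x1)) \<in> K" using t1 \<tau> x1 by (auto simp: K_def I_def)
  define F where "F p = U (a + fst (fst p), snd (fst p)) + W (b + fst (snd p), snd (snd p))"
    for p :: "(real \<times> 'a) \<times> (real \<times> 'a)"
  have uF: "usc_on K F"
    unfolding F_def K_def I_def
    by (intro usc_on_add usc_on_compose[OF U] usc_on_compose[OF W] continuous_intros)
       (use \<tau> ab in \<open>auto simp: image_subset_iff\<close>)
  obtain q where "q \<in> K" "\<And>p. p \<in> K \<Longrightarrow> F p \<le> F q"
    using usc_on_attains_max[OF K _ uF] diag by blast
  then obtain B where B: "\<And>p. p \<in> K \<Longrightarrow> F p \<le> B" by blast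
  \<comment> \<open>The penalty consists of a linear term, which makes the inequality strict, and of an
      exponential, which is at most \<open>\<mu>\<close> up to time \<open>t1\<close> but is so large at time \<open>\<tau>\<close> that the
      maximum cannot occur there. A smooth increasing function is preferred to one that blows up
      at \<open>\<tau>\<close> because it is a test function on all of \<open>{0<..<T}\<close>.\<close>
  define \<kappa> where "\<kappa> = (\<bar>B - M\<bar> / \<mu>) / (\<tau> - t1)"
  have \<kappa>: "\<kappa> \<ge> 0" "B - M \<le> \<mu> * exp (\<kappa> * (\<tau> - t1))"
  proof -
    show "\<kappa> \<ge> 0" unfolding \<kappa>_def using \<mu> \<tau> by simp
    have "\<bar>B - M\<bar> / \<mu> \<le> exp (\<kappa> * (\<tau> - t1))"
    proof -
      have "\<kappa> * (\<tau> - t1) = \<bar>B - M\<bar> / \<mu>" using \<tau> by (simp add: \<kappa>_def)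
      then show ?thesis using exp_ge_add_one_self[of "\<kappa> * (\<tau> - t1)"] by linarith
    qed
    then have "\<bar>B - M\<bar> \<le> \<mu> * exp (\<kappa> * (\<tau> - t1))" using \<mu> by (simp add: field_simps)
    then show "B - M \<le> \<mu> * exp (\<kappa> * (\<tau> - t1))" by linarith
  qed
  define \<alpha> where "\<alpha> = \<mu> / (t1 + 1)"
  have lam: "\<alpha> > 0" "\<alpha> * t1 \<le> \<mu>"
    using \<mu> t1 by (auto simp: \<alpha>_def field_simps)
  define pen where "pen t = \<alpha> * t + \<mu> * exp (\<kappa> * (t - t1))" for t
  have pen0: "pen t \<ge> 0" if "t \<ge> 0" for t using lam \<mu> that by (auto simp: pen_def)
  define \<epsilon> where "\<epsilon> j = inverse (real (Suc j))" for j
  have \<epsilon>: "\<epsilon> j > 0" for j by (simp add: \<epsilon>_def)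
  have \<epsilon>0: "\<epsilon> \<longlonglongrightarrow> 0" unfolding \<epsilon>_def by (rule LIMSEQ_inverse_real_of_nat)
  define \<Phi> where "\<Phi> j p = F p + - (pen (fst (fst p)) + ((d (snd (fst p)) (snd (snd p)))\<^sup>2
      + (fst (fst p) - fst (snd p))\<^sup>2) / (2 * \<epsilon> j))" for j p
  have "\<exists>p. p \<in> K \<and> (\<forall>q\<in>K. \<Phi> j q \<le> \<Phi> j p)" for j
  proof -
    have "usc_on K (\<Phi> j)"
      unfolding \<Phi>_def pen_def
      by (intro usc_on_add uF continuous_on_imp_usc_on continuous_intros continuous_on_mdist)
         (use \<epsilon>[of j] in \<open>auto simp: K_def\<close>)
    moreover have "K \<noteq> {}" using diag by auto
    ultimately obtain p where "p \<in> K" "\<And>q. q \<in> K \<Longrightarrow> \<Phi> j q \<le> \<Phi> j p"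
      using usc_on_attains_max[OF K, of "\<Phi> j"] by metis
    then show ?thesis by (intro exI[of _ p] conjI ballI)
  qed
  then obtain P where P: "\<And>j. P j \<in> K" "\<And>j q. q \<in> K \<Longrightarrow> \<Phi> j q \<le> \<Phi> j (P j)" by metis
  define t where "t j = fst (fst (P j))" for j
  define x where "x j = snd (fst (P j))" for j
  define s where "s j = fst (snd (P j))" for j
  define y where "y j = snd (snd (P j))" for j
  have Pj: "P j = ((t j, x j), (s j, y j))" for j by (simp add: t_def x_def s_def y_def)
  have txsy: "t j \<in> I" "x j \<in> X" "s j \<in> I" "y j \<in> X" for j
    using P(1)[of j] by (auto simp: Pj K_def)
  have low: "M + \<mu> \<le> \<Phi> j (P j)" for j
  proof -
    have "M + \<mu> \<le> \<Phi> j ((t1, x1), (t1, x1))"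
      using \<mu> lam x1 by (simp add: \<Phi>_def F_def pen_def)
    with P(2)[OF diag, of j] show ?thesis by linarith
  qed
  have quad: "((d (x j) (y j))\<^sup>2 + (t j - s j)\<^sup>2) / (2 * \<epsilon> j) \<le> B - M" for j
    using low[of j] B[OF P(1), of j] pen0[of "t j"] txsy(1)[of j] \<mu>
    by (simp add: \<Phi>_def Pj I_def)
  have quad': "(d (x j) (y j))\<^sup>2 + (t j - s j)\<^sup>2 \<le> (2 * (B - M)) * \<epsilon> j" for j
    using quad[of j] \<epsilon>[of j] by (simp add: field_simps)
  have dxy0: "(\<lambda>j. d (x j) (y j)) \<longlonglongrightarrow> 0"
  proof (rule tendsto_0_if_square_le[OF \<epsilon>0])
    show "(d (x j) (y j))\<^sup>2 \<le> (2 * (B - M)) * \<epsilon> j" for j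
      using quad'[of j] zero_le_power2[of "t j - s j"] by linarith
  qed
  have ts0: "(\<lambda>j. t j - s j) \<longlonglongrightarrow> 0"
  proof (rule tendsto_0_if_square_le[OF \<epsilon>0])
    show "(t j - s j)\<^sup>2 \<le> (2 * (B - M)) * \<epsilon> j" for j
      using quad'[of j] zero_le_power2[of "d (x j) (y j)"] by linarith
  qed
  obtain p r where pr: "p \<in> K" "strict_mono r" "(P \<circ> r) \<longlonglongrightarrow> p"
    using K P(1) unfolding compact_def by metis
  define t0 where "t0 = fst (fst p)"
  define x0 where "x0 = snd (fst p)"
  have tl: "(\<lambda>j. t (r j)) \<longlonglongrightarrow> t0" and xl: "(\<lambda>j. x (r j)) \<longlonglongrightarrow> x0"
    and sl: "(\<lambda>j. s (r j)) \<longlonglongrightarrow> fst (snd p)" and yl: "(\<lambda>j. y (r j)) \<longlonglongrightarrow> snd (snd p)"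
    using pr(3) unfolding t_def x_def s_def y_def t0_def x0_def comp_def
    by (auto intro!: tendsto_intros)
  have x0: "x0 \<in> X" "snd (snd p) \<in> X" "t0 \<in> I" using pr(1) by (auto simp: K_def x0_def t0_def)
  have "(\<lambda>j. d (x (r j)) (y (r j))) \<longlonglongrightarrow> d x0 (snd (snd p))"
    by (rule tendsto_mdist[OF xl yl]) (use txsy x0 in auto)
  moreover have "(\<lambda>j. d (x (r j)) (y (r j))) \<longlonglongrightarrow> 0"
    using LIMSEQ_subseq_LIMSEQ[OF dxy0 pr(2)] by (simp add: comp_def)
  ultimately have "d x0 (snd (snd p)) = 0" using LIMSEQ_unique by blast
  then have y0: "snd (snd p) = x0" using x0 by simp
  have "(\<lambda>j. t (r j) - s (r j)) \<longlonglongrightarrow> t0 - fst (snd p)" by (intro tendsto_intros tl sl)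
  moreover have "(\<lambda>j. t (r j) - s (r j)) \<longlonglongrightarrow> 0"
    using LIMSEQ_subseq_LIMSEQ[OF ts0 pr(2)] by (simp add: comp_def)
  ultimately have s0: "fst (snd p) = t0" using LIMSEQ_unique by fastforce
  have peq: "p = ((t0, x0), (t0, x0))"
    using y0 s0 by (simp add: t0_def x0_def prod_eq_iff)
  have "M + \<mu> \<le> F p + - pen (fst (fst p))"
  proof (rule usc_on_LIMSEQ_le[where S=K and x="P \<circ> r" and f="\<lambda>p. F p + - pen (fst (fst p))"])
    show "usc_on K (\<lambda>p. F p + - pen (fst (fst p)))"
      unfolding pen_def by (intro usc_on_add uF continuous_on_imp_usc_on continuous_intros)
    show "M + \<mu> \<le> F ((P \<circ> r) k) + - pen (fst (fst ((P \<circ> r) k)))" for k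
    proof -
      have "0 \<le> ((d (x (r k)) (y (r k)))\<^sup>2 + (t (r k) - s (r k))\<^sup>2) / (2 * \<epsilon> (r k))"
        using \<epsilon>[of "r k"] by simp
      then show ?thesis using low[of "r k"] by (simp add: \<Phi>_def Pj)
    qed
  qed (use pr P(1) in auto)
  then have low0: "M + \<mu> + pen t0 \<le> U (a + t0, x0) + W (b + t0, x0)"
    by (simp add: peq F_def)
  have "t0 \<noteq> 0"
  proof
    assume "t0 = 0"
    then show False using low0 init[OF x0(1)] \<mu> pen0[of 0] by simp
  qed
  moreover have "t0 \<noteq> \<tau>"
  proof
    assume "t0 = \<tau>"
    moreover have "\<alpha> * \<tau> \<ge> 0" using lam \<tau> t1 by simp
    moreover have "U (a + t0, x0) + W (b + t0, x0) \<le> B" using B[OF pr(1)] by (simp add: peq F_def)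
    ultimately show False using low0 \<kappa>(2) \<mu> unfolding pen_def by simp
  qed
  ultimately have t0: "0 < t0" "t0 < \<tau>" using x0(3) by (auto simp: I_def)
  have ev: "\<forall>\<^sub>F j in sequentially. 0 < t (r j) \<and> t (r j) < \<tau> \<and> 0 < s (r j) \<and> s (r j) < \<tau>"
    using order_tendstoD[OF tl] order_tendstoD[OF sl] t0 unfolding s0
    by (intro eventually_conj) auto
  have key: "\<alpha> + V (x j) - V (y j) \<le> 0"
    if j: "0 < t j" "t j < \<tau>" "0 < s j" "s j < \<tau>" for j
  proof -
    have max: "\<Phi> j ((t', x'), (s', y')) \<le> \<Phi> j (P j)" if "t' \<in> I" "x' \<in> X" "s' \<in> I" "y' \<in> X" for t' x' s' y'
      using P(2)[of "((t', x'), (s', y'))" j] that by (simp add: K_def)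
    have 1: "(\<alpha> + \<mu> * \<kappa> * exp (\<kappa> * (a + t j - a - t1)) + (a + t j - a - s j) / \<epsilon> j)
        + (h (d (x j) (y j) / \<epsilon> j) + V (x j)) \<le> 0"
    proof (rule QU[unfolded quadratic_subsolution_def, rule_format,
          where \<theta> = "\<lambda>q. pen (q - a) + (q - a - s j)\<^sup>2 / (2 * \<epsilon> j)"
          and \<theta>' = "\<lambda>q. \<alpha> + \<mu> * \<kappa> * exp (\<kappa> * (q - a - t1)) + (q - a - s j) / \<epsilon> j"
          and r = "min (t j) (\<tau> - t j)"], safe)
      fix q z assume q: "q \<in> {0<..<T}" "z \<in> X" "\<bar>q - (a + t j)\<bar> < min (t j) (\<tau> - t j)"
      have "q - a \<in> I" using q(3) unfolding I_def by auto
      from max[OF this q(2) txsy(3,4)[of j]]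
      show "U (q, z) - (pen (q - a) + (q - a - s j)\<^sup>2 / (2 * \<epsilon> j)) - (d z (y j))\<^sup>2 / (2 * \<epsilon> j)
        \<le> U (a + t j, x j) - (pen (a + t j - a) + (a + t j - a - s j)\<^sup>2 / (2 * \<epsilon> j)) - (d (x j) (y j))\<^sup>2 / (2 * \<epsilon> j)"
        by (simp add: \<Phi>_def F_def Pj add_divide_distrib)
    next
      fix q
      show "((\<lambda>q. pen (q - a) + (q - a - s j)\<^sup>2 / (2 * \<epsilon> j)) has_real_derivative
         \<alpha> + \<mu> * \<kappa> * exp (\<kappa> * (q - a - t1)) + (q - a - s j) / \<epsilon> j) (at q)"
        unfolding pen_def using \<epsilon>[of j]
        by (auto intro!: derivative_eq_intros simp: field_simps)
    qed (use txsy[of j] j \<tau> ab \<epsilon>[of j] in \<open>auto intro!: continuous_intros\<close>)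
    have 2: "(b + s j - b - t j) / \<epsilon> j + - (h (d (y j) (x j) / \<epsilon> j) + V (y j)) \<le> 0"
    proof (rule QW[unfolded quadratic_subsolution_def, rule_format,
          where \<theta> = "\<lambda>q. (q - b - t j)\<^sup>2 / (2 * \<epsilon> j)"
          and \<theta>' = "\<lambda>q. (q - b - t j) / \<epsilon> j"
          and r = "min (s j) (\<tau> - s j)"], safe)
      fix q z assume q: "q \<in> {0<..<T}" "z \<in> X" "\<bar>q - (b + s j)\<bar> < min (s j) (\<tau> - s j)"
      have "q - b \<in> I" using q(3) unfolding I_def by auto
      from max[OF txsy(1,2)[of j] this q(2)]
      show "W (q, z) - (q - b - t j)\<^sup>2 / (2 * \<epsilon> j) - (d z (x j))\<^sup>2 / (2 * \<epsilon> j)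
        \<le> W (b + s j, y j) - (b + s j - b - t j)\<^sup>2 / (2 * \<epsilon> j) - (d (y j) (x j))\<^sup>2 / (2 * \<epsilon> j)"
        by (simp add: \<Phi>_def F_def Pj add_divide_distrib commute[of _ "x j"] power2_commute[of "t j"])
    next
      fix q
      show "((\<lambda>q. (q - b - t j)\<^sup>2 / (2 * \<epsilon> j)) has_real_derivative (q - b - t j) / \<epsilon> j) (at q)"
        using \<epsilon>[of j] by (auto intro!: derivative_eq_intros simp: field_simps)
    qed (use txsy[of j] j \<tau> ab \<epsilon>[of j] in \<open>auto intro!: continuous_intros\<close>)
    have "0 \<le> \<mu> * \<kappa> * exp (\<kappa> * (a + t j - a - t1))" using \<mu> \<kappa> by simp
    moreover have "(a + t j - a - s j) / \<epsilon> j + (b + s j - b - t j) / \<epsilon> j = 0"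
      by (simp flip: add_divide_distrib)
    ultimately show ?thesis using 1 2 unfolding commute[of "y j" "x j"] by linarith
  qed
  have "(\<lambda>j. \<alpha> + V (x (r j)) - V (y (r j))) \<longlonglongrightarrow> \<alpha> + V x0 - V x0"
    using yl unfolding y0
    by (intro tendsto_intros continuous_on_tendsto_compose[OF V xl] continuous_on_tendsto_compose[OF V])
       (use txsy x0 in auto)
  moreover have "\<forall>\<^sub>F j in sequentially. \<alpha> + V (x (r j)) - V (y (r j)) \<le> 0"
    using ev by eventually_elim (use key in auto)
  ultimately have "\<alpha> + V x0 - V x0 \<le> 0" by (rule tendsto_upperbound) simp
  then show False using lam by simp
qed

text \<open>A squared distance that touches an \<open>L\<close>-Lipschitz function from above has slope at most \<open>L\<close> at the
  contact point: moving towards \<open>y\<close> decreases it at the rate \<open>d x y / \<epsilon>\<close>, and the function must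
  decrease at least as fast. With \<open>- g\<close> in place of \<open>g\<close> the lemma also provides upper barriers.\<close>

lemma quadratic_subsolution_barrier:
  assumes lip: "\<And>x y. x \<in> X \<Longrightarrow> y \<in> X \<Longrightarrow> \<bar>g x - g y\<bar> \<le> L * d x y"
    and L: "L \<ge> 0" and G: "\<And>x p. x \<in> X \<Longrightarrow> 0 \<le> p \<Longrightarrow> p \<le> L \<Longrightarrow> G x p \<le> C"
  shows "quadratic_subsolution T X d G (\<lambda>(t, x). g x - C * t)"
  unfolding quadratic_subsolution_def
proof (intro ballI allI impI, elim conjE)
  fix x y t \<epsilon> r and \<theta> \<theta>' :: "real \<Rightarrow> real"
  assume x: "x \<in> X" and y: "y \<in> X" and t: "t \<in> {0<..<T}" and pos: "0 < \<epsilon>" "0 < r"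
    and \<theta>: "\<forall>s\<in>{0<..<T}. (\<theta> has_real_derivative \<theta>' s) (at s)" "continuous_on {0<..<T} \<theta>'"
    and max: "\<forall>s\<in>{0<..<T}. \<forall>z\<in>X. \<bar>s - t\<bar> < r \<longrightarrow>
           (case (s, z) of (t, x) \<Rightarrow> g x - C * t) - \<theta> s - (d z y)\<^sup>2 / (2 * \<epsilon>)
           \<le> (case (t, x) of (t, x) \<Rightarrow> g x - C * t) - \<theta> t - (d x y)\<^sup>2 / (2 * \<epsilon>)"
  have "((\<lambda>s. \<theta> s + C * s) has_real_derivative \<theta>' t + C) (at t)"
    using \<theta>(1) t by (auto intro!: derivative_eq_intros)
  moreover have "min r (min t (T - t)) > 0" using t pos by auto
  moreover have "\<forall>s. \<bar>t - s\<bar> < min r (min t (T - t)) \<longrightarrow> \<theta> t + C * t \<le> \<theta> s + C * s"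
  proof (intro allI impI)
    fix s assume s: "\<bar>t - s\<bar> < min r (min t (T - t))"
    then have "s \<in> {0<..<T}" "\<bar>s - t\<bar> < r" by auto
    then show "\<theta> t + C * t \<le> \<theta> s + C * s" using max x by fastforce
  qed
  ultimately have der: "\<theta>' t + C = 0" by (rule DERIV_local_min)
  have spat: "g z - (d z y)\<^sup>2 / (2 * \<epsilon>) \<le> g x - (d x y)\<^sup>2 / (2 * \<epsilon>)" if "z \<in> X" for z
    using max t that pos by fastforce
  have "d x y / \<epsilon> \<le> L"
  proof (rule ccontr)
    assume "\<not> ?thesis"
    then have gt: "L < d x y / \<epsilon>" by simp
    then have "d x y > 0" using L pos by (simp add: field_simps) (smt (verit) mult_nonneg_nonneg)
    define h where "h = min (d x y) (\<epsilon> * (d x y / \<epsilon> - L))"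
    have h: "0 < h" "h \<le> d x y" "h \<le> \<epsilon> * (d x y / \<epsilon> - L)"
      using \<open>d x y > 0\<close> gt pos by (auto simp: h_def)
    obtain z where z: "z \<in> X" "d x z = h" "d z y = d x y - h"
      using between[OF x y, of h] h by auto
    have "(d x y)\<^sup>2 / (2 * \<epsilon>) - (d z y)\<^sup>2 / (2 * \<epsilon>) \<le> L * h"
      using spat[OF z(1)] lip[OF x z(1)] z(2) by auto
    moreover have "(d x y)\<^sup>2 / (2 * \<epsilon>) - (d z y)\<^sup>2 / (2 * \<epsilon>) = h * (d x y / \<epsilon> - h / (2 * \<epsilon>))"
      using pos unfolding z(3) by (simp add: power2_eq_square field_simps)
    ultimately have "d x y / \<epsilon> - h / (2 * \<epsilon>) \<le> L" using h(1) by (simp add: mult.commute)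
    moreover have "h / (2 * \<epsilon>) \<le> (d x y / \<epsilon> - L) / 2"
      using divide_right_mono[OF h(3), of "2 * \<epsilon>"] pos by simp
    ultimately show False using gt by argo
  qed
  then have "G x (d x y / \<epsilon>) \<le> C" using G[OF x] pos by simp
  then show "\<theta>' t + G x (d x y / \<epsilon>) \<le> 0" using der by simp
qed

text \<open>The constant \<open>C\<close> depends only on \<open>L\<close> and on a bound for \<open>V\<close>, so these estimates are uniform over
  all approximating spaces. The first estimate compares \<open>u\<close> with the barriers \<open>g \<plusminus> C t\<close>; it bounds the change
  of \<open>u\<close> over an initial time interval of length \<open>h\<close>, and comparing \<open>u\<close> with its translate by \<open>h\<close>
  propagates that bound to later times.\<close>

lemma solution_bounds:
  fixes u :: "real \<times> 'a \<Rightarrow> real"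
  assumes u: "continuous_on ({0..<T} \<times> X) u"
    and Q1: "quadratic_subsolution T X d (\<lambda>x p. p\<^sup>2 / 2 + V x) u"
    and Q2: "quadratic_subsolution T X d (\<lambda>x p. - (p\<^sup>2 / 2 + V x)) (\<lambda>p. - u p)"
    and V: "continuous_on X V" and C: "\<And>x. x \<in> X \<Longrightarrow> L\<^sup>2 / 2 + \<bar>V x\<bar> \<le> C"
    and init: "\<And>x. x \<in> X \<Longrightarrow> u (0, x) = g x"
    and lip: "\<And>x y. x \<in> X \<Longrightarrow> y \<in> X \<Longrightarrow> \<bar>g x - g y\<bar> \<le> L * d x y" and L: "L \<ge> 0"
  shows "\<And>t x. t \<in> {0..<T} \<Longrightarrow> x \<in> X \<Longrightarrow> \<bar>u (t, x) - g x\<bar> \<le> C * t"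
    and "\<And>s t x. s \<in> {0..<T} \<Longrightarrow> t \<in> {0..<T} \<Longrightarrow> x \<in> X \<Longrightarrow> \<bar>u (s, x) - u (t, x)\<bar> \<le> C * \<bar>s - t\<bar>"
proof -
  have gc: "continuous_on X g"
  proof (rule locally_lipschitz_continuous)
    show "locally_lipschitz_wrt d X g"
      unfolding locally_lipschitz_wrt_def lipschitz_wrt_def
      using lip by (intro ballI exI[of _ 1] conjI exI[of _ L]) auto
  qed
  have usc: "usc_on ({0..<T} \<times> X) u" "usc_on ({0..<T} \<times> X) (\<lambda>p. - u p)"
    by (intro continuous_on_imp_usc_on continuous_intros u)+
  have bc: "usc_on ({0..<T} \<times> X) (\<lambda>(t, x). f x - C * t)" if "continuous_on X f" for f
    unfolding case_prod_unfold
    by (intro continuous_on_imp_usc_on continuous_intros continuous_on_compose2[OF that]) auto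
  have p2: "p\<^sup>2 \<le> L\<^sup>2" if "0 \<le> p" "p \<le> L" for p using that by (intro power_mono) auto
  have b1: "quadratic_subsolution T X d (\<lambda>x p. p\<^sup>2 / 2 + V x) (\<lambda>(t, x). g x - C * t)"
  proof (rule quadratic_subsolution_barrier[OF lip L])
    show "p\<^sup>2 / 2 + V x \<le> C" if "x \<in> X" "0 \<le> p" "p \<le> L" for x p
      using p2[OF that(2,3)] C[OF that(1)] by linarith
  qed
  have b2: "quadratic_subsolution T X d (\<lambda>x p. - (p\<^sup>2 / 2 + V x)) (\<lambda>(t, x). - g x - C * t)"
  proof (rule quadratic_subsolution_barrier[OF _ L])
    show "\<bar>- g x - - g y\<bar> \<le> L * d x y" if "x \<in> X" "y \<in> X" for x y using lip[OF that] by linarith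
    show "- (p\<^sup>2 / 2 + V x) \<le> C" if "x \<in> X" "0 \<le> p" "p \<le> L" for x p
      using zero_le_power2[of p] zero_le_power2[of L] C[OF that(1)] by linarith
  qed
  have bd: "\<bar>u (t, x) - g x\<bar> \<le> C * t" if "t \<in> {0..<T}" "x \<in> X" for t x
  proof -
    have "u (0 + t, x) + (\<lambda>(t, x). - g x - C * t) (0 + t, x) \<le> 0"
      by (rule comparison[OF usc(1) bc Q1 b2 V]) (use that init gc in \<open>auto intro!: continuous_intros\<close>)
    moreover have "(\<lambda>(t, x). g x - C * t) (0 + t, x) + - u (0 + t, x) \<le> 0"
      by (rule comparison[OF bc usc(2) b1 Q2 V]) (use that init gc in auto)
    ultimately show ?thesis by simp
  qed
  then show "\<And>t x. t \<in> {0..<T} \<Longrightarrow> x \<in> X \<Longrightarrow> \<bar>u (t, x) - g x\<bar> \<le> C * t" .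
  have mono: "\<bar>u (t + h, x) - u (t, x)\<bar> \<le> C * h" if "0 \<le> t" "0 \<le> h" "t + h < T" "x \<in> X" for t h x
  proof -
    have i: "\<bar>u (h, x) - u (0, x)\<bar> \<le> C * h" if "x \<in> X" for x
      using bd[of h x] init[of x] that \<open>0 \<le> t\<close> \<open>0 \<le> h\<close> \<open>t + h < T\<close> by simp
    have "u (h + t, x) + - u (0 + t, x) \<le> C * h"
    proof (rule comparison[OF usc Q1 Q2 V])
      show "u (h, x) + - u (0, x) \<le> C * h" if "x \<in> X" for x using i[OF that] by linarith
    qed (use that in auto)
    moreover have "u (0 + t, x) + - u (h + t, x) \<le> C * h"
    proof (rule comparison[OF usc Q1 Q2 V])
      show "u (0, x) + - u (h, x) \<le> C * h" if "x \<in> X" for x using i[OF that] by linarith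
    qed (use that in auto)
    ultimately show ?thesis by (simp add: add.commute)
  qed
  show "\<bar>u (s, x) - u (t, x)\<bar> \<le> C * \<bar>s - t\<bar>" if "s \<in> {0..<T}" "t \<in> {0..<T}" "x \<in> X" for s t x
  proof (cases "s \<le> t")
    case True
    then show ?thesis using mono[of s "t - s" x] that by (simp add: abs_minus_commute)
  next
    case False
    then show ?thesis using mono[of t "s - t" x] that by simp
  qed
qed

end


section \<open>Slopes at penalized minima\<close>

context compact_geodesic_space
begin

lemma dist_small:
  assumes "x \<in> X" "e > 0"
  shows "\<exists>r>0. \<forall>y\<in>X. d y x < r \<longrightarrow> dist y x < e"
proof -
  have "openin mtopology (X \<inter> ball x e)"
    unfolding mtopology_eq by (simp add: openin_open_Int)
  then obtain r where "r > 0" "mball x r \<subseteq> X \<inter> ball x e"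
    using assms unfolding openin_mtopology by (metis IntI centre_in_ball)
  then show ?thesis
    using assms by (intro exI[of _ r]) (auto simp: commute dist_commute subset_iff)
qed

text \<open>At a minimum point \<open>y\<close> of \<open>f\<close> plus squared distances, \<open>f\<close> cannot decrease faster than these
  increase, which bounds the subslope from above. Along the geodesic from \<open>y\<close> towards \<open>x\<close> the term
  \<open>(d x y)\<^sup>2 / (2 * \<epsilon>)\<close> decreases at the rate \<open>d x y / \<epsilon>\<close>, so \<open>f\<close> must increase there, which bounds
  the slope from below. For a test function the two slopes agree, and \<open>d x y / \<epsilon>\<close> is determined up
  to the error caused by the penalty.\<close>

lemma slope_at_penalized_minimum:
  assumes x: "x \<in> X" and y: "y \<in> X" and x0: "x0 \<in> X" and pos: "\<epsilon> > 0" "K \<ge> 0"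
    and min: "\<And>z. z \<in> X \<Longrightarrow> f y + K * (d y x0)\<^sup>2 + (d x y)\<^sup>2 / (2 * \<epsilon>) \<le> f z + K * (d z x0)\<^sup>2 + (d x z)\<^sup>2 / (2 * \<epsilon>)"
  shows "subslope X d f y \<le> ennreal (d x y / \<epsilon> + 2 * K * d y x0)"
    and "ennreal (d x y / \<epsilon> - 2 * K * d y x0) \<le> slope X d f y"
proof -
  have pen: "K * (d z x0)\<^sup>2 - K * (d y x0)\<^sup>2 \<le> d z y * (2 * K * d y x0 + K * d z y)" if "z \<in> X" for z
    using mult_left_mono[OF square_dist_diff_le[OF y x0 that] pos(2)] by (simp add: algebra_simps)
  show "subslope X d f y \<le> ennreal (d x y / \<epsilon> + 2 * K * d y x0)"
  proof (rule subslope_le[where r=1 and k="K + 1 / (2 * \<epsilon>)"])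
    fix z assume z: "z \<in> X"
    have "(d x z)\<^sup>2 / (2 * \<epsilon>) - (d x y)\<^sup>2 / (2 * \<epsilon>) \<le> (d z y * (2 * d x y + d z y)) / (2 * \<epsilon>)"
      using square_dist_diff_le[OF y x z] pos
      unfolding commute[of z x] commute[of y x] diff_divide_distrib[symmetric]
      by (intro divide_right_mono) auto
    also have "\<dots> = d z y * (d x y / \<epsilon> + 1 / (2 * \<epsilon>) * d z y)"
      using pos by (simp add: field_simps)
    finally have "f y - f z \<le> d z y * (2 * K * d y x0 + K * d z y) + d z y * (d x y / \<epsilon> + 1 / (2 * \<epsilon>) * d z y)"
      using min[OF z] pen[OF z] by linarith
    then show "f y - f z \<le> d z y * (d x y / \<epsilon> + 2 * K * d y x0 + (K + 1 / (2 * \<epsilon>)) * d z y)"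
      by (simp add: algebra_simps)
  qed (use y pos in auto)
  show "ennreal (d x y / \<epsilon> - 2 * K * d y x0) \<le> slope X d f y"
  proof (cases "x = y")
    case True
    then have "d x y / \<epsilon> - 2 * K * d y x0 \<le> 0" using y pos by simp
    then show ?thesis by (simp add: ennreal_neg)
  next
    case False
    then have dpos: "0 < d x y" using x y by simp
    show ?thesis
    proof (rule slope_ge[where r="d x y" and k="K + 1 / (2 * \<epsilon>)"])
      fix h assume h: "0 < h" "h < d x y"
      then obtain z where z: "z \<in> X" "d y z = h" "d z x = d y x - h"
        using between[OF y x, of h] commute[of x y] by auto
      have dz: "d z y = h" "d x z = d x y - h" using z commute by metis+
      have "(d x y)\<^sup>2 / (2 * \<epsilon>) - (d x z)\<^sup>2 / (2 * \<epsilon>) = h * (d x y / \<epsilon> - 1 / (2 * \<epsilon>) * h)"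
        using pos unfolding dz by (simp add: power2_eq_square field_simps)
      then have "h * (d x y / \<epsilon> - 1 / (2 * \<epsilon>) * h) - h * (2 * K * d y x0 + K * h) \<le> f z - f y"
        using min[OF z(1)] pen[OF z(1)] unfolding dz(1) by linarith
      then have "h * (d x y / \<epsilon> - 2 * K * d y x0 - (K + 1 / (2 * \<epsilon>)) * h) \<le> f z - f y"
        by (simp add: algebra_simps)
      then show "\<exists>z\<in>X. d z y = h \<and> h * (d x y / \<epsilon> - 2 * K * d y x0 - (K + 1 / (2 * \<epsilon>)) * h) \<le> f z - f y"
        using z(1) dz(1) by (intro bexI[of _ z]) auto
    qed (use y pos dpos in auto)
  qed
qed

end


section \<open>Relaxed limits\<close>

text \<open>The upper half-relaxed limit of functions \<open>v n\<close> on sets \<open>S n\<close>, that is, the upper limit of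
  \<open>v n q\<close> as \<open>n\<close> tends to infinity and \<open>q \<in> S n\<close> tends to \<open>p\<close>. The lower one is minus the upper
  one of \<open>- v n\<close>.\<close>

definition upper_relaxed_limit ::
    "(nat \<Rightarrow> 'a::metric_space set) \<Rightarrow> (nat \<Rightarrow> 'a \<Rightarrow> real) \<Rightarrow> 'a \<Rightarrow> real" where
  "upper_relaxed_limit S v p =
     Inf {a. \<exists>r>0. \<exists>K. \<forall>n\<ge>K. \<forall>q\<in>S n. dist q p < r \<longrightarrow> v n q \<le> a}"

locale relaxation =
  fixes S :: "nat \<Rightarrow> 'a::metric_space set" and Y :: "'a set" and B :: real
  assumes recovery: "\<And>p. p \<in> Y \<Longrightarrow> \<exists>q. (\<forall>n. q n \<in> S n) \<and> q \<longlonglongrightarrow> p"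
begin

context
  fixes v :: "nat \<Rightarrow> 'a \<Rightarrow> real"
  assumes bounded: "\<And>n q. q \<in> S n \<Longrightarrow> \<bar>v n q\<bar> \<le> B"
begin

abbreviation U where "U \<equiv> upper_relaxed_limit S v"

lemma relaxed_bounds_below:
  assumes p: "p \<in> Y" and "r > 0" "\<And>n q. n \<ge> K \<Longrightarrow> q \<in> S n \<Longrightarrow> dist q p < r \<Longrightarrow> v n q \<le> a"
  shows "- B \<le> a"
proof -
  obtain q where q: "\<And>n. q n \<in> S n" "q \<longlonglongrightarrow> p" using recovery[OF p] by blast
  have "\<forall>\<^sub>F n in sequentially. dist (q n) p < r \<and> n \<ge> K"
    using tendstoD[OF q(2) \<open>r > 0\<close>] eventually_ge_at_top[of K] by eventually_elim auto
  then obtain n where "dist (q n) p < r" "n \<ge> K" by (auto simp: eventually_sequentially)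
  then show ?thesis using assms(3)[of n "q n"] bounded[OF q(1)[of n]] q(1)[of n] by linarith
qed

lemma relaxed_le:
  assumes p: "p \<in> Y" and "r > 0" "\<And>n q. n \<ge> K \<Longrightarrow> q \<in> S n \<Longrightarrow> dist q p < r \<Longrightarrow> v n q \<le> a"
  shows "U p \<le> a"
  unfolding upper_relaxed_limit_def
proof (rule cInf_lower)
  show "a \<in> {a. \<exists>r>0. \<exists>K. \<forall>n\<ge>K. \<forall>q\<in>S n. dist q p < r \<longrightarrow> v n q \<le> a}" using assms by blast
  show "bdd_below {a. \<exists>r>0. \<exists>K. \<forall>n\<ge>K. \<forall>q\<in>S n. dist q p < r \<longrightarrow> v n q \<le> a}"
  proof (rule bdd_belowI[of _ "- B"])
    fix a assume "a \<in> {a. \<exists>r>0. \<exists>K. \<forall>n\<ge>K. \<forall>q\<in>S n. dist q p < r \<longrightarrow> v n q \<le> a}"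
    then obtain r K where "r > 0" "\<forall>n\<ge>K. \<forall>q\<in>S n. dist q p < r \<longrightarrow> v n q \<le> a" by blast
    then show "- B \<le> a" by (intro relaxed_bounds_below[OF p, of r K]) auto
  qed
qed

lemma relaxed_upper:
  assumes p: "p \<in> Y" and e: "e > 0"
  obtains r K where "r > 0" "\<And>n q. n \<ge> K \<Longrightarrow> q \<in> S n \<Longrightarrow> dist q p < r \<Longrightarrow> v n q < U p + e"
proof -
  let ?A = "{a. \<exists>r>0. \<exists>K. \<forall>n\<ge>K. \<forall>q\<in>S n. dist q p < r \<longrightarrow> v n q \<le> a}"
  have "B \<in> ?A" using bounded abs_le_iff by (auto intro!: exI[of _ 1])
  then have "?A \<noteq> {}" by blast
  moreover have "Inf ?A < Inf ?A + e" using e by simp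
  ultimately have "\<exists>a\<in>?A. a < Inf ?A + e" by (rule cInf_lessD)
  then obtain a where "a \<in> ?A" "a < Inf ?A + e" by (rule bexE)
  then obtain r K where "r > 0" "\<forall>n\<ge>K. \<forall>q\<in>S n. dist q p < r \<longrightarrow> v n q \<le> a" by blast
  then show thesis using \<open>a < Inf ?A + e\<close>
    by (intro that[of r K]) (auto simp: upper_relaxed_limit_def intro: le_less_trans)
qed

lemma relaxed_bounded:
  assumes p: "p \<in> Y"
  shows "\<bar>U p\<bar> \<le> B"
proof -
  have "U p \<le> B" by (rule relaxed_le[OF p, of 1]) (use bounded abs_le_iff in auto)
  moreover have "- B \<le> U p"
  proof (rule field_le_epsilon)
    fix e :: real assume "e > 0"
    obtain r K where "r > 0" "\<And>n q. n \<ge> K \<Longrightarrow> q \<in> S n \<Longrightarrow> dist q p < r \<Longrightarrow> v n q < U p + e"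
      using relaxed_upper[OF p \<open>e > 0\<close>] by blast
    then show "- B \<le> U p + e" by (intro relaxed_bounds_below[OF p, of r K]) (auto intro: less_imp_le)
  qed
  ultimately show ?thesis by simp
qed

lemma relaxed_LIMSEQ_le:
  assumes p: "p \<in> Y" and n: "filterlim n at_top sequentially"
    and q: "\<And>k. q k \<in> S (n k)" "q \<longlonglongrightarrow> p"
    and a: "\<forall>\<^sub>F k in sequentially. a k \<le> v (n k) (q k)" "a \<longlonglongrightarrow> c"
  shows "c \<le> U p"
proof (rule field_le_epsilon)
  fix e :: real assume "e > 0"
  obtain r K where r: "r > 0" "\<And>n q. n \<ge> K \<Longrightarrow> q \<in> S n \<Longrightarrow> dist q p < r \<Longrightarrow> v n q < U p + e"
    using relaxed_upper[OF p \<open>e > 0\<close>] by blast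
  have "\<forall>\<^sub>F k in sequentially. n k \<ge> K" using n by (simp add: filterlim_at_top)
  then have "\<forall>\<^sub>F k in sequentially. a k \<le> U p + e"
    using tendstoD[OF q(2) r(1)] a(1)
  proof eventually_elim
    case (elim k)
    then show ?case using r(2)[OF elim(1) q(1) elim(2)] by linarith
  qed
  then show "c \<le> U p + e" by (rule tendsto_upperbound[OF a(2)]) simp
qed

text \<open>A number slightly below the limit is exceeded for arbitrarily large \<open>n\<close> and arbitrarily close to
  \<open>p\<close>; such exceptions form the sequence. Its indices tend to infinity but need not increase.\<close>

lemma relaxed_attained:
  assumes p: "p \<in> Y"
  obtains n q where "filterlim n at_top sequentially" "\<And>k. q k \<in> S (n k)" "q \<longlonglongrightarrow> p"
    "(\<lambda>k. v (n k) (q k)) \<longlonglongrightarrow> U p"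
proof -
  have "\<exists>n q. n \<ge> k \<and> q \<in> S n \<and> dist q p < inverse (real (Suc k)) \<and> v n q > U p - inverse (real (Suc k))" for k
  proof (rule ccontr)
    assume *: "\<not> ?thesis"
    have "U p \<le> U p - inverse (real (Suc k))"
    proof (rule relaxed_le[OF p, of "inverse (real (Suc k))" k])
      fix m q assume "m \<ge> k" "q \<in> S m" "dist q p < inverse (real (Suc k))"
      then have "\<not> v m q > U p - inverse (real (Suc k))" using * by blast
      then show "v m q \<le> U p - inverse (real (Suc k))" by simp
    qed simp
    then show False by simp
  qed
  then obtain n q where nq: "\<And>k. n k \<ge> k" "\<And>k. q k \<in> S (n k)" "\<And>k. dist (q k) p < inverse (real (Suc k))"
      "\<And>k. v (n k) (q k) > U p - inverse (real (Suc k))" by metis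
  have n: "filterlim n at_top sequentially"
    by (rule filterlim_at_top_mono[OF filterlim_ident]) (use nq(1) in auto)
  have "(\<lambda>k. dist (q k) p) \<longlonglongrightarrow> 0"
    by (rule tendsto_sandwich[OF _ _ tendsto_const LIMSEQ_inverse_real_of_nat])
       (use less_imp_le[OF nq(3)] in auto)
  then have q: "q \<longlonglongrightarrow> p" by (rule tendsto_dist_iff[THEN iffD2])
  have "(\<lambda>k. v (n k) (q k)) \<longlonglongrightarrow> U p"
  proof (rule LIMSEQ_I)
    fix e :: real assume "e > 0"
    obtain r K where r: "r > 0" "\<And>n q. n \<ge> K \<Longrightarrow> q \<in> S n \<Longrightarrow> dist q p < r \<Longrightarrow> v n q < U p + e"
      using relaxed_upper[OF p \<open>e > 0\<close>] by blast
    have "\<forall>\<^sub>F k in sequentially. n k \<ge> K" using n by (simp add: filterlim_at_top)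
    then have "\<forall>\<^sub>F k in sequentially. norm (v (n k) (q k) - U p) < e"
      using tendstoD[OF q r(1)] tendstoD[OF LIMSEQ_inverse_real_of_nat \<open>e > 0\<close>]
    proof eventually_elim
      case (elim k)
      have "v (n k) (q k) < U p + e" using r(2)[OF elim(1) nq(2) elim(2)] .
      moreover have "U p - v (n k) (q k) < e" using nq(4)[of k] elim(3) by simp
      ultimately show ?case by (simp add: abs_less_iff)
    qed
    then show "\<exists>no. \<forall>k\<ge>no. norm (v (n k) (q k) - U p) < e" by (simp add: eventually_sequentially)
  qed
  then show thesis using that[OF n nq(2) q] by blast
qed

lemma usc_on_relaxed: "usc_on Y U"
  unfolding usc_on_def
proof (intro ballI allI impI)
  fix p and e :: real assume p: "p \<in> Y" "e > 0"
  then have e2: "e / 2 > 0" by simp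
  obtain r K where r: "r > 0" "\<And>n q. n \<ge> K \<Longrightarrow> q \<in> S n \<Longrightarrow> dist q p < r \<Longrightarrow> v n q < U p + e / 2"
    using relaxed_upper[OF p(1) e2] by blast
  have "U p' < U p + e" if p': "p' \<in> Y" "dist p' p < r" for p'
  proof -
    have "U p' \<le> U p + e / 2"
    proof (rule relaxed_le[OF p'(1), of "r - dist p' p" K])
      fix n q assume "n \<ge> K" "q \<in> S n" "dist q p' < r - dist p' p"
      then show "v n q \<le> U p + e / 2"
        using r(2)[of n q] dist_triangle[of q p p'] by (auto intro: less_imp_le)
    qed (use p' in auto)
    then show ?thesis using p(2) by linarith
  qed
  then show "\<exists>r>0. \<forall>q\<in>Y. dist q p < r \<longrightarrow> U q < U p + e" using r(1) by blast
qed

end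

lemma relaxed_add_relaxed_uminus_ge_0:
  assumes b: "\<And>n q. q \<in> S n \<Longrightarrow> \<bar>v n q\<bar> \<le> B" and p: "p \<in> Y"
  shows "0 \<le> upper_relaxed_limit S v p + upper_relaxed_limit S (\<lambda>n q. - v n q) p"
proof -
  have b': "\<And>n q. q \<in> S n \<Longrightarrow> \<bar>- v n q\<bar> \<le> B" using b by simp
  obtain n q where nq: "filterlim n at_top sequentially" "\<And>k. q k \<in> S (n k)" "q \<longlonglongrightarrow> p"
    "(\<lambda>k. v (n k) (q k)) \<longlonglongrightarrow> upper_relaxed_limit S v p"
    using relaxed_attained[where v=v, OF b p] by blast
  have "- upper_relaxed_limit S v p \<le> upper_relaxed_limit S (\<lambda>n q. - v n q) p"
    by (rule relaxed_LIMSEQ_le[where v="\<lambda>n q. - v n q", OF b' p nq(1-3) _ tendsto_minus[OF nq(4)]]) auto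
  then show ?thesis by simp
qed

end


section \<open>Stability\<close>

lemma continuous_on_compact_bound:
  fixes f :: "'a::topological_space \<Rightarrow> real"
  assumes "compact K" "continuous_on K f"
  obtains b where "\<And>x. x \<in> K \<Longrightarrow> \<bar>f x\<bar> \<le> b"
proof -
  have "bounded (f ` K)" using compact_continuous_image[OF assms(2,1)] by (rule compact_imp_bounded)
  then obtain b where "\<forall>y\<in>f ` K. norm y \<le> b" unfolding bounded_iff by blast
  then show thesis by (intro that[of b]) auto
qed

lemma converging_sequence_in_sets:
  fixes x :: "'a::metric_space"
  assumes comp: "\<And>n. compact (A n)" and ne: "\<And>n. A n \<noteq> {}"
    and dense: "\<And>e. e > 0 \<Longrightarrow> \<exists>K. \<forall>n\<ge>K. \<exists>y\<in>A n. dist y x < e"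
  shows "\<exists>a. (\<forall>n. a n \<in> A n) \<and> a \<longlonglongrightarrow> x"
proof -
  have "\<exists>y\<in>A n. \<forall>z\<in>A n. dist x y \<le> dist x z" for n
    by (rule continuous_attains_inf[OF comp ne]) (intro continuous_intros)
  then obtain a where a: "\<And>n. a n \<in> A n" "\<And>n z. z \<in> A n \<Longrightarrow> dist x (a n) \<le> dist x z" by metis
  have "a \<longlonglongrightarrow> x"
  proof (rule LIMSEQ_def[THEN iffD2], intro allI impI)
    fix e :: real assume "e > 0"
    from dense[OF this] obtain K where K: "\<forall>n\<ge>K. \<exists>y\<in>A n. dist y x < e" by blast
    have "dist (a n) x < e" if "n \<ge> K" for n
      using K a(2)[of _ n] that by (metis dist_commute le_less_trans)
    then show "\<exists>no. \<forall>n\<ge>no. dist (a n) x < e" by blast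
  qed
  then show ?thesis using a(1) by blast
qed

text \<open>Closeness of the metrics is required uniformly on \<open>Xn n\<close>; compactness will provide it for
  networks.\<close>

locale approximating_spaces = compact_geodesic_space X d
  for X :: "'a::metric_space set" and d +
  fixes Xn :: "nat \<Rightarrow> 'a set" and dn :: "nat \<Rightarrow> 'a \<Rightarrow> 'a \<Rightarrow> real"
  assumes geodesic_n: "\<And>n. compact_geodesic_space (Xn n) (dn n)"
    and nonempty_n: "\<And>n. Xn n \<noteq> {}"
    and subset_n: "\<And>n. Xn n \<subseteq> X"
    and dense_n: "\<And>x e. x \<in> X \<Longrightarrow> e > 0 \<Longrightarrow> \<exists>K. \<forall>n\<ge>K. \<exists>y\<in>Xn n. dist y x < e"
    and dist_n: "\<And>e. e > 0 \<Longrightarrow> \<exists>K. \<forall>n\<ge>K. \<forall>x\<in>Xn n. \<forall>y\<in>Xn n. \<bar>dn n x y - d x y\<bar> < e"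
begin

lemma recovery_sequence:
  assumes "x \<in> X"
  shows "\<exists>a. (\<forall>n. a n \<in> Xn n) \<and> a \<longlonglongrightarrow> x"
  by (rule converging_sequence_in_sets[OF compact_geodesic_space.compact_space[OF geodesic_n] nonempty_n dense_n[OF assms]])

lemma tendsto_dist_n:
  assumes n: "filterlim n at_top sequentially"
    and x: "\<And>k. x k \<in> Xn (n k)" "x \<longlonglongrightarrow> x'" and y: "\<And>k. y k \<in> Xn (n k)" "y \<longlonglongrightarrow> y'"
    and X: "x' \<in> X" "y' \<in> X"
  shows "(\<lambda>k. dn (n k) (x k) (y k)) \<longlonglongrightarrow> d x' y'"
proof -
  have "(\<lambda>k. d (x k) (y k)) \<longlonglongrightarrow> d x' y'"
  proof (rule tendsto_mdist[OF x(2) y(2) _ _ X])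
    have "x k \<in> X" "y k \<in> X" for k using x(1)[of k] y(1)[of k] subset_n by blast+
    then show "\<forall>\<^sub>F k in sequentially. x k \<in> X" "\<forall>\<^sub>F k in sequentially. y k \<in> X" by simp_all
  qed
  moreover have "(\<lambda>k. dn (n k) (x k) (y k) - d (x k) (y k)) \<longlonglongrightarrow> 0"
  proof (rule LIMSEQ_I)
    fix e :: real assume "e > 0"
    then obtain K where K: "\<forall>n\<ge>K. \<forall>x\<in>Xn n. \<forall>y\<in>Xn n. \<bar>dn n x y - d x y\<bar> < e" using dist_n by blast
    have "\<forall>\<^sub>F k in sequentially. n k \<ge> K" using n by (simp add: filterlim_at_top)
    then have "\<forall>\<^sub>F k in sequentially. norm (dn (n k) (x k) (y k) - d (x k) (y k) - 0) < e"
      by eventually_elim (use K x(1) y(1) in auto)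
    then show "\<exists>no. \<forall>k\<ge>no. norm (dn (n k) (x k) (y k) - d (x k) (y k) - 0) < e"
      by (simp add: eventually_sequentially)
  qed
  ultimately have "(\<lambda>k. d (x k) (y k) + (dn (n k) (x k) (y k) - d (x k) (y k))) \<longlonglongrightarrow> d x' y' + 0"
    by (rule tendsto_add)
  then show ?thesis by simp
qed

lemma relaxation_spacetime: "relaxation (\<lambda>n. I \<times> Xn n) (I \<times> X)"
proof
  fix p assume "p \<in> I \<times> X"
  then obtain t x where p: "p = (t, x)" "t \<in> I" "x \<in> X" by auto
  obtain a where a: "\<And>n. a n \<in> Xn n" "a \<longlonglongrightarrow> x" using recovery_sequence[OF p(3)] by blast
  show "\<exists>q. (\<forall>n. q n \<in> I \<times> Xn n) \<and> q \<longlonglongrightarrow> p"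
    using a p by (intro exI[of _ "\<lambda>n. (t, a n)"]) (auto intro!: tendsto_intros)
qed

context
  fixes T B :: real and v :: "nat \<Rightarrow> real \<times> 'a \<Rightarrow> real" and G :: "'a \<Rightarrow> real \<Rightarrow> real"
  assumes v_bounded: "\<And>n q. q \<in> {0..<T} \<times> Xn n \<Longrightarrow> \<bar>v n q\<bar> \<le> B"
    and v_continuous: "\<And>n. continuous_on ({0..<T} \<times> Xn n) (v n)"
    and v_sub: "\<And>n. quadratic_subsolution T (Xn n) (dn n) G (v n)"
    and G_tendsto: "\<And>(x :: nat \<Rightarrow> 'a) p x' p'. (\<And>k. x k \<in> X) \<Longrightarrow> x \<longlonglongrightarrow> x' \<Longrightarrow> x' \<in> X \<Longrightarrow> p \<longlonglongrightarrow> p' \<Longrightarrow>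
          (\<lambda>k. G (x k) (p k)) \<longlonglongrightarrow> G x' p'"
begin

interpretation relaxation "\<lambda>n. {0..<T} \<times> Xn n" "{0..<T} \<times> X" B
  by (rule relaxation_spacetime)

abbreviation v_lim where "v_lim \<equiv> upper_relaxed_limit (\<lambda>n. {0..<T} \<times> Xn n) v"

text \<open>The heart of the stability argument. A test function on \<open>X\<close> need not be one on \<open>Xn n\<close>, whose metric
  is different. Therefore \<open>v n (t, x) - \<psi> y - \<theta> t - (dn n x y)\<^sup>2 / (2 * \<epsilon>)\<close> is maximized over two space
  variables in \<open>Xn n\<close>: as a function of \<open>x\<close> it tests \<open>v n\<close> with a squared distance, which is always
  admissible, while \<open>\<psi>\<close> enters only through the minimality in \<open>y\<close>. With \<open>\<epsilon>\<close> fixed, everything passes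
  to the limit in \<open>n\<close> by uniform convergence of the metrics.\<close>

lemma relaxed_doubling:
  assumes t0: "0 < a" "a < t0" "t0 < b" "b < T" and x0: "x0 \<in> X" and \<epsilon>: "\<epsilon> > 0"
    and \<theta>: "\<And>s. s \<in> {0<..<T} \<Longrightarrow> (\<theta> has_real_derivative \<theta>' s) (at s)" "continuous_on {0<..<T} \<theta>'"
    and \<psi>: "continuous_on X \<psi>"
  obtains t x y where "t \<in> {a..b}" "x \<in> X" "y \<in> X"
    "v_lim (t0, x0) - \<psi> x0 - \<theta> t0 \<le> v_lim (t, x) - \<psi> y - \<theta> t - (d x y)\<^sup>2 / (2 * \<epsilon>)"
    "\<And>z. z \<in> X \<Longrightarrow> \<psi> y + (d x y)\<^sup>2 / (2 * \<epsilon>) \<le> \<psi> z + (d x z)\<^sup>2 / (2 * \<epsilon>)"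
    "a < t \<Longrightarrow> t < b \<Longrightarrow> \<theta>' t + G x (d x y / \<epsilon>) \<le> 0"
proof -
  have p0: "(t0, x0) \<in> {0..<T} \<times> X" using t0 x0 by simp
  obtain n q where nq: "filterlim n at_top sequentially" "\<And>k. q k \<in> {0..<T} \<times> Xn (n k)"
      "q \<longlonglongrightarrow> (t0, x0)" "(\<lambda>k. v (n k) (q k)) \<longlonglongrightarrow> v_lim (t0, x0)"
    using relaxed_attained[where v=v, OF v_bounded p0] by blast
  define s where "s = (\<lambda>k. fst (q k))"
  define z where "z = (\<lambda>k. snd (q k))"
  have qk: "q k = (s k, z k)" "z k \<in> Xn (n k)" for k using nq(2)[of k] by (auto simp: s_def z_def)
  have sl: "s \<longlonglongrightarrow> t0" "z \<longlonglongrightarrow> x0"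
    using tendsto_fst[OF nq(3)] tendsto_snd[OF nq(3)] by (simp_all add: s_def z_def)
  have \<theta>c: "continuous_on {0<..<T} \<theta>"
    by (rule DERIV_continuous_on[where D=\<theta>']) (use \<theta>(1) in \<open>auto intro: has_field_derivative_at_within\<close>)
  have \<theta>l: "(\<lambda>k. \<theta> (f k)) \<longlonglongrightarrow> \<theta> t" if "f \<longlonglongrightarrow> t" "t \<in> {0<..<T}" for f :: "nat \<Rightarrow> real" and t
    by (rule isCont_tendsto_compose[OF DERIV_isCont that(1)]) (use \<theta>(1) that in auto)
  have \<theta>'l: "(\<lambda>k. \<theta>' (f k)) \<longlonglongrightarrow> \<theta>' t" if "f \<longlonglongrightarrow> t" "t \<in> {0<..<T}" for f :: "nat \<Rightarrow> real" and t
  proof -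
    have "isCont \<theta>' t" using \<theta>(2) that(2) by (simp add: continuous_on_eq_continuous_at)
    then show ?thesis using isCont_tendsto_compose that(1) by blast
  qed
  have \<psi>l: "(\<lambda>k. \<psi> (f k)) \<longlonglongrightarrow> \<psi> x" if "f \<longlonglongrightarrow> x" "x \<in> X" "\<And>k. f k \<in> X" for f :: "nat \<Rightarrow> 'a" and x
    by (rule continuous_on_tendsto_compose[OF \<psi> that(1,2)]) (use that in auto)
  define \<Psi> where "\<Psi> k = (\<lambda>(t, x, y). v (n k) (t, x) - \<psi> y - \<theta> t - (dn (n k) x y)\<^sup>2 / (2 * \<epsilon>))" for k
  define K where "K k = {a..b} \<times> Xn (n k) \<times> Xn (n k)" for k
  have "\<exists>p\<in>K k. \<forall>q\<in>K k. \<Psi> k q \<le> \<Psi> k p" for k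
  proof (rule continuous_attains_sup)
    interpret n: compact_geodesic_space "Xn (n k)" "dn (n k)" by (rule geodesic_n)
    show "compact (K k)" unfolding K_def by (intro compact_Times compact_Icc n.compact_space)
    show "K k \<noteq> {}" using nonempty_n[of "n k"] t0 by (auto simp: K_def)
    show "continuous_on (K k) (\<Psi> k)"
      unfolding \<Psi>_def case_prod_unfold K_def
      by (intro continuous_intros n.continuous_on_mdist continuous_on_compose2[OF v_continuous]
          continuous_on_compose2[OF \<psi>] continuous_on_compose2[OF \<theta>c])
         (use t0 subsetD[OF subset_n] \<epsilon> in auto)
  qed
  then obtain P where P: "\<And>k. P k \<in> K k" "\<And>k q. q \<in> K k \<Longrightarrow> \<Psi> k q \<le> \<Psi> k (P k)" by metis
  define t where "t k = fst (P k)" for k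
  define x where "x k = fst (snd (P k))" for k
  define y where "y k = snd (snd (P k))" for k
  have Pk: "P k = (t k, x k, y k)" for k by (simp add: t_def x_def y_def)
  have mem: "t k \<in> {a..b}" "x k \<in> Xn (n k)" "y k \<in> Xn (n k)" for k
    using P(1)[of k] by (auto simp: Pk K_def)
  have memX: "x k \<in> X" "y k \<in> X" for k using mem subset_n by blast+
  have memT: "t k \<in> {0..<T}" for k using mem(1)[of k] t0 by auto
  have max: "v (n k) (t', x') - \<psi> y' - \<theta> t' - (dn (n k) x' y')\<^sup>2 / (2 * \<epsilon>)
      \<le> v (n k) (t k, x k) - \<psi> (y k) - \<theta> (t k) - (dn (n k) (x k) (y k))\<^sup>2 / (2 * \<epsilon>)"
    if "t' \<in> {a..b}" "x' \<in> Xn (n k)" "y' \<in> Xn (n k)" for k t' x' y'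
    using P(2)[of "(t', x', y')" k] that by (simp add: K_def \<Psi>_def Pk)
  have "compact ({a..b} \<times> X \<times> X)" by (intro compact_Times compact_Icc compact_space)
  moreover have "\<forall>k. P k \<in> {a..b} \<times> X \<times> X" using mem memX by (simp add: Pk)
  ultimately obtain p r where pr: "p \<in> {a..b} \<times> X \<times> X" "strict_mono r" "(P \<circ> r) \<longlonglongrightarrow> p"
    unfolding compact_def by metis
  obtain t' x' y' where p: "p = (t', x', y')" by (cases p)
  have m': "t' \<in> {a..b}" "x' \<in> X" "y' \<in> X" using pr(1) p by auto
  have tT: "t' \<in> {0<..<T}" using m' t0 by auto
  have lim: "(\<lambda>k. t (r k)) \<longlonglongrightarrow> t'" "(\<lambda>k. x (r k)) \<longlonglongrightarrow> x'" "(\<lambda>k. y (r k)) \<longlonglongrightarrow> y'"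
    using tendsto_fst[OF pr(3)] tendsto_fst[OF tendsto_snd[OF pr(3)]] tendsto_snd[OF tendsto_snd[OF pr(3)]]
    by (simp_all add: p t_def x_def y_def comp_def)
  have nr: "filterlim (\<lambda>k. n (r k)) at_top sequentially"
    using filterlim_compose[OF nq(1) filterlim_subseq[OF pr(2)]] .
  have dl: "(\<lambda>k. dn (n (r k)) (x (r k)) (y (r k))) \<longlonglongrightarrow> d x' y'"
    by (rule tendsto_dist_n[OF nr]) (use mem lim m' in auto)
  have qr: "(\<lambda>k. v (n (r k)) (q (r k))) \<longlonglongrightarrow> v_lim (t0, x0)" "(\<lambda>k. s (r k)) \<longlonglongrightarrow> t0" "(\<lambda>k. z (r k)) \<longlonglongrightarrow> x0"
    using LIMSEQ_subseq_LIMSEQ[OF nq(4) pr(2)] LIMSEQ_subseq_LIMSEQ[OF sl(1) pr(2)]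
      LIMSEQ_subseq_LIMSEQ[OF sl(2) pr(2)] by (simp_all add: comp_def)
  show thesis
  proof (rule that[OF m'])
    have "v_lim (t0, x0) - \<psi> x0 - \<theta> t0 + \<psi> y' + \<theta> t' + (d x' y')\<^sup>2 / (2 * \<epsilon>) \<le> v_lim (t', x')"
    proof (rule relaxed_LIMSEQ_le[where v=v, OF v_bounded _ nr])
      show "(\<lambda>k. (t (r k), x (r k))) \<longlonglongrightarrow> (t', x')" by (intro tendsto_Pair lim)
      show "(\<lambda>k. v (n (r k)) (q (r k)) - \<psi> (z (r k)) - \<theta> (s (r k)) + \<psi> (y (r k)) + \<theta> (t (r k))
          + (dn (n (r k)) (x (r k)) (y (r k)))\<^sup>2 / (2 * \<epsilon>))
        \<longlonglongrightarrow> v_lim (t0, x0) - \<psi> x0 - \<theta> t0 + \<psi> y' + \<theta> t' + (d x' y')\<^sup>2 / (2 * \<epsilon>)"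
        by (intro tendsto_intros dl qr \<psi>l \<theta>l lim)
           (use qk(2) subset_n x0 t0 tT m' memX \<epsilon> in auto)
      have "\<forall>\<^sub>F k in sequentially. s (r k) > a" "\<forall>\<^sub>F k in sequentially. s (r k) < b"
        using order_tendstoD[OF qr(2)] t0 by auto
      then show "\<forall>\<^sub>F k in sequentially. v (n (r k)) (q (r k)) - \<psi> (z (r k)) - \<theta> (s (r k)) + \<psi> (y (r k)) + \<theta> (t (r k))
          + (dn (n (r k)) (x (r k)) (y (r k)))\<^sup>2 / (2 * \<epsilon>) \<le> v (n (r k)) (t (r k), x (r k))"
      proof eventually_elim
        case (elim k)
        interpret n: compact_geodesic_space "Xn (n (r k))" "dn (n (r k))" by (rule geodesic_n)
        show ?case using max[of "s (r k)" "z (r k)" "r k" "z (r k)"] elim qk[of "r k"] by simp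
      qed
    qed (use m' t0 mem memT tT in auto)
    then show "v_lim (t0, x0) - \<psi> x0 - \<theta> t0 \<le> v_lim (t', x') - \<psi> y' - \<theta> t' - (d x' y')\<^sup>2 / (2 * \<epsilon>)" by linarith
  next
    fix w assume w: "w \<in> X"
    obtain c where c: "\<And>n. c n \<in> Xn n" "c \<longlonglongrightarrow> w" using recovery_sequence[OF w] by blast
    have cl: "(\<lambda>k. c (n (r k))) \<longlonglongrightarrow> w" using filterlim_compose[OF c(2) nr] .
    show "\<psi> y' + (d x' y')\<^sup>2 / (2 * \<epsilon>) \<le> \<psi> w + (d x' w)\<^sup>2 / (2 * \<epsilon>)"
    proof (rule LIMSEQ_le)
      show "(\<lambda>k. \<psi> (y (r k)) + (dn (n (r k)) (x (r k)) (y (r k)))\<^sup>2 / (2 * \<epsilon>)) \<longlonglongrightarrow> \<psi> y' + (d x' y')\<^sup>2 / (2 * \<epsilon>)"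
        by (intro tendsto_intros dl \<psi>l lim) (use m' memX \<epsilon> in auto)
      show "(\<lambda>k. \<psi> (c (n (r k))) + (dn (n (r k)) (x (r k)) (c (n (r k))))\<^sup>2 / (2 * \<epsilon>)) \<longlonglongrightarrow> \<psi> w + (d x' w)\<^sup>2 / (2 * \<epsilon>)"
        by (intro tendsto_intros \<psi>l cl tendsto_dist_n[OF nr] lim)
          (use m' mem c subsetD[OF subset_n c(1)] w \<epsilon> in auto)
      show "\<exists>N. \<forall>k\<ge>N. \<psi> (y (r k)) + (dn (n (r k)) (x (r k)) (y (r k)))\<^sup>2 / (2 * \<epsilon>)
          \<le> \<psi> (c (n (r k))) + (dn (n (r k)) (x (r k)) (c (n (r k))))\<^sup>2 / (2 * \<epsilon>)"
      proof (intro exI allI impI)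
        fix k
        show "\<psi> (y (r k)) + (dn (n (r k)) (x (r k)) (y (r k)))\<^sup>2 / (2 * \<epsilon>)
          \<le> \<psi> (c (n (r k))) + (dn (n (r k)) (x (r k)) (c (n (r k))))\<^sup>2 / (2 * \<epsilon>)"
          using max[OF mem(1)[of "r k"] mem(2)[of "r k"] c(1)] by linarith
      qed
    qed
  next
    assume ab: "a < t'" "t' < b"
    have "\<forall>\<^sub>F k in sequentially. t (r k) > a" "\<forall>\<^sub>F k in sequentially. t (r k) < b"
      using order_tendstoD[OF lim(1)] ab by auto
    then have ev: "\<forall>\<^sub>F k in sequentially. \<theta>' (t (r k)) + G (x (r k)) (dn (n (r k)) (x (r k)) (y (r k)) / \<epsilon>) \<le> 0"
    proof eventually_elim
      case (elim k)
      show ?case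
      proof (rule v_sub[unfolded quadratic_subsolution_def, rule_format, OF mem(2,3) _ \<epsilon>,
            where r = "min (t (r k) - a) (b - t (r k))" and \<theta>=\<theta> and \<theta>'=\<theta>'], safe)
        fix \<sigma> \<zeta> assume *: "\<sigma> \<in> {0<..<T}" "\<zeta> \<in> Xn (n (r k))" "\<bar>\<sigma> - t (r k)\<bar> < min (t (r k) - a) (b - t (r k))"
        then have "\<sigma> \<in> {a..b}" by auto
        from max[OF this *(2) mem(3)[of "r k"]]
        show "v (n (r k)) (\<sigma>, \<zeta>) - \<theta> \<sigma> - (dn (n (r k)) \<zeta> (y (r k)))\<^sup>2 / (2 * \<epsilon>)
          \<le> v (n (r k)) (t (r k), x (r k)) - \<theta> (t (r k)) - (dn (n (r k)) (x (r k)) (y (r k)))\<^sup>2 / (2 * \<epsilon>)"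
          by linarith
      qed (use elim t0 \<theta> in auto)
    qed
    have "(\<lambda>k. \<theta>' (t (r k)) + G (x (r k)) (dn (n (r k)) (x (r k)) (y (r k)) / \<epsilon>)) \<longlonglongrightarrow> \<theta>' t' + G x' (d x' y' / \<epsilon>)"
      by (intro tendsto_intros \<theta>'l G_tendsto dl lim) (use memX m' tT \<epsilon> in auto)
    from tendsto_upperbound[OF this ev] show "\<theta>' t' + G x' (d x' y' / \<epsilon>) \<le> 0" by simp
  qed
qed

text \<open>It remains to let \<open>\<epsilon>\<close> tend to \<open>0\<close>. The test function is first penalized by \<open>K (d y x0)\<^sup>2\<close> in the
  variable \<open>y\<close>, with \<open>K\<close> so large that the local maximum becomes global and strict. Then the
  points from the doubling converge to \<open>(t0, x0)\<close>, and at \<open>y\<close> the slope of \<open>\<phi>\<^sub>1\<close> is almost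
  \<open>d x y / \<epsilon>\<close>, the argument of \<open>G\<close>. Continuity of the slope finishes the proof.\<close>

lemma test_subsolution_relaxed_limit: "test_subsolution T X d G v_lim"
  unfolding test_subsolution_def
proof (intro allI ballI impI, elim conjE)
  fix \<phi>\<^sub>1 \<phi>\<^sub>2 t0 x0
  assume t0: "t0 \<in> {0<..<T}" and x0: "x0 \<in> X" and low: "lower_test T X d \<phi>\<^sub>1 \<phi>\<^sub>2"
    and lmax: "local_max_at (spacetime {0<..<T} X d) (\<lambda>(s, y). v_lim (s, y) - (\<phi>\<^sub>1 y + \<phi>\<^sub>2 s)) (t0, x0)"
  have ll: "locally_lipschitz_wrt d X \<phi>\<^sub>1"
    and eqs: "\<And>x. x \<in> X \<Longrightarrow> slope X d \<phi>\<^sub>1 x = subslope X d \<phi>\<^sub>1 x"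
    and subc: "continuous_on X (subslope X d \<phi>\<^sub>1)"
    and C1: "\<phi>\<^sub>2 C1_differentiable_on {0<..<T}"
    using low by (auto simp: lower_test_def mtopology_eq)
  have \<phi>c: "continuous_on X \<phi>\<^sub>1" by (rule locally_lipschitz_continuous[OF ll])
  obtain D where D: "\<And>s. s \<in> {0<..<T} \<Longrightarrow> (\<phi>\<^sub>2 has_real_derivative D s) (at s)" "continuous_on {0<..<T} D"
    using C1 unfolding C1_differentiable_on_def has_real_derivative_iff_has_vector_derivative by blast
  have \<phi>2c: "continuous_on {0<..<T} \<phi>\<^sub>2"
    by (rule DERIV_continuous_on[where D=D]) (use D(1) in \<open>auto intro: has_field_derivative_at_within\<close>)
  define w where "w s y = v_lim (s, y) - \<phi>\<^sub>1 y - \<phi>\<^sub>2 s" for s y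
  define w0 where "w0 = w t0 x0"
  obtain r where r: "r > 0" "\<And>s y. s \<in> {0<..<T} \<Longrightarrow> y \<in> X \<Longrightarrow> dist (s, y) (t0, x0) < r \<Longrightarrow> w s y \<le> w0"
  proof -
    obtain O' where O': "openin (top_of_set ({0<..<T} \<times> X)) O'" "(t0, x0) \<in> O'"
      "\<forall>q\<in>O'. (\<lambda>(s, y). v_lim (s, y) - (\<phi>\<^sub>1 y + \<phi>\<^sub>2 s)) q \<le> (\<lambda>(s, y). v_lim (s, y) - (\<phi>\<^sub>1 y + \<phi>\<^sub>2 s)) (t0, x0)"
      using lmax unfolding local_max_at_def spacetime_eq by blast
    then obtain r where "r > 0" "\<forall>q\<in>{0<..<T} \<times> X. dist q (t0, x0) < r \<longrightarrow> q \<in> O'"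
      unfolding openin_euclidean_subtopology_iff by blast
    moreover have "w s y \<le> w0" if "(s, y) \<in> O'" for s y
      using bspec[OF O'(3) that] by (simp add: w_def w0_def)
    ultimately show thesis by (intro that[of r]) auto
  qed
  define \<rho> where "\<rho> = min (r / 3) (min t0 (T - t0) / 2)"
  have \<rho>: "\<rho> > 0" "\<rho> \<le> r / 3" "0 < t0 - \<rho>" "t0 + \<rho> < T"
  proof -
    have "\<rho> \<le> r / 3" "\<rho> \<le> t0 / 2" "\<rho> \<le> (T - t0) / 2" "\<rho> > 0"
      using r(1) t0 by (auto simp: \<rho>_def min_def)
    then show "\<rho> > 0" "\<rho> \<le> r / 3" "0 < t0 - \<rho>" "t0 + \<rho> < T" using t0 by auto
  qed
  define a where "a = t0 - \<rho>"
  define b where "b = t0 + \<rho>"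
  have ab: "0 < a" "a < t0" "t0 < b" "b < T" using \<rho> by (auto simp: a_def b_def)
  have near: "w s y \<le> w0" if "s \<in> {a..b}" "y \<in> X" "dist y x0 < r / 3" for s y
  proof (rule r(2))
    have "dist (s, y) (t0, x0) \<le> dist s t0 + dist y x0"
      unfolding dist_Pair_Pair by (rule sqrt_sum_squares_le_sum) auto
    also have "\<dots> < r" using that \<rho> r(1) by (auto simp: dist_real_def a_def b_def)
    finally show "dist (s, y) (t0, x0) < r" .
  qed (use that ab in auto)
  obtain \<delta> where \<delta>: "\<delta> > 0" "\<forall>y\<in>X. d y x0 < \<delta> \<longrightarrow> dist y x0 < r / 3"
    using dist_small[OF x0, of "r / 3"] r(1) by auto
  obtain B1 where B1: "\<And>y. y \<in> X \<Longrightarrow> \<bar>\<phi>\<^sub>1 y\<bar> \<le> B1"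
    using continuous_on_compact_bound[OF compact_space \<phi>c] by blast
  have abT: "{a..b} \<subseteq> {0<..<T}" using ab by auto
  obtain B2 where B2: "\<And>s. s \<in> {a..b} \<Longrightarrow> \<bar>\<phi>\<^sub>2 s\<bar> \<le> B2"
    using continuous_on_compact_bound[OF compact_Icc continuous_on_subset[OF \<phi>2c abT]] by blast
  have far: "w s y \<le> B + B1 + B2" if "s \<in> {a..b}" "y \<in> X" for s y
    using relaxed_bounded[where v=v and p="(s, y)", OF v_bounded] B1[OF that(2)] B2[OF that(1)] that ab
    by (auto simp: w_def)
  \<comment> \<open>Where \<open>d y x0 \<ge> \<delta>\<close>, the coefficient \<open>K - 1\<close> makes up for the excess of \<open>B + B1 + B2\<close> over \<open>w0\<close>;
      the remaining \<open>1\<close> makes the maximum strict.\<close>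
  define K where "K = 1 + max 0 (B + B1 + B2 - w0) / \<delta>\<^sup>2"
  have K: "K \<ge> 1" using \<delta>(1) by (simp add: K_def)
  define \<psi> where "\<psi> y = \<phi>\<^sub>1 y + K * (d y x0)\<^sup>2" for y
  define \<theta> where "\<theta> s = \<phi>\<^sub>2 s + K * (s - t0)\<^sup>2" for s
  define \<theta>' where "\<theta>' s = D s + 2 * K * (s - t0)" for s
  have \<theta>: "(\<theta> has_real_derivative \<theta>' s) (at s)" if "s \<in> {0<..<T}" for s
    unfolding \<theta>_def \<theta>'_def by (auto intro!: derivative_eq_intros D(1)[OF that])
  have \<theta>'c: "continuous_on {0<..<T} \<theta>'" unfolding \<theta>'_def by (intro continuous_intros D(2))
  have \<psi>c: "continuous_on X \<psi>"
    unfolding \<psi>_def by (intro continuous_intros \<phi>c continuous_on_mdist) (use x0 in auto)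
  have strict: "v_lim (s, y) - \<psi> y - \<theta> s \<le> w0 - (d y x0)\<^sup>2 - (s - t0)\<^sup>2" if s: "s \<in> {a..b}" and y: "y \<in> X" for s y
  proof -
    have 1: "(s - t0)\<^sup>2 \<le> K * (s - t0)\<^sup>2" using mult_right_mono[OF K, of "(s - t0)\<^sup>2"] by simp
    have 2: "w s y + (d y x0)\<^sup>2 \<le> w0 + K * (d y x0)\<^sup>2"
    proof (cases "d y x0 < \<delta>")
      case True
      then have "w s y \<le> w0" using near[OF s y] \<delta>(2) y by blast
      moreover have "(d y x0)\<^sup>2 \<le> K * (d y x0)\<^sup>2" using mult_right_mono[OF K, of "(d y x0)\<^sup>2"] by simp
      ultimately show ?thesis by linarith
    next
      case False
      then have "\<delta>\<^sup>2 \<le> (d y x0)\<^sup>2" using \<delta>(1) by (intro power_mono) auto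
      then have "max 0 (B + B1 + B2 - w0) / \<delta>\<^sup>2 * \<delta>\<^sup>2 \<le> max 0 (B + B1 + B2 - w0) / \<delta>\<^sup>2 * (d y x0)\<^sup>2"
        by (intro mult_left_mono) auto
      then have "B + B1 + B2 - w0 \<le> max 0 (B + B1 + B2 - w0) / \<delta>\<^sup>2 * (d y x0)\<^sup>2"
        using \<delta>(1) by simp
      also have "\<dots> = K * (d y x0)\<^sup>2 - (d y x0)\<^sup>2" by (simp add: K_def algebra_simps)
      finally show ?thesis using far[OF s y] by linarith
    qed
    show ?thesis using 1 2 unfolding w_def \<psi>_def \<theta>_def by linarith
  qed
  have w0eq: "v_lim (t0, x0) - \<psi> x0 - \<theta> t0 = w0" using x0 by (simp add: w0_def w_def \<psi>_def \<theta>_def)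
  define \<epsilon> where "\<epsilon> j = inverse (real (Suc j))" for j
  have \<epsilon>: "\<epsilon> j > 0" for j by (simp add: \<epsilon>_def)
  have \<epsilon>0: "\<epsilon> \<longlonglongrightarrow> 0" unfolding \<epsilon>_def by (rule LIMSEQ_inverse_real_of_nat)
  have "\<exists>t x y. t \<in> {a..b} \<and> x \<in> X \<and> y \<in> X \<and>
    w0 \<le> v_lim (t, x) - \<psi> y - \<theta> t - (d x y)\<^sup>2 / (2 * \<epsilon> j) \<and>
    (\<forall>z\<in>X. \<psi> y + (d x y)\<^sup>2 / (2 * \<epsilon> j) \<le> \<psi> z + (d x z)\<^sup>2 / (2 * \<epsilon> j)) \<and>
    (a < t \<and> t < b \<longrightarrow> \<theta>' t + G x (d x y / \<epsilon> j) \<le> 0)" for j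
  proof (rule relaxed_doubling[OF ab x0 \<epsilon>[of j] \<theta> \<theta>'c \<psi>c])
    fix t x y
    assume txy: "t \<in> {a..b}" "x \<in> X" "y \<in> X"
      "v_lim (t0, x0) - \<psi> x0 - \<theta> t0 \<le> v_lim (t, x) - \<psi> y - \<theta> t - (d x y)\<^sup>2 / (2 * \<epsilon> j)"
      "\<And>z. z \<in> X \<Longrightarrow> \<psi> y + (d x y)\<^sup>2 / (2 * \<epsilon> j) \<le> \<psi> z + (d x z)\<^sup>2 / (2 * \<epsilon> j)"
      "a < t \<Longrightarrow> t < b \<Longrightarrow> \<theta>' t + G x (d x y / \<epsilon> j) \<le> 0"
    show ?thesis
      by (rule exI[of _ t], rule exI[of _ x], rule exI[of _ y], intro conjI ballI impI)
        (use txy w0eq in auto)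
  qed
  then obtain t x y where txy: "\<And>j. t j \<in> {a..b}" "\<And>j. x j \<in> X" "\<And>j. y j \<in> X"
    and val: "\<And>j. w0 \<le> v_lim (t j, x j) - \<psi> (y j) - \<theta> (t j) - (d (x j) (y j))\<^sup>2 / (2 * \<epsilon> j)"
    and mini: "\<And>j z. z \<in> X \<Longrightarrow> \<psi> (y j) + (d (x j) (y j))\<^sup>2 / (2 * \<epsilon> j) \<le> \<psi> z + (d (x j) z)\<^sup>2 / (2 * \<epsilon> j)"
    and ineq: "\<And>j. a < t j \<Longrightarrow> t j < b \<Longrightarrow> \<theta>' (t j) + G (x j) (d (x j) (y j) / \<epsilon> j) \<le> 0"
    by metis
  \<comment> \<open>Strictness bounds all deviations from \<open>(t0, x0)\<close> by the oscillation of \<open>\<psi>\<close> between \<open>x j\<close> and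
      \<open>y j\<close>, first crudely to see that \<open>x j\<close> and \<open>y j\<close> merge, then again to see where.\<close>
  have main: "(d (x j) (y j))\<^sup>2 / (2 * \<epsilon> j) + (d (x j) x0)\<^sup>2 + (t j - t0)\<^sup>2 \<le> \<psi> (x j) - \<psi> (y j)" for j
    using val[of j] strict[OF txy(1,2), of j j] by linarith
  obtain B3 where B3: "\<And>y. y \<in> X \<Longrightarrow> \<bar>\<psi> y\<bar> \<le> B3"
    using continuous_on_compact_bound[OF compact_space \<psi>c] by blast
  have dxy0: "(\<lambda>j. d (x j) (y j)) \<longlonglongrightarrow> 0"
  proof (rule tendsto_0_if_square_le[OF \<epsilon>0])
    fix j
    have "(d (x j) (y j))\<^sup>2 / (2 * \<epsilon> j) \<le> 2 * B3"
      using main[of j] B3[OF txy(2), of j] B3[OF txy(3), of j]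
        zero_le_power2[of "d (x j) x0"] zero_le_power2[of "t j - t0"] by linarith
    then show "(d (x j) (y j))\<^sup>2 \<le> (4 * B3) * \<epsilon> j" using \<epsilon>[of j] by (simp add: field_simps)
  qed
  have "compact (X \<times> X)" by (intro compact_Times compact_space)
  then obtain p r where pr: "p \<in> X \<times> X" "strict_mono r" "((\<lambda>j. (x j, y j)) \<circ> r) \<longlonglongrightarrow> p"
    unfolding compact_def using txy by (elim allE[of _ "\<lambda>j. (x j, y j)"]) auto
  obtain x' y' where p: "p = (x', y')" by (cases p)
  have xl: "(\<lambda>j. x (r j)) \<longlonglongrightarrow> x'" and yl: "(\<lambda>j. y (r j)) \<longlonglongrightarrow> y'"
    using tendsto_fst[OF pr(3)] tendsto_snd[OF pr(3)] by (simp_all add: p comp_def)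
  have m': "x' \<in> X" "y' \<in> X" using pr(1) p by auto
  have "(\<lambda>j. d (x (r j)) (y (r j))) \<longlonglongrightarrow> d x' y'"
    by (rule tendsto_mdist[OF xl yl]) (use txy m' in auto)
  moreover have "(\<lambda>j. d (x (r j)) (y (r j))) \<longlonglongrightarrow> 0"
    using LIMSEQ_subseq_LIMSEQ[OF dxy0 pr(2)] by (simp add: comp_def)
  ultimately have "d x' y' = 0" using LIMSEQ_unique by blast
  then have yx: "y' = x'" using m' by simp
  have \<psi>0: "(\<lambda>j. \<psi> (x (r j)) - \<psi> (y (r j))) \<longlonglongrightarrow> 0"
  proof -
    have "(\<lambda>j. \<psi> (x (r j)) - \<psi> (y (r j))) \<longlonglongrightarrow> \<psi> x' - \<psi> x'"
      using yl unfolding yx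
      by (intro tendsto_intros continuous_on_tendsto_compose[OF \<psi>c xl] continuous_on_tendsto_compose[OF \<psi>c])
         (use txy m' in auto)
    then show ?thesis by simp
  qed
  have pos: "0 \<le> (d (x j) (y j))\<^sup>2 / (2 * \<epsilon> j)" for j using \<epsilon>[of j] by simp
  have "(\<lambda>j. d (x (r j)) x0) \<longlonglongrightarrow> 0"
    by (rule tendsto_0_if_square_le[OF \<psi>0, where c=1])
       (use main pos in \<open>smt (verit) zero_le_power2\<close>)
  moreover have "(\<lambda>j. d (x (r j)) x0) \<longlonglongrightarrow> d x' x0"
    by (rule tendsto_mdist[OF xl tendsto_const]) (use txy m' x0 in auto)
  ultimately have "d x' x0 = 0" using LIMSEQ_unique by blast
  then have x'x0: "x' = x0" using m' x0 by simp
  have "(\<lambda>j. t (r j) - t0) \<longlonglongrightarrow> 0"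
    by (rule tendsto_0_if_square_le[OF \<psi>0, where c=1])
       (use main pos in \<open>smt (verit) zero_le_power2\<close>)
  then have tl: "(\<lambda>j. t (r j)) \<longlonglongrightarrow> t0" by (simp add: LIM_zero_iff)
  note xl = xl[unfolded x'x0] and yl = yl[unfolded yx x'x0]
  have dy0: "(\<lambda>j. d (y (r j)) x0) \<longlonglongrightarrow> 0"
    using tendsto_mdist[OF yl tendsto_const, of x0] txy x0 by simp
  define \<sigma> where "\<sigma> z = enn2real (slope X d \<phi>\<^sub>1 z)" for z
  have sl: "slope X d \<phi>\<^sub>1 z = ennreal (\<sigma> z)" "\<sigma> z \<ge> 0" if "z \<in> X" for z
    using slope_finite[OF ll that] by (simp_all add: \<sigma>_def)
  have \<sigma>l: "(\<lambda>j. \<sigma> (y (r j))) \<longlonglongrightarrow> \<sigma> x0"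
  proof -
    have "(\<lambda>j. subslope X d \<phi>\<^sub>1 (y (r j))) \<longlonglongrightarrow> subslope X d \<phi>\<^sub>1 x0"
      by (rule continuous_on_tendsto_compose[OF subc yl x0]) (use txy in auto)
    then have "(\<lambda>j. ennreal (\<sigma> (y (r j)))) \<longlonglongrightarrow> ennreal (\<sigma> x0)"
      using eqs[symmetric] sl(1) txy x0 by simp
    then show ?thesis by (rule tendsto_ennrealD) (use sl(2) txy x0 in auto)
  qed
  define P where "P j = d (x j) (y j) / \<epsilon> j" for j
  have diff: "\<bar>P j - \<sigma> (y j)\<bar> \<le> 2 * K * d (y j) x0" for j
  proof -
    have m: "\<phi>\<^sub>1 (y j) + K * (d (y j) x0)\<^sup>2 + (d (x j) (y j))\<^sup>2 / (2 * \<epsilon> j)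
        \<le> \<phi>\<^sub>1 z + K * (d z x0)\<^sup>2 + (d (x j) z)\<^sup>2 / (2 * \<epsilon> j)" if "z \<in> X" for z
      using mini[OF that, of j] by (simp add: \<psi>_def)
    have K0: "K \<ge> 0" using K by simp
    have "ennreal (\<sigma> (y j)) \<le> ennreal (P j + 2 * K * d (y j) x0)"
      using slope_at_penalized_minimum(1)[OF txy(2,3) x0 \<epsilon> K0 m] eqs[OF txy(3)] sl(1)[OF txy(3)]
      by (simp add: P_def)
    moreover have "0 \<le> P j + 2 * K * d (y j) x0" using \<epsilon>[of j] K0 by (simp add: P_def)
    ultimately have 1: "\<sigma> (y j) \<le> P j + 2 * K * d (y j) x0" by (simp add: ennreal_le_iff)
    have "ennreal (P j - 2 * K * d (y j) x0) \<le> ennreal (\<sigma> (y j))"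
      using slope_at_penalized_minimum(2)[OF txy(2,3) x0 \<epsilon> K0 m] sl(1)[OF txy(3)]
      by (simp add: P_def)
    then have "P j - 2 * K * d (y j) x0 \<le> \<sigma> (y j)"
      using sl(2)[OF txy(3), of j] by (simp add: ennreal_le_iff)
    with 1 show ?thesis by linarith
  qed
  have "(\<lambda>j. P (r j) - \<sigma> (y (r j))) \<longlonglongrightarrow> 0"
  proof (rule Lim_null_comparison)
    show "\<forall>\<^sub>F j in sequentially. norm (P (r j) - \<sigma> (y (r j))) \<le> 2 * K * d (y (r j)) x0"
      using diff by simp
    show "(\<lambda>j. 2 * K * d (y (r j)) x0) \<longlonglongrightarrow> 0" using tendsto_mult_left[OF dy0, of "2 * K"] by simp
  qed
  from tendsto_add[OF this \<sigma>l] have Pl: "(\<lambda>j. P (r j)) \<longlonglongrightarrow> \<sigma> x0" by simp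
  have "\<forall>\<^sub>F j in sequentially. t (r j) > a" "\<forall>\<^sub>F j in sequentially. t (r j) < b"
    using order_tendstoD[OF tl] ab by auto
  then have ev: "\<forall>\<^sub>F j in sequentially. \<theta>' (t (r j)) + G (x (r j)) (P (r j)) \<le> 0"
    by eventually_elim (use ineq in \<open>simp add: P_def\<close>)
  have "isCont \<theta>' t0" using \<theta>'c t0 by (simp add: continuous_on_eq_continuous_at)
  then have "(\<lambda>j. \<theta>' (t (r j))) \<longlonglongrightarrow> \<theta>' t0" using isCont_tendsto_compose tl by blast
  then have "(\<lambda>j. \<theta>' (t (r j)) + G (x (r j)) (P (r j))) \<longlonglongrightarrow> \<theta>' t0 + G x0 (\<sigma> x0)"
    by (intro tendsto_add G_tendsto xl Pl) (use txy x0 in auto)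
  from tendsto_upperbound[OF this ev] have "\<theta>' t0 + G x0 (\<sigma> x0) \<le> 0" by simp
  moreover have "\<theta>' t0 = deriv \<phi>\<^sub>2 t0" using DERIV_imp_deriv[OF D(1)[OF t0]] by (simp add: \<theta>'_def)
  ultimately show "deriv \<phi>\<^sub>2 t0 + G x0 (enn2real (slope X d \<phi>\<^sub>1 x0)) \<le> 0" by (simp add: \<sigma>_def)
qed

end

end


lemma continuous_on_if_usc_on_uminus:
  assumes "usc_on S f" "usc_on S (\<lambda>x. - f x)"
  shows "continuous_on S f"
  unfolding continuous_on_iff
proof (intro ballI allI impI)
  fix p and e :: real assume p: "p \<in> S" "0 < e"
  obtain r where r: "r > 0" "\<And>q. q \<in> S \<Longrightarrow> dist q p < r \<Longrightarrow> f q < f p + e"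
    using usc_onD[OF assms(1) p] by blast
  obtain r' where r': "r' > 0" "\<And>q. q \<in> S \<Longrightarrow> dist q p < r' \<Longrightarrow> - f q < - f p + e"
    using usc_onD[OF assms(2) p] by blast
  have "dist (f q) (f p) < e" if "q \<in> S" "dist q p < min r r'" for q
    using r(2)[of q] r'(2)[of q] that by (simp add: dist_real_def abs_less_iff)
  then show "\<exists>d>0. \<forall>q\<in>S. dist q p < d \<longrightarrow> dist (f q) (f p) < e"
    using r(1) r'(1) by (intro exI[of _ "min r r'"]) auto
qed

context relaxation
begin

lemma relaxed_le_continuous_bound:
  assumes b: "\<And>n q. q \<in> S n \<Longrightarrow> \<bar>v n q\<bar> \<le> B" and sub: "\<And>n. S n \<subseteq> Y"
    and f: "continuous_on Y f" and le: "\<And>n q. q \<in> S n \<Longrightarrow> v n q \<le> f q" and p: "p \<in> Y"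
  shows "upper_relaxed_limit S v p \<le> f p"
proof (rule field_le_epsilon)
  fix e :: real assume "e > 0"
  obtain r where r: "r > 0" "\<And>q. q \<in> Y \<Longrightarrow> dist q p < r \<Longrightarrow> f q < f p + e"
    using usc_onD[OF continuous_on_imp_usc_on[OF f] p \<open>e > 0\<close>] by blast
  show "upper_relaxed_limit S v p \<le> f p + e"
  proof (rule relaxed_le[where v=v, OF b p r(1), of 0])
    fix n q assume "q \<in> S n" "dist q p < r"
    then show "v n q \<le> f p + e" using r(2)[of q] le[of q n] sub by fastforce
  qed
qed

text \<open>The definition of the relaxed limit bounds \<open>v n\<close> from above near \<open>p\<close>, and that for \<open>- v n\<close> from
  below. This is how the agreement of the limits is turned back into convergence.\<close>

lemma relaxed_two_sided:
  assumes b: "\<And>n q. q \<in> S n \<Longrightarrow> \<bar>v n q\<bar> \<le> B" and p: "p \<in> Y"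
    and eq: "upper_relaxed_limit S (\<lambda>n q. - v n q) p = - upper_relaxed_limit S v p" and e: "e > 0"
  obtains r K where "r > 0"
    "\<And>n q. n \<ge> K \<Longrightarrow> q \<in> S n \<Longrightarrow> dist q p < r \<Longrightarrow> \<bar>v n q - upper_relaxed_limit S v p\<bar> < e"
proof -
  have b': "\<And>n q. q \<in> S n \<Longrightarrow> \<bar>- v n q\<bar> \<le> B" using b by simp
  obtain r K where r: "r > 0" "\<And>n q. n \<ge> K \<Longrightarrow> q \<in> S n \<Longrightarrow> dist q p < r \<Longrightarrow> v n q < upper_relaxed_limit S v p + e"
    using relaxed_upper[where v=v, OF b p e] by blast
  obtain r' K' where r': "r' > 0" "\<And>n q. n \<ge> K' \<Longrightarrow> q \<in> S n \<Longrightarrow> dist q p < r' \<Longrightarrow> - v n q < - upper_relaxed_limit S v p + e"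
    using relaxed_upper[where v="\<lambda>n q. - v n q", OF b' p e] unfolding eq by blast
  show thesis
  proof (rule that[of "min r r'" "max K K'"])
    fix n q assume "max K K' \<le> n" "q \<in> S n" "dist q p < min r r'"
    then have "v n q < upper_relaxed_limit S v p + e" "- v n q < - upper_relaxed_limit S v p + e"
      using r(2)[of n q] r'(2)[of n q] by auto
    then show "\<bar>v n q - upper_relaxed_limit S v p\<bar> < e" by (simp add: abs_less_iff)
  qed (use r r' in auto)
qed

end

context compact_geodesic_space
begin

text \<open>Relaxed limits carry no information outside \<open>{0..<T} \<times> X\<close>, where they are arbitrary; hence the
  identification of the two limits holds only inside, and the property has to be transferred.\<close>

lemma test_subsolution_cong:
  assumes "test_subsolution T X d G v" and eq: "\<And>t x. t \<in> {0<..<T} \<Longrightarrow> x \<in> X \<Longrightarrow> v (t, x) = v' (t, x)"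
  shows "test_subsolution T X d G v'"
  unfolding test_subsolution_def
proof (intro allI ballI impI, elim conjE)
  fix \<phi>\<^sub>1 \<phi>\<^sub>2 t x
  assume t: "t \<in> {0<..<T}" and x: "x \<in> X" and low: "lower_test T X d \<phi>\<^sub>1 \<phi>\<^sub>2"
    and lmax: "local_max_at (spacetime {0<..<T} X d) (\<lambda>(s, y). v' (s, y) - (\<phi>\<^sub>1 y + \<phi>\<^sub>2 s)) (t, x)"
  obtain O' where O': "openin (top_of_set ({0<..<T} \<times> X)) O'" "(t, x) \<in> O'"
      "\<forall>q\<in>O'. (\<lambda>(s, y). v' (s, y) - (\<phi>\<^sub>1 y + \<phi>\<^sub>2 s)) q \<le> (\<lambda>(s, y). v' (s, y) - (\<phi>\<^sub>1 y + \<phi>\<^sub>2 s)) (t, x)"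
    using lmax unfolding local_max_at_def spacetime_eq by blast
  have sub: "O' \<subseteq> {0<..<T} \<times> X" using openin_imp_subset[OF O'(1)] .
  have eq': "(\<lambda>(s, y). v (s, y) - (\<phi>\<^sub>1 y + \<phi>\<^sub>2 s)) q = (\<lambda>(s, y). v' (s, y) - (\<phi>\<^sub>1 y + \<phi>\<^sub>2 s)) q"
    if "q \<in> {0<..<T} \<times> X" for q using that eq by auto
  have "\<forall>q\<in>O'. (\<lambda>(s, y). v (s, y) - (\<phi>\<^sub>1 y + \<phi>\<^sub>2 s)) q \<le> (\<lambda>(s, y). v (s, y) - (\<phi>\<^sub>1 y + \<phi>\<^sub>2 s)) (t, x)"
  proof
    fix q assume q: "q \<in> O'"
    have m: "q \<in> {0<..<T} \<times> X" "(t, x) \<in> {0<..<T} \<times> X" using q O'(2) sub by auto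
    show "(\<lambda>(s, y). v (s, y) - (\<phi>\<^sub>1 y + \<phi>\<^sub>2 s)) q \<le> (\<lambda>(s, y). v (s, y) - (\<phi>\<^sub>1 y + \<phi>\<^sub>2 s)) (t, x)"
      unfolding eq'[OF m(1)] eq'[OF m(2)] using O'(3) q by (rule bspec)
  qed
  then have "local_max_at (spacetime {0<..<T} X d) (\<lambda>(s, y). v (s, y) - (\<phi>\<^sub>1 y + \<phi>\<^sub>2 s)) (t, x)"
    unfolding local_max_at_def spacetime_eq using O'(1,2) by (intro exI[of _ O'] conjI)
  then show "deriv \<phi>\<^sub>2 t + G x (enn2real (slope X d \<phi>\<^sub>1 x)) \<le> 0"
    using assms(1)[unfolded test_subsolution_def, rule_format, OF t x] low by blast
qed

lemma viscosity_solutionD: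
  assumes "viscosity_solution T X d H g u"
  shows "continuous_on ({0..<T} \<times> X) u" "\<And>x. x \<in> X \<Longrightarrow> u (0, x) = g x"
    "test_subsolution T X d H u" "test_subsolution T X d (\<lambda>x p. - H x p) (\<lambda>p. - u p)"
proof -
  note facts = assms[unfolded viscosity_solution_def viscosity_subsolution_iff
      viscosity_supersolution_iff spacetime_eq]
  show "continuous_on ({0..<T} \<times> X) u" using facts by simp
  show "u (0, x) = g x" if "x \<in> X" for x using facts that by (intro antisym) blast+
  show "test_subsolution T X d H u" "test_subsolution T X d (\<lambda>x p. - H x p) (\<lambda>p. - u p)"
    using facts by blast+
qed

lemma viscosity_solutionI:
  assumes c: "continuous_on ({0..<T} \<times> X) u" and b: "\<And>q. q \<in> {0..<T} \<times> X \<Longrightarrow> \<bar>u q\<bar> \<le> B"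
    and i: "\<And>x. x \<in> X \<Longrightarrow> u (0, x) = g x"
    and t: "test_subsolution T X d H u" "test_subsolution T X d (\<lambda>x p. - H x p) (\<lambda>p. - u p)"
  shows "viscosity_solution T X d H g u"
proof -
  let ?S = "top_of_set ({0..<T} \<times> X)"
  have cm: "continuous_map ?S euclideanreal u" using c by simp
  have "openin ?S {p \<in> topspace ?S. u p < a}" for a
    using openin_continuous_map_preimage[OF cm, of "{..<a}"] by simp
  then have usc: "usc_map ?S u" by (simp add: usc_map_def)
  have "openin ?S {p \<in> topspace ?S. u p > a}" for a
    using openin_continuous_map_preimage[OF cm, of "{a<..}"] by simp
  then have lsc: "lsc_map ?S u" by (simp add: lsc_map_def)
  have "\<exists>U B. openin ?S U \<and> p \<in> U \<and> (\<forall>q\<in>U. \<bar>u q\<bar> \<le> B)" if "p \<in> topspace ?S" for p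
    using that b by (intro exI[of _ "{0..<T} \<times> X"] exI[of _ B]) auto
  then have "locally_bounded_map ?S u" by (simp add: locally_bounded_map_def)
  then show ?thesis
    unfolding viscosity_solution_def viscosity_subsolution_iff viscosity_supersolution_iff spacetime_eq
    using usc lsc i t cm by simp
qed

end


section \<open>Convergence of solutions\<close>

context approximating_spaces
begin

text \<open>The upper relaxed limits \<open>w\<close> of \<open>u n\<close> and \<open>w'\<close> of \<open>- u n\<close> are subsolutions for \<open>H\<close> and \<open>- H\<close>.
  Comparison gives \<open>w + w' \<le> 0\<close>, and \<open>0 \<le> w + w'\<close> holds because the two limits are taken of
  opposite functions. Hence \<open>w' = - w\<close>, so \<open>w\<close> is continuous, solves the equation, and is the limit of
  \<open>u n\<close> uniformly on compact sets.\<close>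

theorem viscosity_solutions_converge:
  fixes u :: "nat \<Rightarrow> real \<times> 'a \<Rightarrow> real"
  assumes T: "T > 0" and mono: "\<And>n. Xn n \<subseteq> Xn (Suc n)"
    and dle: "\<And>n x y. x \<in> Xn n \<Longrightarrow> y \<in> Xn n \<Longrightarrow> d x y \<le> dn n x y"
    and V: "continuous_on X V" and H: "\<And>x p. H x p = p\<^sup>2 / 2 + V x"
    and lip: "\<And>x y. x \<in> X \<Longrightarrow> y \<in> X \<Longrightarrow> \<bar>g x - g y\<bar> \<le> L * d x y" and L: "L \<ge> 0"
    and sol: "\<And>n. viscosity_solution T (Xn n) (dn n) H g (u n)"
  shows "\<exists>w. viscosity_solution T X d H g w \<and> (\<forall>m. uniform_limit ({0..<T} \<times> Xn m) u w sequentially)"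
proof -
  have Heq: "H = (\<lambda>x p. p\<^sup>2 / 2 + V x)" by (intro ext) (rule H)
  have Xn_mono: "Xn m \<subseteq> Xn n" if "m \<le> n" for m n using lift_Suc_mono_le[of Xn, OF mono that] .
  obtain Vb where Vb: "\<And>x. x \<in> X \<Longrightarrow> \<bar>V x\<bar> \<le> Vb"
    using continuous_on_compact_bound[OF compact_space V] by blast
  define C where "C = L\<^sup>2 / 2 + \<bar>Vb\<bar>"
  have C: "L\<^sup>2 / 2 + \<bar>V x\<bar> \<le> C" if "x \<in> X" for x using Vb[OF that] by (simp add: C_def)
  have C0: "C \<ge> 0" by (simp add: C_def)
  have gc: "continuous_on X g"
  proof (rule locally_lipschitz_continuous)
    show "locally_lipschitz_wrt d X g"
      unfolding locally_lipschitz_wrt_def lipschitz_wrt_def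
      using lip by (intro ballI exI[of _ 1] conjI exI[of _ L]) auto
  qed
  obtain Bg where Bg: "\<And>x. x \<in> X \<Longrightarrow> \<bar>g x\<bar> \<le> Bg"
    using continuous_on_compact_bound[OF compact_space gc] by blast
  have uc: "continuous_on ({0..<T} \<times> Xn n) (u n)"
    and Q1: "quadratic_subsolution T (Xn n) (dn n) H (u n)"
    and Q2: "quadratic_subsolution T (Xn n) (dn n) (\<lambda>x p. - H x p) (\<lambda>p. - u n p)"
    and growth: "\<And>t x. t \<in> {0..<T} \<Longrightarrow> x \<in> Xn n \<Longrightarrow> \<bar>u n (t, x) - g x\<bar> \<le> C * t"
    and tlip: "\<And>s t x. s \<in> {0..<T} \<Longrightarrow> t \<in> {0..<T} \<Longrightarrow> x \<in> Xn n \<Longrightarrow> \<bar>u n (s, x) - u n (t, x)\<bar> \<le> C * \<bar>s - t\<bar>"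
    for n
  proof -
    interpret n: compact_geodesic_space "Xn n" "dn n" by (rule geodesic_n)
    note D = n.viscosity_solutionD[OF sol[of n]]
    show c: "continuous_on ({0..<T} \<times> Xn n) (u n)" by (rule D(1))
    show q1: "quadratic_subsolution T (Xn n) (dn n) H (u n)"
      by (rule n.quadratic_subsolution_if_test_subsolution[OF D(3)])
    show q2: "quadratic_subsolution T (Xn n) (dn n) (\<lambda>x p. - H x p) (\<lambda>p. - u n p)"
      by (rule n.quadratic_subsolution_if_test_subsolution[OF D(4)])
    have lip_n: "\<bar>g x - g y\<bar> \<le> L * dn n x y" if "x \<in> Xn n" "y \<in> Xn n" for x y
    proof -
      have "\<bar>g x - g y\<bar> \<le> L * d x y" using lip that subset_n by blast
      also have "\<dots> \<le> L * dn n x y" using dle[OF that] L by (rule mult_left_mono)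
      finally show ?thesis .
    qed
    have Vn: "continuous_on (Xn n) V" using continuous_on_subset[OF V subset_n] .
    have Cn: "L\<^sup>2 / 2 + \<bar>V x\<bar> \<le> C" if "x \<in> Xn n" for x using C subset_n that by blast
    note bounds = n.solution_bounds[OF c q1[unfolded Heq] q2[unfolded Heq] Vn Cn D(2) lip_n L]
    show "\<bar>u n (t, x) - g x\<bar> \<le> C * t" if "t \<in> {0..<T}" "x \<in> Xn n" for t x
      using bounds(1) that by blast
    show "\<bar>u n (s, x) - u n (t, x)\<bar> \<le> C * \<bar>s - t\<bar>" if "s \<in> {0..<T}" "t \<in> {0..<T}" "x \<in> Xn n" for s t x
      using bounds(2) that by blast
  qed
  define B where "B = Bg + C * T"
  have ub: "\<bar>u n q\<bar> \<le> B" if q: "q \<in> {0..<T} \<times> Xn n" for n q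
  proof -
    obtain t x where tx: "q = (t, x)" "t \<in> {0..<T}" "x \<in> Xn n" using q by auto
    have "C * t \<le> C * T" using C0 tx(2) by (intro mult_left_mono) auto
    moreover have "x \<in> X" using subset_n tx(3) by blast
    ultimately show ?thesis using growth[OF tx(2,3)] Bg[of x] unfolding B_def tx(1) by linarith
  qed
  have ub': "\<bar>- u n q\<bar> \<le> B" if q: "q \<in> {0..<T} \<times> Xn n" for n q using ub[OF q] by simp
  interpret R: relaxation "\<lambda>n. {0..<T} \<times> Xn n" "{0..<T} \<times> X" B by (rule relaxation_spacetime)
  have SY: "{0..<T} \<times> Xn n \<subseteq> {0..<T} \<times> X" for n using subset_n by auto
  define w where "w = upper_relaxed_limit (\<lambda>n. {0..<T} \<times> Xn n) u"
  define w' where "w' = upper_relaxed_limit (\<lambda>n. {0..<T} \<times> Xn n) (\<lambda>n q. - u n q)"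
  have Hlim: "(\<lambda>k. H (x k) (p k)) \<longlonglongrightarrow> H x' p'"
    if "\<And>k. x k \<in> X" "x \<longlonglongrightarrow> x'" "x' \<in> X" "p \<longlonglongrightarrow> p'" for x :: "nat \<Rightarrow> 'a" and p x' p'
    unfolding Heq
    by (intro tendsto_intros continuous_on_tendsto_compose[OF V that(2,3)] that(4)) (use that(1) in auto)
  have test: "test_subsolution T X d H w"
    unfolding w_def by (rule test_subsolution_relaxed_limit[OF ub uc Q1 Hlim])
  have test': "test_subsolution T X d (\<lambda>x p. - H x p) w'"
    unfolding w'_def
  proof (rule test_subsolution_relaxed_limit[OF ub' _ Q2])
    show "continuous_on ({0..<T} \<times> Xn n) (\<lambda>q. - u n q)" for n by (intro continuous_intros uc)
    show "(\<lambda>k. - H (x k) (p k)) \<longlonglongrightarrow> - H x' p'"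
      if "\<And>k. x k \<in> X" "x \<longlonglongrightarrow> x'" "x' \<in> X" "p \<longlonglongrightarrow> p'" for x :: "nat \<Rightarrow> 'a" and p x' p'
      by (intro tendsto_minus Hlim that)
  qed
  have usc: "usc_on ({0..<T} \<times> X) w" "usc_on ({0..<T} \<times> X) w'"
    unfolding w_def w'_def by (rule R.usc_on_relaxed, erule ub ub')+
  have cf: "continuous_on ({0..<T} \<times> X) (\<lambda>q. f (snd q) + C * fst q)" if "continuous_on X f" for f
    by (intro continuous_intros continuous_on_compose2[OF that]) auto
  have init: "w (0, x) \<le> g x" "w' (0, x) \<le> - g x" if x: "x \<in> X" for x
  proof -
    have p: "(0, x) \<in> {0..<T} \<times> X" using x T by simp
    have "w (0, x) \<le> (\<lambda>q. g (snd q) + C * fst q) (0, x)"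
      unfolding w_def
    proof (rule R.relaxed_le_continuous_bound[where v=u, OF ub SY cf[OF gc] _ p])
      show "u n q \<le> g (snd q) + C * fst q" if "q \<in> {0..<T} \<times> Xn n" for n q
        using growth[of "fst q" "snd q" n] that by (auto simp: abs_le_iff)
    qed
    then show "w (0, x) \<le> g x" by simp
    have "w' (0, x) \<le> (\<lambda>q. - g (snd q) + C * fst q) (0, x)"
      unfolding w'_def
    proof (rule R.relaxed_le_continuous_bound[where v="\<lambda>n q. - u n q", OF ub' SY cf _ p])
      show "- u n q \<le> - g (snd q) + C * fst q" if "q \<in> {0..<T} \<times> Xn n" for n q
        using growth[of "fst q" "snd q" n] that by (auto simp: abs_le_iff)
      show "continuous_on X (\<lambda>x. - g x)" by (intro continuous_intros gc)
    qed
    then show "w' (0, x) \<le> - g x" by simp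
  qed
  have w': "w' (t, x) = - w (t, x)" if tx: "t \<in> {0..<T}" "x \<in> X" for t x
  proof -
    have "w (0 + t, x) + w' (0 + t, x) \<le> 0"
    proof (rule comparison[OF usc _ _ V])
      show "quadratic_subsolution T X d (\<lambda>x p. p\<^sup>2 / 2 + V x) w"
        using quadratic_subsolution_if_test_subsolution[OF test] unfolding Heq .
      show "quadratic_subsolution T X d (\<lambda>x p. - (p\<^sup>2 / 2 + V x)) w'"
        using quadratic_subsolution_if_test_subsolution[OF test'] unfolding Heq .
      show "w (0, x) + w' (0, x) \<le> 0" if "x \<in> X" for x using init[OF that] by linarith
    qed (use tx in auto)
    moreover have "0 \<le> w (t, x) + w' (t, x)"
      unfolding w_def w'_def by (rule R.relaxed_add_relaxed_uminus_ge_0[where v=u, OF ub]) (use tx in auto)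
    ultimately show ?thesis by simp
  qed
  have wc: "continuous_on ({0..<T} \<times> X) w"
  proof (rule continuous_on_if_usc_on_uminus[OF usc(1)])
    have "usc_on ({0..<T} \<times> X) w' \<longleftrightarrow> usc_on ({0..<T} \<times> X) (\<lambda>q. - w q)"
      unfolding usc_on_def using w' by (intro ball_cong all_cong ex_cong imp_cong refl conj_cong) auto
    then show "usc_on ({0..<T} \<times> X) (\<lambda>q. - w q)" using usc(2) by simp
  qed
  have close: "\<exists>r>0. \<exists>K. \<forall>n\<ge>K. \<forall>q\<in>{0..<T} \<times> Xn n. dist q p < r \<longrightarrow> \<bar>u n q - w p\<bar> < e"
    if p: "p \<in> {0..<T} \<times> X" and e: "e > 0" for p e
  proof -
    have eq: "upper_relaxed_limit (\<lambda>n. {0..<T} \<times> Xn n) (\<lambda>n q. - u n q) p = - upper_relaxed_limit (\<lambda>n. {0..<T} \<times> Xn n) u p"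
      using w' p unfolding w_def w'_def by auto
    show ?thesis unfolding w_def
    proof (rule R.relaxed_two_sided[where v=u, OF ub p eq e])
      fix r K
      assume "0 < r" "\<And>n q. K \<le> n \<Longrightarrow> q \<in> {0..<T} \<times> Xn n \<Longrightarrow> dist q p < r \<Longrightarrow>
        \<bar>u n q - upper_relaxed_limit (\<lambda>n. {0..<T} \<times> Xn n) u p\<bar> < e"
      then show "\<exists>r>0. \<exists>K. \<forall>n\<ge>K. \<forall>q\<in>{0..<T} \<times> Xn n. dist q p < r \<longrightarrow>
        \<bar>u n q - upper_relaxed_limit (\<lambda>n. {0..<T} \<times> Xn n) u p\<bar> < e"
        by (intro exI[of _ r] conjI exI[of _ K] allI ballI impI)
    qed
  qed
  have wlip: "\<bar>w (s, x) - w (t, x)\<bar> \<le> C * \<bar>s - t\<bar>"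
    if st: "s \<in> {0..<T}" "t \<in> {0..<T}" and x: "x \<in> Xn m" for s t x m
  proof -
    have conv: "(\<lambda>n. u n (t, x)) \<longlonglongrightarrow> w (t, x)" if "t \<in> {0..<T}" for t
    proof (rule LIMSEQ_I)
      fix e :: real assume "e > 0"
      have "(t, x) \<in> {0..<T} \<times> X" using that x subset_n by blast
      from close[OF this \<open>e > 0\<close>] obtain r K where
        r: "r > 0" "\<forall>n\<ge>K. \<forall>q\<in>{0..<T} \<times> Xn n. dist q (t, x) < r \<longrightarrow> \<bar>u n q - w (t, x)\<bar> < e" by blast
      have "norm (u n (t, x) - w (t, x)) < e" if "n \<ge> max m K" for n
      proof -
        have "x \<in> Xn n" using Xn_mono[of m n] x that by auto
        then show ?thesis using r that \<open>t \<in> {0..<T}\<close> by simp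
      qed
      then show "\<exists>no. \<forall>n\<ge>no. norm (u n (t, x) - w (t, x)) < e" by blast
    qed
    have "(\<lambda>n. \<bar>u n (s, x) - u n (t, x)\<bar>) \<longlonglongrightarrow> \<bar>w (s, x) - w (t, x)\<bar>"
      by (intro tendsto_intros conv st)
    moreover have "\<forall>\<^sub>F n in sequentially. \<bar>u n (s, x) - u n (t, x)\<bar> \<le> C * \<bar>s - t\<bar>"
      using eventually_ge_at_top[of m]
    proof eventually_elim
      case (elim n)
      then show ?case using tlip[OF st, of x n] Xn_mono[of m n] x by blast
    qed
    ultimately show ?thesis by (rule tendsto_upperbound) simp
  qed
  have "uniform_limit ({0..<T} \<times> Xn m) u w sequentially" for m
    unfolding uniform_limit_iff
  proof (intro allI impI, rule ccontr)
    fix e :: real assume e: "e > 0"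
    assume neg: "\<not> (\<forall>\<^sub>F n in sequentially. \<forall>q\<in>{0..<T} \<times> Xn m. dist (u n q) (w q) < e)"
    \<comment> \<open>Points of large deviation may approach the excluded time \<open>T\<close>. They are moved back by \<open>\<eta>\<close>,
        which changes \<open>u n\<close> and \<open>w\<close> by at most \<open>e / 4\<close> each, so that they stay in a compact set.\<close>
    define \<eta> where "\<eta> = e / (4 * (C + 1))"
    have \<eta>: "\<eta> > 0" "C * \<eta> \<le> e / 4"
      using e C0 by (auto simp: \<eta>_def field_simps)
    have "\<forall>k. \<exists>n\<ge>k. n \<ge> m \<and> (\<exists>q\<in>{0..<T} \<times> Xn m. e \<le> dist (u n q) (w q))"
    proof
      fix k
      obtain n where "n \<ge> max k m" "\<not> (\<forall>q\<in>{0..<T} \<times> Xn m. dist (u n q) (w q) < e)"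
        using neg unfolding eventually_sequentially by blast
      then show "\<exists>n\<ge>k. n \<ge> m \<and> (\<exists>q\<in>{0..<T} \<times> Xn m. e \<le> dist (u n q) (w q))"
        by (intro exI[of _ n]) (force simp: not_less)
    qed
    then obtain n q where nq: "\<And>k. n k \<ge> k" "\<And>k. n k \<ge> m" "\<And>k. q k \<in> {0..<T} \<times> Xn m"
      "\<And>k. e \<le> dist (u (n k) (q k)) (w (q k))" by metis
    define t where "t k = max 0 (fst (q k) - \<eta>)" for k
    define x where "x k = snd (q k)" for k
    define \<tau> where "\<tau> = max 0 (T - \<eta>)"
    have \<tau>T: "\<tau> < T" using \<eta> T by (simp add: \<tau>_def)
    have mem: "t k \<in> {0..\<tau>}" "x k \<in> Xn m" "fst (q k) \<in> {0..<T}" for k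
      using nq(3)[of k] \<eta> by (auto simp: t_def x_def \<tau>_def mem_Times_iff)
    have memX: "x k \<in> X" "x k \<in> Xn (n k)" for k
      using mem(2)[of k] subset_n Xn_mono[OF nq(2)[of k]] by blast+
    have tT: "t k \<in> {0..<T}" for k using mem(1)[of k] \<tau>T by auto
    have shift: "\<bar>fst (q k) - t k\<bar> \<le> \<eta>" for k
      using mem(3)[of k] \<eta>(1) by (auto simp: t_def)
    have sep: "e / 2 \<le> \<bar>u (n k) (t k, x k) - w (t k, x k)\<bar>" for k
    proof -
      have "C * \<bar>fst (q k) - t k\<bar> \<le> e / 4"
        using mult_left_mono[OF shift C0] \<eta>(2) by (rule order_trans)
      then have "\<bar>u (n k) (q k) - u (n k) (t k, x k)\<bar> \<le> e / 4" "\<bar>w (q k) - w (t k, x k)\<bar> \<le> e / 4"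
        using tlip[OF mem(3) tT memX(2), of k k k] wlip[OF mem(3) tT mem(2), of k k k]
        by (auto simp: x_def)
      then show ?thesis using nq(4)[of k] unfolding dist_real_def by linarith
    qed
    have "compact ({0..\<tau>} \<times> X)" by (intro compact_Times compact_Icc compact_space)
    then obtain p r where pr: "p \<in> {0..\<tau>} \<times> X" "strict_mono r" "((\<lambda>k. (t k, x k)) \<circ> r) \<longlonglongrightarrow> p"
      unfolding compact_def using mem memX by (elim allE[of _ "\<lambda>k. (t k, x k)"]) auto
    have lim: "(\<lambda>k. (t (r k), x (r k))) \<longlonglongrightarrow> p" using pr(3) by (simp add: comp_def)
    have p: "p \<in> {0..<T} \<times> X" using pr(1) \<tau>T by auto
    have "e / 4 > 0" using e by simp
    from close[OF p this] obtain \<rho> K where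
      \<rho>: "\<rho> > 0" "\<forall>n\<ge>K. \<forall>q\<in>{0..<T} \<times> Xn n. dist q p < \<rho> \<longrightarrow> \<bar>u n q - w p\<bar> < e / 4" by blast
    have "(\<lambda>k. w (t (r k), x (r k))) \<longlonglongrightarrow> w p"
      by (rule continuous_on_tendsto_compose[OF wc lim p]) (use tT memX in auto)
    from tendstoD[OF this \<open>e / 4 > 0\<close>] tendstoD[OF lim \<rho>(1)] eventually_ge_at_top[of K]
    have "\<forall>\<^sub>F k in sequentially. False"
    proof eventually_elim
      case (elim k)
      have "n (r k) \<ge> K" using nq(1)[of "r k"] seq_suble[OF pr(2), of k] elim(3) by linarith
      then have "\<bar>u (n (r k)) (t (r k), x (r k)) - w p\<bar> < e / 4"
        using \<rho>(2) elim(2) tT memX(2) by blast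
      then show ?case using sep[of "r k"] elim(1) unfolding dist_real_def by linarith
    qed
    then show False by simp
  qed
  moreover have "viscosity_solution T X d H g w"
  proof (rule viscosity_solutionI[OF wc _ _ test])
    show "\<bar>w q\<bar> \<le> B" if "q \<in> {0..<T} \<times> X" for q
      unfolding w_def by (rule R.relaxed_bounded[where v=u, OF ub that])
    show "w (0, x) = g x" if "x \<in> X" for x
      using init[OF that] w'[of 0 x] that T by simp
    show "test_subsolution T X d (\<lambda>x p. - H x p) (\<lambda>p. - w p)"
      by (rule test_subsolution_cong[OF test']) (use w' in auto)
  qed
  ultimately show ?thesis by blast
qed

end


section \<open>Networks\<close>

lemma network_graphD:
  assumes "network_graph V P"
  shows "finite P" "P \<noteq> {}" "\<And>p. p \<in> P \<Longrightarrow> p 0 \<in> V"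
    "\<And>v w. v \<in> V \<Longrightarrow> w \<in> V \<Longrightarrow> (v, w) \<in> (joined P)\<^sup>*"
    "\<And>p. p \<in> P \<Longrightarrow> path_image p = closed_segment (p 0) (p 1)"
proof -
  note facts = assms[unfolded network_graph_def]
  show "finite P" "P \<noteq> {}" using facts by simp_all
  show "p 0 \<in> V" if "p \<in> P" for p using facts that by simp
  show "(v, w) \<in> (joined P)\<^sup>*" if "v \<in> V" "w \<in> V" for v w using facts that by simp
  have "\<forall>p\<in>P. \<exists>a b. a \<noteq> b \<and> p = linepath a b" using facts by simp
  then show "path_image p = closed_segment (p 0) (p 1)" if "p \<in> P" for p
    using that by (auto simp: linepath_0' linepath_1')
qed

lemma compact_network:
  assumes "network_graph V P"
  shows "compact (network P)"
  unfolding network_def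
proof (rule compact_UN[OF network_graphD(1)[OF assms]])
  show "compact (path_image p)" if "p \<in> P" for p
    unfolding network_graphD(5)[OF assms that] by (rule compact_segment)
qed

lemma network_nonempty:
  assumes "network_graph V P"
  shows "network P \<noteq> {}"
proof -
  obtain p where p: "p \<in> P" using network_graphD(2)[OF assms] by blast
  then have "p 0 \<in> path_image p" using network_graphD(5)[OF assms p] by simp
  with p show ?thesis by (auto simp: network_def)
qed

lemma segment_subset_network:
  assumes "network_graph V P" "p \<in> P" "x \<in> path_image p" "y \<in> path_image p"
  shows "closed_segment x y \<subseteq> network P"
proof -
  have "closed_segment x y \<subseteq> path_image p"
    using assms network_graphD(5)[OF assms(1,2)]
    by (intro closed_segment_subset) auto
  then show ?thesis using assms(2) by (auto simp: network_def)
qed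

text \<open>Each point reaches an end of its segment, and the ends are joined by a path of edges.\<close>

lemma intrinsic_edist_network_finite:
  assumes G: "network_graph V P" and x: "x \<in> network P" and y: "y \<in> network P"
  shows "intrinsic_edist (network P) x y < \<infinity>"
proof -
  let ?e = "intrinsic_edist (network P)"
  have seg: "?e x y < \<infinity>" if "p \<in> P" "x \<in> path_image p" "y \<in> path_image p" for p x y
    using intrinsic_edist_segment[OF segment_subset_network[OF G that]] by (simp add: le_less_trans)
  have trans: "?e x z < \<infinity>" if "?e x y < \<infinity>" "?e y z < \<infinity>" for x y z
    using intrinsic_edist_triangle[of "network P" x z y] that by (simp add: le_less_trans)
  have ends: "p 0 \<in> path_image p" "p 1 \<in> path_image p" "p 0 \<in> V" if "p \<in> P" for p
    using network_graphD(3,5)[OF G that] by auto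
  have conn: "?e v w < \<infinity>" if "(v, w) \<in> (joined P)\<^sup>*" "?e v v < \<infinity>" for v w
    using that
  proof (induction rule: rtrancl_induct)
    case (step w z)
    then obtain p where p: "p \<in> P" "{p 0, p 1} = {w, z}" by (auto simp: joined_def)
    then have "?e w z < \<infinity>" using ends[OF p(1)] by (intro seg[OF p(1)]) (auto simp: doubleton_eq_iff)
    then show ?case using step trans by blast
  qed
  obtain p q where p: "p \<in> P" "x \<in> path_image p" and q: "q \<in> P" "y \<in> path_image q"
    using x y by (auto simp: network_def)
  have "?e (p 0) (q 0) < \<infinity>"
    by (rule conn[OF network_graphD(4)[OF G ends(3)[OF p(1)] ends(3)[OF q(1)]]
        seg[OF p(1) ends(1)[OF p(1)] ends(1)[OF p(1)]]])
  then show ?thesis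
    by (rule trans[OF seg[OF p(1,2) ends(1)[OF p(1)]] trans[OF _ seg[OF q(1) ends(1)[OF q(1)] q(2)]]])
qed

text \<open>Near a point \<open>x\<close> there are only the finitely many segments through \<open>x\<close>, along which the intrinsic
  distance to \<open>x\<close> is Euclidean. Hence both distances induce the same topology.\<close>

lemma compact_geodesic_space_network:
  fixes P :: "(real \<Rightarrow> 'a::euclidean_space) set"
  assumes G: "network_graph V P"
  shows "compact_geodesic_space (network P) (intrinsic_dist (network P))"
proof (rule compact_geodesic_space_intrinsic[OF compact_network[OF G] intrinsic_edist_network_finite[OF G]])
  fix x and e :: real assume x: "x \<in> network P" and e: "e > 0"
  let ?Q = "\<Union> (path_image ` {p \<in> P. x \<notin> path_image p})"
  have "closed ?Q"
    using network_graphD(1,5)[OF G] by (intro closed_Union) auto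
  then have "open (- ?Q)" by (rule open_Compl)
  moreover have "x \<in> - ?Q" by blast
  ultimately obtain r where r: "r > 0" "ball x r \<subseteq> - ?Q" by (rule openE)
  have "intrinsic_dist (network P) x y < e" if y: "y \<in> network P" "dist x y < min r e" for y
  proof -
    obtain p where p: "p \<in> P" "y \<in> path_image p" using y by (auto simp: network_def)
    have "y \<in> ball x r" using y by simp
    with r(2) have "y \<notin> ?Q" by blast
    with p have "x \<in> path_image p" by blast
    from intrinsic_edist_segment[OF segment_subset_network[OF G p(1) this p(2)]]
    have "intrinsic_dist (network P) x y \<le> dist x y"
      unfolding intrinsic_dist_def by (intro enn2real_leI) auto
    then show ?thesis using y by simp
  qed
  then show "\<exists>r>0. \<forall>y\<in>network P. dist x y < r \<longrightarrow> intrinsic_dist (network P) x y < e"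
    using r(1) e by (intro exI[of _ "min r e"]) auto
qed


section \<open>Hausdorff and intrinsic convergence\<close>

lemma hausdorff_edist_tendsto_0D:
  assumes "(\<lambda>n. hausdorff_edist (A n) B) \<longlonglongrightarrow> 0" "e > 0"
  shows "\<exists>K. \<forall>n\<ge>K. \<forall>a\<in>A n. \<exists>b\<in>B. dist a b < e"
    and "\<exists>K. \<forall>n\<ge>K. \<forall>b\<in>B. \<exists>a\<in>A n. dist a b < e"
proof -
  have "\<forall>\<^sub>F n in sequentially. hausdorff_edist (A n) B < ennreal e"
    using order_tendstoD(2)[OF assms(1)] assms(2) by simp
  then obtain K where K: "\<And>n. n \<ge> K \<Longrightarrow> hausdorff_edist (A n) B < ennreal e"
    by (auto simp: eventually_sequentially)
  have *: "(\<forall>a\<in>A n. \<exists>b\<in>B. dist a b < e) \<and> (\<forall>b\<in>B. \<exists>a\<in>A n. dist a b < e)" if n: "n \<ge> K" for n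
  proof -
    obtain \<epsilon> where \<epsilon>: "\<epsilon> > 0" "\<forall>a\<in>A n. \<exists>b\<in>B. dist a b \<le> \<epsilon>" "\<forall>b\<in>B. \<exists>a\<in>A n. dist a b \<le> \<epsilon>"
      "ennreal \<epsilon> < ennreal e"
      using K[OF n] unfolding hausdorff_edist_def INF_less_iff by blast
    then have "\<epsilon> < e" by (simp add: ennreal_less_iff)
    then show ?thesis using \<epsilon>(2,3) by (meson le_less_trans)
  qed
  show "\<exists>K. \<forall>n\<ge>K. \<forall>a\<in>A n. \<exists>b\<in>B. dist a b < e" using * by (intro exI[of _ K]) simp
  show "\<exists>K. \<forall>n\<ge>K. \<forall>b\<in>B. \<exists>a\<in>A n. dist a b < e" using * by (intro exI[of _ K]) simp
qed

text \<open>Hypotheses on full sequences are applied to a subsequence by filling the gaps with any sequence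
  that has the same limit.\<close>

lemma fill_subsequence:
  fixes a :: "'a::metric_space"
  assumes r: "strict_mono (r :: nat \<Rightarrow> nat)" and f: "f \<longlonglongrightarrow> a" and g: "g \<longlonglongrightarrow> a"
  shows "(\<lambda>n. if n \<in> range r then f (inv r n) else g n) \<longlonglongrightarrow> a"
  unfolding LIMSEQ_def
proof (intro allI impI)
  fix e :: real assume e: "e > 0"
  obtain K where K: "\<And>k. k \<ge> K \<Longrightarrow> dist (f k) a < e" using f e unfolding LIMSEQ_def by blast
  obtain K' where K': "\<And>k. k \<ge> K' \<Longrightarrow> dist (g k) a < e" using g e unfolding LIMSEQ_def by blast
  have "dist (if n \<in> range r then f (inv r n) else g n) a < e" if n: "n \<ge> max (r K) K'" for n
  proof (cases "n \<in> range r")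
    case True
    then obtain k where k: "n = r k" by blast
    then have "inv r n = k" using strict_mono_imp_inj_on[OF r] by (simp add: inv_f_f)
    moreover have "k \<ge> K" using n k strict_mono_less_eq[OF r] by simp
    ultimately show ?thesis using True K by simp
  qed (use n K' in auto)
  then show "\<exists>no. \<forall>n\<ge>no. dist (if n \<in> range r then f (inv r n) else g n) a < e" by blast
qed

text \<open>If uniformity failed, pairs of points with a large discrepancy would exist for infinitely many
  \<open>n\<close>. By compactness a subsequence of these pairs converges, and along it both distances tend to
  the distance of the limits.\<close>

lemma intrinsic_dist_uniform_convergence:
  fixes N :: "'a::euclidean_space set"
  assumes geo: "compact_geodesic_space N (intrinsic_dist N)"
    and fin: "\<And>x y. x \<in> N \<Longrightarrow> y \<in> N \<Longrightarrow> intrinsic_edist N x y < \<infinity>"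
    and sub: "\<And>n. Nn n \<subseteq> N"
    and recov: "\<And>x. x \<in> N \<Longrightarrow> \<exists>a. (\<forall>n. a n \<in> Nn n) \<and> a \<longlonglongrightarrow> x"
    and conv: "\<And>(a :: nat \<Rightarrow> 'a) b a' b'.
           (\<And>n. a n \<in> Nn n) \<Longrightarrow> (\<And>n. b n \<in> Nn n) \<Longrightarrow> a' \<in> N \<Longrightarrow> b' \<in> N \<Longrightarrow>
           a \<longlonglongrightarrow> a' \<Longrightarrow> b \<longlonglongrightarrow> b' \<Longrightarrow>
           (\<lambda>n. intrinsic_edist (Nn n) (a n) (b n)) \<longlonglongrightarrow> intrinsic_edist N a' b'"
    and e: "e > 0"
  shows "\<exists>K. \<forall>n\<ge>K. \<forall>x\<in>Nn n. \<forall>y\<in>Nn n. \<bar>intrinsic_dist (Nn n) x y - intrinsic_dist N x y\<bar> < e"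
proof (rule ccontr)
  define d where "d = intrinsic_dist N"
  define dn where "dn n = intrinsic_dist (Nn n)" for n
  interpret compact_geodesic_space N d unfolding d_def by (rule geo)
  assume neg: "\<not> ?thesis"
  define Bad where "Bad = {n. \<exists>x\<in>Nn n. \<exists>y\<in>Nn n. e \<le> \<bar>dn n x y - d x y\<bar>}"
  have "\<exists>n\<ge>K. n \<in> Bad" for K
    using neg unfolding Bad_def d_def dn_def by (force simp: not_less)
  then have "infinite Bad" by (meson finite_nat_set_iff_bounded not_less)
  then obtain r :: "nat \<Rightarrow> nat" where r: "strict_mono r" "\<And>k. r k \<in> Bad"
    using infinite_enumerate by blast
  then have "\<forall>k. \<exists>x y. x \<in> Nn (r k) \<and> y \<in> Nn (r k) \<and> e \<le> \<bar>dn (r k) x y - d x y\<bar>"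
    unfolding Bad_def by blast
  then obtain x y where xy: "\<And>k. x k \<in> Nn (r k)" "\<And>k. y k \<in> Nn (r k)"
      "\<And>k. e \<le> \<bar>dn (r k) (x k) (y k) - d (x k) (y k)\<bar>" by metis
  have xyN: "x k \<in> N" "y k \<in> N" for k using xy(1,2)[of k] sub by blast+
  have "compact (N \<times> N)" by (intro compact_Times compact_space)
  then obtain p l where pl: "p \<in> N \<times> N" "strict_mono l" "((\<lambda>k. (x k, y k)) \<circ> l) \<longlonglongrightarrow> p"
    unfolding compact_def using xyN by (elim allE[of _ "\<lambda>k. (x k, y k)"]) auto
  define a where "a = fst p"
  define b where "b = snd p"
  have ab: "a \<in> N" "b \<in> N" using pl(1) by (auto simp: a_def b_def)
  have xl: "(\<lambda>k. x (l k)) \<longlonglongrightarrow> a" and yl: "(\<lambda>k. y (l k)) \<longlonglongrightarrow> b"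
    using tendsto_fst[OF pl(3)] tendsto_snd[OF pl(3)] by (simp_all add: a_def b_def comp_def)
  define \<rho> where "\<rho> = r \<circ> l"
  have \<rho>: "strict_mono \<rho>" unfolding \<rho>_def using r(1) pl(2) by (rule strict_mono_o)
  have inv\<rho>: "inv \<rho> (\<rho> k) = k" for k using strict_mono_imp_inj_on[OF \<rho>] by (simp add: inv_f_f)
  obtain \<alpha> \<beta> where \<alpha>: "\<And>n. \<alpha> n \<in> Nn n" "\<alpha> \<longlonglongrightarrow> a" and \<beta>: "\<And>n. \<beta> n \<in> Nn n" "\<beta> \<longlonglongrightarrow> b"
    using recov ab by metis
  define A where "A n = (if n \<in> range \<rho> then x (l (inv \<rho> n)) else \<alpha> n)" for n
  define B where "B n = (if n \<in> range \<rho> then y (l (inv \<rho> n)) else \<beta> n)" for n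
  have A\<rho>: "A (\<rho> k) = x (l k)" "B (\<rho> k) = y (l k)" for k by (simp_all add: A_def B_def inv\<rho>)
  have AB: "A n \<in> Nn n" "B n \<in> Nn n" for n
  proof -
    have "A n \<in> Nn n \<and> B n \<in> Nn n"
    proof (cases "n \<in> range \<rho>")
      case True
      then obtain k where "n = \<rho> k" by blast
      then show ?thesis using xy(1,2)[of "l k"] A\<rho>[of k] by (simp add: \<rho>_def)
    qed (use \<alpha> \<beta> in \<open>auto simp: A_def B_def\<close>)
    then show "A n \<in> Nn n" "B n \<in> Nn n" by auto
  qed
  have lim: "A \<longlonglongrightarrow> a" "B \<longlonglongrightarrow> b"
    unfolding A_def B_def by (rule fill_subsequence[OF \<rho>] xl yl \<alpha> \<beta>)+
  have "(\<lambda>n. intrinsic_edist (Nn n) (A n) (B n)) \<longlonglongrightarrow> ennreal (d a b)"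
    using conv[OF AB ab lim] intrinsic_edist_eq[OF fin[OF ab]] by (simp add: d_def)
  then have "(\<lambda>n. dn n (A n) (B n)) \<longlonglongrightarrow> d a b"
    unfolding dn_def intrinsic_dist_def by (rule tendsto_enn2real) simp
  then have "(\<lambda>k. dn (\<rho> k) (A (\<rho> k)) (B (\<rho> k))) \<longlonglongrightarrow> d a b"
    using LIMSEQ_subseq_LIMSEQ[OF _ \<rho>] by (simp add: comp_def)
  moreover have "(\<lambda>k. d (x (l k)) (y (l k))) \<longlonglongrightarrow> d a b"
    by (rule tendsto_mdist[OF xl yl]) (use xyN ab in auto)
  ultimately have "(\<lambda>k. \<bar>dn (\<rho> k) (x (l k)) (y (l k)) - d (x (l k)) (y (l k))\<bar>) \<longlonglongrightarrow> \<bar>d a b - d a b\<bar>"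
    unfolding A\<rho> by (intro tendsto_intros)
  moreover have "e \<le> \<bar>dn (\<rho> k) (x (l k)) (y (l k)) - d (x (l k)) (y (l k))\<bar>" for k
    using xy(3)[of "l k"] by (simp add: \<rho>_def)
  ultimately have "e \<le> \<bar>d a b - d a b\<bar>" by (intro LIMSEQ_le_const) auto
  then show False using e by simp
qed


section \<open>Convergence on expanding networks\<close>

text \<open>The networks increase and converge to the closed set \<open>N\<close> in the Hausdorff distance, so they are
  contained in \<open>N\<close> and exhaust it up to small errors. The finite diameter makes the intrinsic metric of
  \<open>N\<close> real-valued, and the hypothesis on Euclidean convergence makes its topology Euclidean. Thus the
  general convergence theorem applies.\<close>

theorem theorem1p1:
  fixes T :: real
    and Vs :: "nat \<Rightarrow> (real ^ 'd) set"
    and Ps :: "nat \<Rightarrow> (real \<Rightarrow> real ^ 'd) set"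
    and Nn :: "nat \<Rightarrow> (real ^ 'd) set"
    and N :: "(real ^ 'd) set"
    and V g :: "real ^ 'd \<Rightarrow> real"
    and H :: "real ^ 'd \<Rightarrow> real \<Rightarrow> real"
    and u :: "nat \<Rightarrow> real \<times> (real ^ 'd) \<Rightarrow> real"
  assumes "T > 0"
    and "expanding_network Vs Ps"
    and "\<And>n. Nn n = network (Ps n)"
    and "compact N"
    and "(\<lambda>n. hausdorff_edist (Nn n) N) \<longlonglongrightarrow> 0"
    and "\<And>(a :: nat \<Rightarrow> real ^ 'd) b a' b'.
           (\<And>n. a n \<in> Nn n) \<Longrightarrow> (\<And>n. b n \<in> Nn n) \<Longrightarrow> a' \<in> N \<Longrightarrow> b' \<in> N \<Longrightarrow>
           (\<lambda>n. intrinsic_edist N (a n) a') \<longlonglongrightarrow> 0 \<Longrightarrow>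
           (\<lambda>n. intrinsic_edist N (b n) b') \<longlonglongrightarrow> 0 \<Longrightarrow>
           (\<lambda>n. intrinsic_edist (Nn n) (a n) (b n)) \<longlonglongrightarrow> intrinsic_edist N a' b'"
    and "\<And>(a :: nat \<Rightarrow> real ^ 'd) b.
           (\<And>n. a n \<in> N) \<Longrightarrow> (\<And>n. b n \<in> N) \<Longrightarrow>
           (\<lambda>n. dist (a n) (b n)) \<longlonglongrightarrow> 0 \<Longrightarrow>
           (\<lambda>n. intrinsic_edist N (a n) (b n)) \<longlonglongrightarrow> 0"
    and "\<exists>C>0. \<forall>a\<in>N. \<forall>b\<in>N. intrinsic_edist N a b \<le> ennreal C"
    and "continuous_on N V"
    and "\<And>x p. H x p = 1 / 2 * p\<^sup>2 + V x"
    and "lipschitz_wrt (intrinsic_dist N) N g"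
    and "\<And>n. viscosity_solution T (Nn n) (intrinsic_dist (Nn n)) H g (u n)"
  shows "\<exists>w. viscosity_solution T N (intrinsic_dist N) H g w \<and>
             (\<forall>m. uniform_limit ({0..<T} \<times> Nn m) u w sequentially)"
proof -
  note T = assms(1) and Nn = assms(3) and comp = assms(4) and haus = assms(5)
    and conv = assms(6) and top = assms(7)
  have graph: "network_graph (Vs n) (Ps n)" for n using assms(2) by (simp add: expanding_network_def)
  have mono: "Nn n \<subseteq> Nn (Suc n)" for n using assms(2) Nn by (simp add: expanding_network_def)
  have Nn_mono: "Nn m \<subseteq> Nn n" if "m \<le> n" for m n using lift_Suc_mono_le[of Nn, OF mono that] .
  have fin: "intrinsic_edist N x y < \<infinity>" if "x \<in> N" "y \<in> N" for x y
  proof -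
    obtain C where "intrinsic_edist N x y \<le> ennreal C" using assms(8) \<open>x \<in> N\<close> \<open>y \<in> N\<close> by blast
    then show ?thesis by (simp add: le_less_trans)
  qed
  have fin_n: "intrinsic_edist (Nn n) x y < \<infinity>" if "x \<in> Nn n" "y \<in> Nn n" for n x y
    using intrinsic_edist_network_finite[OF graph] that unfolding Nn by blast
  have geo_n: "compact_geodesic_space (Nn n) (intrinsic_dist (Nn n))" for n
    unfolding Nn by (rule compact_geodesic_space_network[OF graph])
  have sub: "Nn n \<subseteq> N" for n
  proof
    fix x assume x: "x \<in> Nn n"
    have "\<exists>y\<in>N. dist y x < e" if e: "e > 0" for e
    proof -
      obtain K where K: "\<forall>n\<ge>K. \<forall>a\<in>Nn n. \<exists>b\<in>N. dist a b < e"
        using hausdorff_edist_tendsto_0D(1)[OF haus e] by (rule exE)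
      have "x \<in> Nn (max n K)" using Nn_mono[of n "max n K"] x by auto
      moreover have "max n K \<ge> K" by simp
      ultimately have "\<exists>b\<in>N. dist x b < e" using K by blast
      then show ?thesis by (simp add: dist_commute)
    qed
    then have "x \<in> closure N" by (simp add: closure_approachable)
    then show "x \<in> N" using comp by (simp add: compact_imp_closed)
  qed
  have cont: "\<exists>r>0. \<forall>y\<in>N. dist x y < r \<longrightarrow> intrinsic_dist N x y < e" if x: "x \<in> N" and e: "e > 0" for x e
  proof (rule ccontr)
    assume neg: "\<not> ?thesis"
    have "\<exists>y\<in>N. dist x y < inverse (real (Suc k)) \<and> e \<le> intrinsic_dist N x y" for k
      using neg by (metis inverse_positive_iff_positive not_less of_nat_0_less_iff zero_less_Suc)
    then obtain y where y: "\<And>k. y k \<in> N" "\<And>k. dist x (y k) < inverse (real (Suc k))"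
      "\<And>k. e \<le> intrinsic_dist N x (y k)" by metis
    have "(\<lambda>k. dist x (y k)) \<longlonglongrightarrow> 0"
      by (rule tendsto_sandwich[OF _ _ tendsto_const LIMSEQ_inverse_real_of_nat])
         (use less_imp_le[OF y(2)] in auto)
    then have "(\<lambda>k. intrinsic_edist N x (y k)) \<longlonglongrightarrow> ennreal 0" using top[of "\<lambda>_. x" y] x y(1) by simp
    then have "(\<lambda>k. intrinsic_dist N x (y k)) \<longlonglongrightarrow> 0"
      unfolding intrinsic_dist_def by (rule tendsto_enn2real) simp
    then have "e \<le> 0" by (rule LIMSEQ_le_const) (use y(3) in auto)
    then show False using e by simp
  qed
  have geo: "compact_geodesic_space N (intrinsic_dist N)"
    by (rule compact_geodesic_space_intrinsic[OF comp fin cont])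
  have dense: "\<exists>K. \<forall>n\<ge>K. \<exists>y\<in>Nn n. dist y x < e" if x: "x \<in> N" and e: "e > 0" for x e
  proof -
    from hausdorff_edist_tendsto_0D(2)[OF haus e] x show ?thesis by (elim exE) blast
  qed
  have conv': "(\<lambda>n. intrinsic_edist (Nn n) (a n) (b n)) \<longlonglongrightarrow> intrinsic_edist N a' b'"
    if ab: "\<And>n. a n \<in> Nn n" "\<And>n. b n \<in> Nn n" "a' \<in> N" "b' \<in> N" "a \<longlonglongrightarrow> a'" "b \<longlonglongrightarrow> b'" for a b a' b'
  proof (rule conv[OF ab(1-4)])
    have "(\<lambda>n. dist (a n) a') \<longlonglongrightarrow> 0" "(\<lambda>n. dist (b n) b') \<longlonglongrightarrow> 0"
      using ab(5,6) by (auto simp: tendsto_dist_iff[symmetric])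
    then show "(\<lambda>n. intrinsic_edist N (a n) a') \<longlonglongrightarrow> 0" "(\<lambda>n. intrinsic_edist N (b n) b') \<longlonglongrightarrow> 0"
      using top[of a "\<lambda>_. a'"] top[of b "\<lambda>_. b'"] ab sub by blast+
  qed
  have recov: "\<exists>a. (\<forall>n. a n \<in> Nn n) \<and> a \<longlonglongrightarrow> x" if "x \<in> N" for x
    by (rule converging_sequence_in_sets[OF _ _ dense[OF that]])
      (use compact_network[OF graph] network_nonempty[OF graph] in \<open>auto simp: Nn\<close>)
  have "approximating_spaces N (intrinsic_dist N) Nn (\<lambda>n. intrinsic_dist (Nn n))"
  proof (intro approximating_spaces.intro geo approximating_spaces_axioms.intro geo_n sub dense)
    show "Nn n \<noteq> {}" for n using network_nonempty[OF graph] by (simp add: Nn)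
    show "\<exists>K. \<forall>n\<ge>K. \<forall>x\<in>Nn n. \<forall>y\<in>Nn n. \<bar>intrinsic_dist (Nn n) x y - intrinsic_dist N x y\<bar> < e"
      if "e > 0" for e
      by (rule intrinsic_dist_uniform_convergence[OF geo fin sub recov conv' that])
  qed
  then interpret approximating_spaces N "intrinsic_dist N" Nn "\<lambda>n. intrinsic_dist (Nn n)" .
  obtain L where L: "\<And>x y. x \<in> N \<Longrightarrow> y \<in> N \<Longrightarrow> \<bar>g x - g y\<bar> \<le> L * intrinsic_dist N x y"
    using assms(11) unfolding lipschitz_wrt_def by blast
  show ?thesis
  proof (rule viscosity_solutions_converge[OF T mono _ assms(9) _ _ _ assms(12), where L="max L 0"])
    show "intrinsic_dist N x y \<le> intrinsic_dist (Nn n) x y" if "x \<in> Nn n" "y \<in> Nn n" for n x y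
      unfolding intrinsic_dist_def
      by (rule enn2real_mono[OF intrinsic_edist_mono[OF sub]]) (use fin_n[OF that] in simp)
    show "H x p = p\<^sup>2 / 2 + V x" for x p using assms(10) by simp
    show "\<bar>g x - g y\<bar> \<le> max L 0 * intrinsic_dist N x y" if "x \<in> N" "y \<in> N" for x y
      using L[OF that] mult_right_mono[of L "max L 0" "intrinsic_dist N x y"] by (simp add: intrinsic_dist_def)
  qed simp
qed

end
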